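(* Let $S$ be an $m$-Koszul Artin-Schelter regular algebra of dimension $d$ and Gorenstein parameter $\ell$, let $V=S_1$, and let $\mathsf{w}\in V^{\otimes \ell}$ be a basis of the one-dimensional space $\bigcap_{s+t=\ell-m}V^{\otimes s}\otimes R\otimes V^{\otimes t}$, where $R=\ker(V^{\otimes m}\to S_m)$. Then $$\operatorname{Aut}(S)=\{\sigma\in \operatorname{GL}(V)\;|\;\sigma^{\otimes \ell}(k\mathsf{w})=k\mathsf{w}\}.$$
   Context: $k$ is a field; all vector spaces and algebras are over $k$. Algebras are $\mathbb{N}$-graded, $A=\bigoplus_{i\ge 0}A_i$; $A$ is connected if $A_0=k$, and then $k=A/A_{\ge 1}$. Shifts: $M(n)_i=M_{n+i}$. A connected graded algebra $A$ is $m$-Koszul ($m\ge 2$) if it is finitely presented, its relations are homogeneous of degree $m$ (so $A\cong TV/(R)$ with $V=A_1$ finite dimensional, $R\subseteq V^{\otimes m}$), and $\operatorname{Ext}^i_A(k,k)$ is concentrated in a single degree for every $i$. It is Artin-Schelter (AS) regular of dimension $d$ with Gorenstein parameter $\ell$ if $\operatorname{gldim}(A)=d<\infty$, $\operatorname{Ext}^d_A(k,A)\cong k(\ell)$ and $\operatorname{Ext}^i_A(k,A)=0$ for $i\ne d$; no noetherian hypothesis is made. For the algebra $S$: $V=S_1$, $R=\ker(V^{\otimes m}\to S_m)$ (multiplication), so $S\cong TV/(R)$; $\ell\ge m$; the space $\bigcap_{s+t=\ell-m}V^{\otimes s}\otimes R\otimes V^{\otimes t}\subseteq V^{\otimes \ell}$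 (intersection over integers $s,t\ge 0$) is one-dimensional. $\operatorname{Aut}(S)$ is the group of graded $k$-algebra automorphisms of $S$, identified via $\sigma\mapsto\sigma|_V$ with the subgroup $\{\sigma\in\operatorname{GL}(V)\;|\;\sigma^{\otimes m}(R)=R\}$ of $\operatorname{GL}(V)$. *)

theory Defs
  imports Complex_Main "HOL-Library.Function_Algebras" "HOL-Library.FuncSet"
    "HOL-Library.Extended_Nat"
begin

section \<open>Connected graded algebras\<close>

definition add_subgroup :: "'m::ab_group_add set \<Rightarrow> bool" where
  "add_subgroup C \<longleftrightarrow> 0 \<in> C \<and> (\<forall>x\<in>C. \<forall>y\<in>C. x + y \<in> C) \<and> (\<forall>x\<in>C. - x \<in> C)"

definition internal_direct_sum :: "('i \<Rightarrow> 'm::ab_group_add set) \<Rightarrow> 'm set \<Rightarrow> bool" where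
  "internal_direct_sum D C \<longleftrightarrow>
     (\<forall>i. D i \<subseteq> C \<and> add_subgroup (D i)) \<and>
     (\<forall>x\<in>C. \<exists>!f. (\<forall>i. f i \<in> D i) \<and> finite {i. f i \<noteq> 0} \<and> x = (\<Sum>i | f i \<noteq> 0. f i))"

locale connected_graded_algebra = vector_space scale
  for scale :: "'k::field \<Rightarrow> 's::ring_1 \<Rightarrow> 's" +
  fixes gr :: "nat \<Rightarrow> 's set"
  assumes scale_mult_left: "scale c a * b = scale c (a * b)"
    and scale_mult_right: "a * scale c b = scale c (a * b)"
    and subspace_gr: "subspace (gr i)"
    and direct_sum_gr: "internal_direct_sum gr UNIV"
    and mult_gr: "\<lbrakk>a \<in> gr i; b \<in> gr j\<rbrakk> \<Longrightarrow> a * b \<in> gr (i + j)"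
    and connected: "gr 0 = range (\<lambda>c. scale c 1)"

text \<open>The augmentation $A \to A/A_{\ge 1} = k$.\<close>

definition augmentation ::
    "('k::field \<Rightarrow> 's::ring_1 \<Rightarrow> 's) \<Rightarrow> (nat \<Rightarrow> 's set) \<Rightarrow> 's \<Rightarrow> 'k" where
  "augmentation scale gr a = (THE c. a - scale c 1 \<in> module.span scale (\<Union>i\<in>{1..}. gr i))"

definition linear_on ::
    "('k \<Rightarrow> 's::ab_group_add \<Rightarrow> 's) \<Rightarrow> 's set \<Rightarrow> ('k \<Rightarrow> 't::ab_group_add \<Rightarrow> 't) \<Rightarrow> ('s \<Rightarrow> 't) \<Rightarrow> bool" where
  "linear_on scale V scale' f \<longleftrightarrow>
     (\<forall>x\<in>V. \<forall>y\<in>V. f (x + y) = f x + f y) \<and> (\<forall>c. \<forall>x\<in>V. f (scale c x) = scale' c (f x))"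

definition graded_algebra_aut ::
    "('k::field \<Rightarrow> 's::ring_1 \<Rightarrow> 's) \<Rightarrow> (nat \<Rightarrow> 's set) \<Rightarrow> ('s \<Rightarrow> 's) set" where
  "graded_algebra_aut scale gr =
     {\<sigma>. bij \<sigma> \<and> linear_on scale UNIV scale \<sigma> \<and> \<sigma> 1 = 1 \<and> (\<forall>a b. \<sigma> (a * b) = \<sigma> a * \<sigma> b) \<and>
         (\<forall>i. \<sigma> ` gr i = gr i)}"

text \<open>Elements of $GL(V)$ for a subspace $V$, made unique by being undefined outside $V$.\<close>

definition GL :: "('k::field \<Rightarrow> 's::ab_group_add \<Rightarrow> 's) \<Rightarrow> 's set \<Rightarrow> ('s \<Rightarrow> 's) set" where
  "GL scale V = {\<sigma> \<in> extensional V. bij_betw \<sigma> V V \<and> linear_on scale V scale \<sigma>}"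


section \<open>The tensor algebra\<close>

text \<open>
  Over a field, $V^{\otimes n}$ embeds canonically into the $n$-multilinear forms on the dual
  $V^*$, by $(v_1 \otimes \dots \otimes v_n)(f_1,\dots,f_n) = f_1(v_1) \cdots f_n(v_n)$; this is
  injective for every $V$.  Below, $TV = \bigoplus_n V^{\otimes n}$ is the span of the pure tensors
  in the functions on lists of functionals; $V^{\otimes n}$ consists of functions supported on lists
  of length $n$.  Functionals on $V$ are functions on the ambient type that are linear on $V$;
  their values outside $V$ play no role.
\<close>

type_synonym ('s, 'k) tensor = "('s \<Rightarrow> 'k) list \<Rightarrow> 'k"

abbreviation tscale :: "'k::field \<Rightarrow> ('s, 'k) tensor \<Rightarrow> ('s, 'k) tensor" where
  "tscale \<equiv> (\<lambda>c T fs. c * T fs)"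

global_interpretation tens: vector_space "tscale :: 'k::field \<Rightarrow> ('s, 'k) tensor \<Rightarrow> ('s, 'k) tensor"
  by unfold_locales (auto simp: fun_eq_iff algebra_simps)

definition dual :: "('k::field \<Rightarrow> 's::ab_group_add \<Rightarrow> 's) \<Rightarrow> 's set \<Rightarrow> ('s \<Rightarrow> 'k) set" where
  "dual scale V = {f. linear_on scale V (*) f}"

definition pure_tensor ::
    "('k::field \<Rightarrow> 's::ab_group_add \<Rightarrow> 's) \<Rightarrow> 's set \<Rightarrow> 's list \<Rightarrow> ('s, 'k) tensor" where
  "pure_tensor scale V vs = (\<lambda>fs.
     if length fs = length vs \<and> set fs \<subseteq> dual scale V
     then prod_list (map2 (\<lambda>f v. f v) fs vs) else 0)"

definition tensor_power ::
    "('k::field \<Rightarrow> 's::ab_group_add \<Rightarrow> 's) \<Rightarrow> 's set \<Rightarrow> nat \<Rightarrow> ('s, 'k) tensor set" where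
  "tensor_power scale V n = tens.span (pure_tensor scale V ` {vs \<in> lists V. length vs = n})"

definition tensor_algebra ::
    "('k::field \<Rightarrow> 's::ab_group_add \<Rightarrow> 's) \<Rightarrow> 's set \<Rightarrow> ('s, 'k) tensor set" where
  "tensor_algebra scale V = tens.span (pure_tensor scale V ` lists V)"

text \<open>
  The multiplication of $TV$; on $V^{\otimes s} \times V^{\otimes t}$ only the splitting $i = s$
  contributes.
\<close>

definition tensor_mult :: "('s, 'k::field) tensor \<Rightarrow> ('s, 'k) tensor \<Rightarrow> ('s, 'k) tensor"
    (infixl \<open>\<otimes>\<^sub>t\<close> 70) where
  "T \<otimes>\<^sub>t U = (\<lambda>fs. \<Sum>i\<le>length fs. T (take i fs) * U (drop i fs))"

definition tensor_subspace_mult ::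
    "('s, 'k::field) tensor set \<Rightarrow> ('s, 'k) tensor set \<Rightarrow> ('s, 'k) tensor set" (infixl \<open>\<otimes>\<^sub>s\<close> 70) where
  "A \<otimes>\<^sub>s B = tens.span {T \<otimes>\<^sub>t U | T U. T \<in> A \<and> U \<in> B}"

definition tensor_ideal ::
    "('k::field \<Rightarrow> 's::ab_group_add \<Rightarrow> 's) \<Rightarrow> 's set \<Rightarrow> ('s, 'k) tensor set \<Rightarrow> ('s, 'k) tensor set" where
  "tensor_ideal scale V R = tensor_algebra scale V \<otimes>\<^sub>s R \<otimes>\<^sub>s tensor_algebra scale V"

text \<open>
  The direct sum of all $\sigma^{\otimes n}$, for $\sigma \in GL(V)$: precomposition with the
  transpose of $\sigma$; see the lemma \<open>tensor_map_pure_tensor\<close>.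
\<close>

definition tensor_map ::
    "('k::field \<Rightarrow> 's::ab_group_add \<Rightarrow> 's) \<Rightarrow> 's set \<Rightarrow> ('s \<Rightarrow> 's) \<Rightarrow> ('s, 'k) tensor \<Rightarrow> ('s, 'k) tensor" where
  "tensor_map scale V \<sigma> T =
     (\<lambda>fs. if set fs \<subseteq> dual scale V then T (map (\<lambda>f. f \<circ> \<sigma>) fs) else 0)"

text \<open>
  The linear map $TV \to S$ with $v_1 \otimes \dots \otimes v_n \mapsto v_1 \cdots v_n$; well
  defined by the lemma \<open>tensor_eval_sum\<close>.
\<close>

definition tensor_eval ::
    "('k::field \<Rightarrow> 's::ring_1 \<Rightarrow> 's) \<Rightarrow> 's set \<Rightarrow> ('s, 'k) tensor \<Rightarrow> 's" where
  "tensor_eval scale V T = (THE y. \<exists>F c. finite F \<and> F \<subseteq> lists V \<and>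
     T = (\<Sum>vs\<in>F. tscale (c vs) (pure_tensor scale V vs)) \<and>
     y = (\<Sum>vs\<in>F. scale (c vs) (prod_list vs)))"

definition relations ::
    "('k::field \<Rightarrow> 's::ring_1 \<Rightarrow> 's) \<Rightarrow> (nat \<Rightarrow> 's set) \<Rightarrow> nat \<Rightarrow> ('s, 'k) tensor set" where
  "relations scale gr m = {T \<in> tensor_power scale (gr 1) m. tensor_eval scale (gr 1) T = 0}"


section \<open>Modules, projective resolutions, global dimension\<close>

text \<open>
  A left module lives on an additive subgroup \<open>Car\<close> of some ambient abelian group, with an arbitrary
  action on that subgroup.
\<close>

record ('s, 'm) lmod =
  Car :: "'m set"
  Act :: "'s \<Rightarrow> 'm \<Rightarrow> 'm"

record ('s, 'm) gmod = "('s, 'm) lmod" +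
  Deg :: "int \<Rightarrow> 'm set"

definition left_module :: "('s::ring_1, 'm::ab_group_add, 'z) lmod_scheme \<Rightarrow> bool" where
  "left_module M \<longleftrightarrow> add_subgroup (Car M) \<and>
     (\<forall>a. \<forall>x\<in>Car M. Act M a x \<in> Car M) \<and>
     (\<forall>a. \<forall>x\<in>Car M. \<forall>y\<in>Car M. Act M a (x + y) = Act M a x + Act M a y) \<and>
     (\<forall>a b. \<forall>x\<in>Car M. Act M (a + b) x = Act M a x + Act M b x) \<and>
     (\<forall>a b. \<forall>x\<in>Car M. Act M (a * b) x = Act M a (Act M b x)) \<and>
     (\<forall>x\<in>Car M. Act M 1 x = x)"

definition module_hom_on :: "('s::ring_1, 'm::ab_group_add, 'y) lmod_scheme \<Rightarrow>
    ('s, 'n::ab_group_add, 'z) lmod_scheme \<Rightarrow> ('m \<Rightarrow> 'n) \<Rightarrow> bool" where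
  "module_hom_on M N f \<longleftrightarrow> f ` Car M \<subseteq> Car N \<and>
     (\<forall>x\<in>Car M. \<forall>y\<in>Car M. f (x + y) = f x + f y) \<and>
     (\<forall>a. \<forall>x\<in>Car M. f (Act M a x) = Act N a (f x))"

text \<open>
  Quantification over ``all modules'' needs a fixed ambient group that is large enough.  We use
  $S^{\mathbb N}$ with its pointwise addition.  If $S$ is an algebra over a field $k$, every
  $S$-module is a $k$-space, so every $S$-module of $k$-dimension at most $\dim_k S^{\mathbb N}$ is
  isomorphic to one on a subgroup (even $k$-subspace) of $S^{\mathbb N}$.  This class contains
  the cyclic modules $S/I$, so that it suffices for the global dimension by Auslander's theorem.
  Since $\dim_k S^{\mathbb N} = |S^{\mathbb N}|$ is infinite and at least $\dim_k S$, every member is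
  also a quotient of a free module in the class.  Hence the class tests projectivity correctly, and
  all its members have projective resolutions in it.
\<close>

type_synonym 's univ = "nat \<Rightarrow> 's"

definition projective :: "('s::ring_1, 's univ, 'z) lmod_scheme \<Rightarrow> bool" where
  "projective P \<longleftrightarrow> left_module P \<and>
     (\<forall>(N :: ('s, 's univ) lmod) (N' :: ('s, 's univ) lmod) g f.
        left_module N \<and> left_module N' \<and> module_hom_on N N' g \<and> g ` Car N = Car N' \<and>
        module_hom_on P N' f
        \<longrightarrow> (\<exists>h. module_hom_on P N h \<and> (\<forall>x\<in>Car P. g (h x) = f x)))"

text \<open>
  An exact sequence $\cdots \to P_2 \to P_1 \to P_0 \to M \to 0$ with $d_i : P_{i+1} \to P_i$ and
  $e : P_0 \to M$.
\<close>

definition projective_resolution :: "(nat \<Rightarrow> ('s::ring_1, 's univ, 'y) lmod_scheme) \<Rightarrow>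
    (nat \<Rightarrow> 's univ \<Rightarrow> 's univ) \<Rightarrow> ('s univ \<Rightarrow> 'm) \<Rightarrow>
    ('s, 'm::ab_group_add, 'z) lmod_scheme \<Rightarrow> bool" where
  "projective_resolution P d e M \<longleftrightarrow>
     (\<forall>i. projective (P i)) \<and>
     (\<forall>i. module_hom_on (P (Suc i)) (P i) (d i)) \<and> module_hom_on (P 0) M e \<and>
     e ` Car (P 0) = Car M \<and>
     {x \<in> Car (P 0). e x = 0} = d 0 ` Car (P 1) \<and>
     (\<forall>i. {x \<in> Car (P (Suc i)). d i x = 0} = d (Suc i) ` Car (P (Suc (Suc i))))"

definition proj_dim :: "('s::ring_1, 'm::ab_group_add, 'z) lmod_scheme \<Rightarrow> enat" where
  "proj_dim M = Inf {enat n | n. \<exists>(P :: nat \<Rightarrow> ('s, 's univ) lmod) d e.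
      projective_resolution P d e M \<and> (\<forall>i>n. Car (P i) = {0})}"

definition gldim :: "'s::ring_1 itself \<Rightarrow> enat" where
  "gldim _ = (SUP M \<in> {M :: ('s, 's univ) lmod. left_module M}. proj_dim M)"


section \<open>Graded Ext\<close>

definition graded_module ::
    "(nat \<Rightarrow> 's set) \<Rightarrow> ('s::ring_1, 'm::ab_group_add, 'z) gmod_scheme \<Rightarrow> bool" where
  "graded_module gr M \<longleftrightarrow> left_module M \<and> internal_direct_sum (Deg M) (Car M) \<and>
     (\<forall>i n. \<forall>a\<in>gr i. \<forall>x\<in>Deg M n. Act M a x \<in> Deg M (int i + n))"

definition graded_shift :: "int \<Rightarrow> ('s, 'm, 'z) gmod_scheme \<Rightarrow> ('s, 'm, 'z) gmod_scheme" where
  "graded_shift n M = M\<lparr>Deg := \<lambda>i. Deg M (n + i)\<rparr>"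

definition graded_projective_resolution :: "(nat \<Rightarrow> 's set) \<Rightarrow> (nat \<Rightarrow> ('s::ring_1, 's univ) gmod) \<Rightarrow>
    (nat \<Rightarrow> 's univ \<Rightarrow> 's univ) \<Rightarrow> ('s univ \<Rightarrow> 'm) \<Rightarrow> ('s, 'm::ab_group_add) gmod \<Rightarrow> bool" where
  "graded_projective_resolution gr P d e M \<longleftrightarrow>
     projective_resolution P d e M \<and> (\<forall>i. graded_module gr (P i)) \<and>
     (\<forall>i n. d i ` Deg (P (Suc i)) n \<subseteq> Deg (P i) n) \<and> (\<forall>n. e ` Deg (P 0) n \<subseteq> Deg M n)"

text \<open>Homomorphisms of degree $j$; they are made unique by being $0$ outside the carrier.\<close>

definition graded_Hom :: "('s::ring_1, 'm::ab_group_add) gmod \<Rightarrow> ('s, 'n::ab_group_add) gmod \<Rightarrow>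
    int \<Rightarrow> ('m \<Rightarrow> 'n) set" where
  "graded_Hom M N j = {f. module_hom_on M N f \<and> (\<forall>n. f ` Deg M n \<subseteq> Deg N (n + j)) \<and>
     (\<forall>x. x \<notin> Car M \<longrightarrow> f x = 0)}"

definition cocycles :: "(nat \<Rightarrow> ('s::ring_1, 's univ) gmod) \<Rightarrow> (nat \<Rightarrow> 's univ \<Rightarrow> 's univ) \<Rightarrow>
    ('s, 'n::ab_group_add) gmod \<Rightarrow> nat \<Rightarrow> int \<Rightarrow> ('s univ \<Rightarrow> 'n) set" where
  "cocycles P d N i j = {f \<in> graded_Hom (P i) N j. \<forall>x\<in>Car (P (Suc i)). f (d i x) = 0}"

definition coboundaries :: "(nat \<Rightarrow> ('s::ring_1, 's univ) gmod) \<Rightarrow> (nat \<Rightarrow> 's univ \<Rightarrow> 's univ) \<Rightarrow>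
    ('s, 'n::ab_group_add) gmod \<Rightarrow> nat \<Rightarrow> int \<Rightarrow> ('s univ \<Rightarrow> 'n) set" where
  "coboundaries P d N i j = (case i of 0 \<Rightarrow> {\<lambda>x. 0}
     | Suc i' \<Rightarrow> (\<lambda>g x. if x \<in> Car (P i) then g (d i' x) else 0) ` graded_Hom (P i') N j)"

text \<open>
  Properties of $\mathrm{Ext}^i_S(M,N)_j = Z^i_j / B^i_j$, the cohomology of
  $\mathrm{Hom}_S(P_\bullet, N)_j$ for a graded projective resolution $P_\bullet$ of $M$, are stated
  for all such resolutions; the cohomology does not depend on the choice.
\<close>

definition Ext_vanishes :: "(nat \<Rightarrow> 's set) \<Rightarrow> ('s::ring_1, 'm::ab_group_add) gmod \<Rightarrow>
    ('s, 'n::ab_group_add) gmod \<Rightarrow> nat \<Rightarrow> int \<Rightarrow> bool" where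
  "Ext_vanishes gr M N i j \<longleftrightarrow> (\<forall>P d e. graded_projective_resolution gr P d e M \<longrightarrow>
     cocycles P d N i j = coboundaries P d N i j)"

definition regular_module :: "(nat \<Rightarrow> 's set) \<Rightarrow> ('s::ring_1, 's) gmod" where
  "regular_module gr =
     \<lparr>Car = UNIV, Act = (*), Deg = (\<lambda>i. if 0 \<le> i then gr (nat i) else {0})\<rparr>"

definition trivial_module ::
    "('k::field \<Rightarrow> 's::ring_1 \<Rightarrow> 's) \<Rightarrow> (nat \<Rightarrow> 's set) \<Rightarrow> ('s, 'k) gmod" where
  "trivial_module scale gr =
     \<lparr>Car = UNIV, Act = (\<lambda>a c. augmentation scale gr a * c), Deg = (\<lambda>i. if i = 0 then UNIV else {0})\<rparr>"

text \<open>
  $\mathrm{Ext}^i_S(k,S) \cong k(\ell)$ as graded right $S$-modules.  The right action on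
  $\mathrm{Hom}_S(P,S)$ is $(z s)(x) = z(x) s$, and that on $k(\ell)$ is
  $c\, s = c \cdot \varepsilon(s)$, with $\varepsilon$ the augmentation.  The isomorphism is given
  by surjections $\theta_j$ from the cocycles of degree $j$ onto $k(\ell)_j$ whose kernels are the
  coboundaries.
\<close>

definition Ext_regular_iso_trivial_shift ::
    "('k::field \<Rightarrow> 's::ring_1 \<Rightarrow> 's) \<Rightarrow> (nat \<Rightarrow> 's set) \<Rightarrow> nat \<Rightarrow> int \<Rightarrow> bool" where
  "Ext_regular_iso_trivial_shift scale gr i l \<longleftrightarrow>
     (\<forall>P d e. graded_projective_resolution gr P d e (trivial_module scale gr) \<longrightarrow>
       (let Z = cocycles P d (regular_module gr) i; B = coboundaries P d (regular_module gr) i in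
        \<exists>\<theta> :: int \<Rightarrow> ('s univ \<Rightarrow> 's) \<Rightarrow> 'k. \<forall>j.
          (\<forall>y\<in>Z j. \<forall>z\<in>Z j. \<theta> j (y + z) = \<theta> j y + \<theta> j z) \<and>
          \<theta> j ` Z j = Deg (graded_shift l (trivial_module scale gr)) j \<and>
          {z \<in> Z j. \<theta> j z = 0} = B j \<and>
          (\<forall>n. \<forall>s\<in>gr n. \<forall>z\<in>Z j.
             \<theta> (j + int n) (\<lambda>x. z x * s) = \<theta> j z * augmentation scale gr s)))"


section \<open>$m$-Koszul and Artin-Schelter regular algebras\<close>

definition m_Koszul ::
    "('k::field \<Rightarrow> 's::ring_1 \<Rightarrow> 's) \<Rightarrow> (nat \<Rightarrow> 's set) \<Rightarrow> nat \<Rightarrow> bool" where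
  "m_Koszul scale gr m \<longleftrightarrow> connected_graded_algebra scale gr \<and> 2 \<le> m \<and>
     (\<exists>B. finite B \<and> module.span scale B = gr 1) \<and>
     (\<exists>R. tens.subspace R \<and> R \<subseteq> tensor_power scale (gr 1) m \<and>
        tensor_eval scale (gr 1) ` tensor_algebra scale (gr 1) = UNIV \<and>
        {T \<in> tensor_algebra scale (gr 1). tensor_eval scale (gr 1) T = 0}
          = tensor_ideal scale (gr 1) R) \<and>
     (\<forall>i. \<exists>n. \<forall>j. j \<noteq> n \<longrightarrow>
        Ext_vanishes gr (trivial_module scale gr) (trivial_module scale gr) i j)"

definition AS_regular ::
    "('k::field \<Rightarrow> 's::ring_1 \<Rightarrow> 's) \<Rightarrow> (nat \<Rightarrow> 's set) \<Rightarrow> nat \<Rightarrow> int \<Rightarrow> bool" where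
  "AS_regular scale gr d l \<longleftrightarrow> connected_graded_algebra scale gr \<and>
     gldim TYPE('s) = enat d \<and>
     Ext_regular_iso_trivial_shift scale gr d l \<and>
     (\<forall>i j. i \<noteq> d \<longrightarrow> Ext_vanishes gr (trivial_module scale gr) (regular_module gr) i j)"


section \<open>Basic facts on tensors\<close>

lemma tensor_map_pure_tensor:
  assumes "\<sigma> \<in> GL scale V" and "vs \<in> lists V"
  shows "tensor_map scale V \<sigma> (pure_tensor scale V vs) = pure_tensor scale V (map \<sigma> vs)"
proof
  fix fs
  have lin: "linear_on scale V scale \<sigma>" and im: "\<sigma> ` V = V"
    using assms(1) by (auto simp: GL_def bij_betw_def)
  have "f \<circ> \<sigma> \<in> dual scale V" if f: "f \<in> dual scale V" for f
  proof -
    have m: "\<sigma> x \<in> V" if "x \<in> V" for x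
      using that im by blast
    then show ?thesis
      using f lin by (auto simp: dual_def linear_on_def)
  qed
  then have *: "set (map (\<lambda>f. f \<circ> \<sigma>) fs) \<subseteq> dual scale V" if "set fs \<subseteq> dual scale V"
    using that by auto
  have "prod_list (map2 (\<lambda>f v. f v) (map (\<lambda>f. f \<circ> \<sigma>) fs) vs)
      = prod_list (map2 (\<lambda>f v. f v) fs (map \<sigma> vs))"
    by (simp add: zip_map1 zip_map2 case_prod_unfold comp_def)
  then show "tensor_map scale V \<sigma> (pure_tensor scale V vs) fs = pure_tensor scale V (map \<sigma> vs) fs"
    using * by (auto simp: tensor_map_def pure_tensor_def)
qed

lemma pure_tensor_mult:
  "pure_tensor scale V vs \<otimes>\<^sub>t pure_tensor scale V ws = pure_tensor scale V (vs @ ws)"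
proof
  fix fs
  let ?t = "\<lambda>i. pure_tensor scale V vs (take i fs) * pure_tensor scale V ws (drop i fs)"
  have z: "?t i = 0" if "i \<le> length fs" "i \<noteq> length vs" for i
    using that by (simp add: pure_tensor_def)
  show "(pure_tensor scale V vs \<otimes>\<^sub>t pure_tensor scale V ws) fs = pure_tensor scale V (vs @ ws) fs"
  proof (cases "length vs \<le> length fs")
    case True
    have "(\<Sum>i\<le>length fs. ?t i) = (\<Sum>i\<in>{length vs}. ?t i)"
      by (rule sum.mono_neutral_right) (use True z in auto)
    also have "\<dots> = pure_tensor scale V (vs @ ws) fs"
    proof -
      have s: "set fs \<subseteq> dual scale V \<longleftrightarrow>
          set (take (length vs) fs) \<subseteq> dual scale V \<and> set (drop (length vs) fs) \<subseteq> dual scale V"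
        by (metis append_take_drop_id set_append Un_subset_iff)
      have zp: "zip fs (vs @ ws) = zip (take (length vs) fs) vs @ zip (drop (length vs) fs) ws"
        by (simp add: zip_append2)
      show ?thesis
        using True s by (auto simp: pure_tensor_def zp)
    qed
    finally show ?thesis
      by (simp add: tensor_mult_def)
  next
    case False
    then show ?thesis
      using z by (auto simp: tensor_mult_def pure_tensor_def)
  qed
qed

context connected_graded_algebra
begin

lemma prod_list_expand:
  assumes B: "independent B" and V: "V = span B" and fin: "finite C" and "C \<subseteq> B"
    and "vs \<in> lists V" and supp: "\<forall>v\<in>set vs. {b. representation B v b \<noteq> 0} \<subseteq> C"
  shows "prod_list vs = (\<Sum>bs | set bs \<subseteq> C \<and> length bs = length vs.
     scale (pure_tensor scale V vs (map (\<lambda>b v. representation B v b) bs)) (prod_list bs))"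
  using assms(5) supp
proof (induction vs)
  case Nil
  have "{bs. set bs \<subseteq> C \<and> length bs = length ([] :: 's list)} = {[]}"
    by auto
  then show ?case
    by (simp add: pure_tensor_def)
next
  case (Cons v vs)
  let ?f = "\<lambda>b v. representation B v b"
  let ?W = "\<lambda>n. {bs. set bs \<subseteq> C \<and> length bs = n}"
  let ?p = "pure_tensor scale V"
  have dual: "?f b \<in> dual scale V" for b
    using B V by (auto simp: dual_def linear_on_def representation_add representation_scale)
  have p: "?p (v # vs) (map ?f (b # bs)) = ?f b v * ?p vs (map ?f bs)" for b bs
    using dual by (auto simp: pure_tensor_def)
  have v: "v = (\<Sum>b\<in>C. scale (?f b v) b)"
  proof -
    have "v = (\<Sum>b | ?f b v \<noteq> 0. scale (?f b v) b)"
      by (rule sum_nonzero_representation_eq [symmetric]) (use B V Cons.hyps in auto)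
    also have "\<dots> = (\<Sum>b\<in>C. scale (?f b v) b)"
      by (rule sum.mono_neutral_left) (use fin Cons.prems in auto)
    finally show ?thesis .
  qed
  have IH: "prod_list vs = (\<Sum>bs\<in>?W (length vs). scale (?p vs (map ?f bs)) (prod_list bs))"
    using Cons by auto
  have "prod_list (v # vs) = (\<Sum>b\<in>C. scale (?f b v) b) *
      (\<Sum>bs\<in>?W (length vs). scale (?p vs (map ?f bs)) (prod_list bs))"
    using v IH by simp
  also have "\<dots> = (\<Sum>b\<in>C. \<Sum>bs\<in>?W (length vs).
      scale (?p (v # vs) (map ?f (b # bs))) (prod_list (b # bs)))"
    unfolding sum_product p by (simp add: scale_mult_left scale_mult_right mult.commute)
  also have "\<dots> = (\<Sum>(b, bs)\<in>C \<times> ?W (length vs).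
      scale (?p (v # vs) (map ?f (b # bs))) (prod_list (b # bs)))"
    by (simp add: sum.cartesian_product)
  also have "\<dots> = (\<Sum>bs\<in>?W (length (v # vs)). scale (?p (v # vs) (map ?f bs)) (prod_list bs))"
    by (rule sum.reindex_bij_witness [of _ "\<lambda>bs. (hd bs, tl bs)" "\<lambda>(b, bs). b # bs"])
      (auto simp: length_Suc_conv)
  finally show ?case .
qed

lemma tensor_eval_sum:
  assumes V: "subspace V" and F: "finite F" "F \<subseteq> lists V"
  shows "tensor_eval scale V (\<Sum>vs\<in>F. tscale (c vs) (pure_tensor scale V vs))
    = (\<Sum>vs\<in>F. scale (c vs) (prod_list vs))"
proof -
  obtain B where B: "B \<subseteq> V" "independent B" "V \<subseteq> span B"
    using maximal_independent_subset by blast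
  then have VB: "V = span B"
    using V by (metis span_minimal subset_antisym)
  let ?f = "\<lambda>b v. representation B v b"
  let ?p = "pure_tensor scale V"
  have eval: "(\<Sum>vs\<in>G. scale (e vs) (prod_list vs))
      = (\<Sum>bs | set bs \<subseteq> C \<and> length bs \<le> N.
           scale ((\<Sum>vs\<in>G. tscale (e vs) (?p vs)) (map ?f bs)) (prod_list bs))"
    if G: "finite G" "G \<subseteq> lists V" and C: "finite C" "C \<subseteq> B"
      and supp: "\<forall>vs\<in>G. length vs \<le> N \<and> (\<forall>v\<in>set vs. {b. ?f b v \<noteq> 0} \<subseteq> C)"
    for G e C N
  proof -
    let ?W = "{bs. set bs \<subseteq> C \<and> length bs \<le> N}"
    have finW: "finite ?W"
      using C finite_lists_length_le by blast
    have "prod_list vs = (\<Sum>bs\<in>?W. scale (?p vs (map ?f bs)) (prod_list bs))" if "vs \<in> G" for vs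
    proof -
      have "prod_list vs = (\<Sum>bs | set bs \<subseteq> C \<and> length bs = length vs.
          scale (?p vs (map ?f bs)) (prod_list bs))"
        using B VB C G supp that by (intro prod_list_expand) auto
      also have "\<dots> = (\<Sum>bs\<in>?W. scale (?p vs (map ?f bs)) (prod_list bs))"
        by (rule sum.mono_neutral_left) (use finW supp that in \<open>auto simp: pure_tensor_def\<close>)
      finally show ?thesis .
    qed
    then have "(\<Sum>vs\<in>G. scale (e vs) (prod_list vs))
        = (\<Sum>vs\<in>G. \<Sum>bs\<in>?W. scale (e vs * ?p vs (map ?f bs)) (prod_list bs))"
      by (simp add: scale_sum_right)
    also have "\<dots> = (\<Sum>bs\<in>?W. \<Sum>vs\<in>G. scale (e vs * ?p vs (map ?f bs)) (prod_list bs))"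
      by (rule sum.swap)
    also have "\<dots> = (\<Sum>bs\<in>?W. scale ((\<Sum>vs\<in>G. tscale (e vs) (?p vs)) (map ?f bs)) (prod_list bs))"
    proof -
      have "(\<Sum>vs\<in>G. tscale (e vs) (?p vs)) fs = (\<Sum>vs\<in>G. e vs * ?p vs fs)" for fs
        using G(1) by (induction G rule: finite_induct) auto
      then show ?thesis
        by (simp add: scale_sum_left)
    qed
    finally show ?thesis .
  qed
  have unique: "(\<Sum>vs\<in>G. scale (e vs) (prod_list vs)) = (\<Sum>vs\<in>F. scale (c vs) (prod_list vs))"
    if G: "finite G" "G \<subseteq> lists V"
      and eq: "(\<Sum>vs\<in>F. tscale (c vs) (?p vs)) = (\<Sum>vs\<in>G. tscale (e vs) (?p vs))" for G e
  proof -
    define N where "N = Max (insert 0 (length ` (F \<union> G)))"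
    define C where "C = (\<Union>vs\<in>F \<union> G. \<Union>v\<in>set vs. {b. ?f b v \<noteq> 0})"
    have N: "length vs \<le> N" if "vs \<in> F \<union> G" for vs
      unfolding N_def using that F G by (intro Max_ge) auto
    have C: "finite C" "C \<subseteq> B"
      unfolding C_def using F G by (auto intro: finite_representation dest: representation_ne_zero)
    have supp: "\<forall>vs\<in>F \<union> G. length vs \<le> N \<and> (\<forall>v\<in>set vs. {b. ?f b v \<noteq> 0} \<subseteq> C)"
      using N unfolding C_def by blast
    have "\<forall>vs\<in>F. length vs \<le> N \<and> (\<forall>v\<in>set vs. {b. ?f b v \<noteq> 0} \<subseteq> C)"
      "\<forall>vs\<in>G. length vs \<le> N \<and> (\<forall>v\<in>set vs. {b. ?f b v \<noteq> 0} \<subseteq> C)"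
      using supp unfolding ball_Un by (rule conjunct1, rule conjunct2)
    note * = eval [OF F C this(1), of c] eval [OF G C this(2), of e]
    show ?thesis
      by (simp only: * eq)
  qed
  show ?thesis
    unfolding tensor_eval_def
  proof (rule the_equality)
    show "\<exists>G e. finite G \<and> G \<subseteq> lists V \<and>
        (\<Sum>vs\<in>F. tscale (c vs) (?p vs)) = (\<Sum>vs\<in>G. tscale (e vs) (?p vs)) \<and>
        (\<Sum>vs\<in>F. scale (c vs) (prod_list vs)) = (\<Sum>vs\<in>G. scale (e vs) (prod_list vs))"
      using F by blast
  qed (use unique in blast)
qed

end

end

theory Submission
  imports Defs "HOL-Library.Nat_Bijection"
begin

text \<open>
  Only the inclusion of the right-hand side in the left-hand side is deep: a map that fixes the line
  of \<open>w\<close> has to preserve \<open>R\<close>.  It does, because \<open>R\<close> is spanned by the slices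
  \<open>(\<xi> \<otimes> id)(w)\<close>, where \<open>\<xi>\<close> is a tensor product of \<open>l - m\<close> functionals on \<open>V\<close>; a map preserving \<open>R\<close>
  extends to \<open>S = TV/(R)\<close>.

  Let \<open>W N = \<Inter> V\<^sup>s R V\<^sup>t\<close> and let \<open>kd i\<close> be \<open>am\<close> for \<open>i = 2a\<close> and \<open>am + 1\<close> for \<open>i = 2a + 1\<close>.
  Because \<open>W l \<noteq> 0\<close> and every \<open>Ext\<^sup>i(k, k)\<close> lives in one degree, the Koszul complex
  \<open>S \<otimes> W (kd i)\<close> is exact as long as \<open>kd i \<le> l\<close>: the kernel at the last term starts in degree
  \<open>kd (i + 1)\<close>, and its minimal generators contribute to \<open>Ext\<^sup>i\<^sup>+\<^sup>1(k, k)\<close>.  A nonzero functional on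
  \<open>W (kd i)\<close> is a cochain of degree \<open>-kd i\<close> with values in \<open>S\<close>, which for degree reasons is not a
  coboundary.  As \<open>Ext\<^sup>i(k, S)\<close> vanishes in degree \<open>-kd i \<noteq> -l\<close>, it is not a cocycle either, so
  that some slice of it is a nonzero functional on \<open>W (kd (i + 1))\<close>.  Climbing from \<open>W m = R\<close> to
  \<open>W l = k w\<close> shows that no nonzero functional on \<open>R\<close> kills all slices of \<open>w\<close>.  That \<open>l\<close> is one of
  the numbers \<open>kd i\<close> follows from the finite global dimension.
\<close>

section \<open>Linear algebra\<close>

text \<open>\<open>Ext_vanishes\<close> quantifies over all graded projective resolutions on the
  type \<open>'s univ\<close>, so each use of it requires such a resolution to be exhibited. The
  Koszul complex is shown to be exact only in the range \<open>kd i \<le> l\<close>; it is cut off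
  there and continued by free covers, whose generators can be coded by natural numbers because all
  components of \<open>S\<close> are finite dimensional. Tensors are treated as functions on words
  in a basis of \<open>V\<close>. Words shorter than \<open>m\<close> are independent in
  \<open>S\<close>, so kernels in low degree can be computed in the tensor algebra. In the critical
  degree some windows of \<open>m\<close> letters are reached neither from the left nor from the
  right; they are handled by an extra condition that comes out of exactness at term 2. Modules are
  left modules, hence the differential moves letters from the left end of a word into the
  coefficient, and slices are taken on the left. Finally, \<open>gldim\<close> speaks of ungraded
  resolutions while Ext is graded; the two are reconciled by taking homogeneous components of an
  ungraded lift.\<close>

lemma sum_fun_apply: "(\<Sum>a\<in>A. f a) x = (\<Sum>a\<in>A. f a x)"
  by (induction A rule: infinite_finite_induct) auto

context vector_space
begin

lemma linear_functional_extend: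
  assumes "subspace Y" and "z \<notin> Y"
  shows "\<exists>\<phi>. Vector_Spaces.linear scale (*) \<phi> \<and> (\<forall>y\<in>Y. \<phi> y = 0) \<and> \<phi> z = 1"
proof -
  interpret vp: vector_space_pair scale "(*) :: 'a \<Rightarrow> 'a \<Rightarrow> 'a"
    by unfold_locales (auto simp: algebra_simps)
  obtain B where B: "B \<subseteq> Y" "independent B" "Y \<subseteq> span B"
    using maximal_independent_subset by blast
  then have YB: "span B = Y"
    using assms(1) by (metis span_minimal subset_antisym)
  then have "independent (insert z B)"
    using B assms(2) by (simp add: independent_insert)
  then obtain \<phi> where \<phi>: "Vector_Spaces.linear scale (*) \<phi>" "\<forall>x\<in>insert z B. \<phi> x = (if x = z then 1 else 0)"
    using vp.linear_independent_extend [of "insert z B" "\<lambda>x. if x = z then 1 else 0"] by blast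
  have "z \<notin> B"
    using B assms(2) by blast
  then have "\<phi> y = 0" if "y \<in> Y" for y
    using vp.linear_eq_0_on_span [OF \<phi>(1), of B y] \<phi>(2) YB that \<open>z \<notin> B\<close> by (metis insert_iff)
  then show ?thesis
    using \<phi> by auto
qed

lemma linear_functional_eqI:
  assumes "\<And>\<phi>. Vector_Spaces.linear scale (*) \<phi> \<Longrightarrow> \<phi> x = \<phi> y"
  shows "x = y"
proof (rule ccontr)
  assume "x \<noteq> y"
  then obtain \<phi> where \<phi>: "Vector_Spaces.linear scale (*) \<phi>" "\<phi> (x - y) = 1"
    using linear_functional_extend [of "{0}" "x - y"] by auto
  interpret vp: vector_space_pair scale "(*) :: 'a \<Rightarrow> 'a \<Rightarrow> 'a"
    by unfold_locales (auto simp: algebra_simps)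
  show False
    using assms [OF \<phi>(1)] \<phi>(2) vp.linear_diff [OF \<phi>(1), of x y] by simp
qed

text \<open>Independence is required of the family indexed by \<open>X\<close>, so
  \<open>v p\<close> lies outside the span of the other members, and some functional vanishes on
  that span but not at \<open>v p\<close>.\<close>

lemma linear_functional_dual:
  assumes "finite X" and "\<And>c p. (\<Sum>q\<in>X. scale (c q) (v q)) = 0 \<Longrightarrow> p \<in> X \<Longrightarrow> c p = 0" and p: "p \<in> X"
  shows "\<exists>\<phi>. Vector_Spaces.linear scale (*) \<phi> \<and> (\<forall>q\<in>X. \<phi> (v q) = (if q = p then 1 else 0))"
proof -
  have "v p \<notin> span (v ` (X - {p}))"
  proof
    assume "v p \<in> span (v ` (X - {p}))"
    moreover have "span (v ` (X - {p})) \<subseteq> {\<Sum>q\<in>X - {p}. scale (c q) (v q) | c. True}" (is "_ \<subseteq> ?L")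
    proof (rule span_minimal)
      show "v ` (X - {p}) \<subseteq> ?L"
      proof
        fix y assume "y \<in> v ` (X - {p})"
        then obtain q where q: "q \<in> X - {p}" "y = v q" by blast
        have "(\<Sum>q'\<in>X - {p}. scale (if q' = q then 1 else 0) (v q')) = (\<Sum>q'\<in>X - {p}. if q = q' then v q' else 0)"
          by (intro sum.cong) auto
        also have "\<dots> = y"
          using q assms(1) by simp
        finally show "y \<in> ?L" by (intro CollectI exI [of _ "\<lambda>q'. if q' = q then 1 else 0"]) auto
      qed
      show "subspace ?L"
      proof (rule subspaceI)
        show "0 \<in> ?L" by (auto intro!: exI [of _ "\<lambda>_. 0"])
        show "x + y \<in> ?L" if "x \<in> ?L" "y \<in> ?L" for x y
        proof -
          obtain c e where "x = (\<Sum>q\<in>X - {p}. scale (c q) (v q))" "y = (\<Sum>q\<in>X - {p}. scale (e q) (v q))"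
            using \<open>x \<in> ?L\<close> \<open>y \<in> ?L\<close> by blast
          then have "x + y = (\<Sum>q\<in>X - {p}. scale (c q + e q) (v q))"
            by (simp add: scale_left_distrib sum.distrib)
          then show ?thesis by (intro CollectI exI [of _ "\<lambda>q. c q + e q"]) auto
        qed
        show "scale a x \<in> ?L" if x: "x \<in> ?L" for a x
        proof -
          obtain c where "x = (\<Sum>q\<in>X - {p}. scale (c q) (v q))"
            using x by blast
          then have "scale a x = (\<Sum>q\<in>X - {p}. scale (a * c q) (v q))"
            by (simp add: scale_sum_right)
          then show ?thesis by (intro CollectI exI [of _ "\<lambda>q. a * c q"]) auto
        qed
      qed
    qed
    ultimately obtain c where c: "v p = (\<Sum>q\<in>X - {p}. scale (c q) (v q))"
      by blast
    \<comment> \<open>Moving \<open>v p\<close> to the other side gives a relation whose coefficient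
      at \<open>p\<close> is \<open>-1\<close>, against independence.\<close>
    have "(\<Sum>q\<in>X. scale ((c(p := -1)) q) (v q)) = scale (-1) (v p) + (\<Sum>q\<in>X - {p}. scale ((c(p := -1)) q) (v q))"
      by (subst sum.remove [OF assms(1) p]) simp
    also have "(\<Sum>q\<in>X - {p}. scale ((c(p := -1)) q) (v q)) = v p"
      unfolding c by (intro sum.cong) auto
    finally have "(\<Sum>q\<in>X. scale ((c(p := -1)) q) (v q)) = 0"
      by simp
    from assms(2) [OF this p] show False by simp
  qed
  from linear_functional_extend [OF subspace_span this]
  obtain \<phi> where \<phi>: "Vector_Spaces.linear scale (*) \<phi>" "\<forall>y\<in>span (v ` (X - {p})). \<phi> y = 0" "\<phi> (v p) = 1"
    by blast
  have "\<phi> (v q) = 0" if "q \<in> X" "q \<noteq> p" for q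
    using \<phi>(2) span_base [of "v q" "v ` (X - {p})"] that by blast
  then show ?thesis using \<phi> by auto
qed

text \<open>Zero is kept out of the list because such lists later serve as generators: a generator
  of degree \<open>j\<close> then witnesses that the component of degree \<open>j\<close> is
  nonzero.\<close>

lemma finite_spanning_list:
  assumes "finite B" and "Y \<subseteq> span B" and "subspace Y"
  shows "\<exists>zs. set zs \<subseteq> Y - {0} \<and> Y \<subseteq> span (set zs)"
proof -
  obtain C where C: "C \<subseteq> Y" "independent C" "Y \<subseteq> span C"
    using maximal_independent_subset by blast
  then have "finite C"
    using independent_span_bound [of B C] assms by auto
  then obtain zs where "set zs = C"
    using finite_list by blast
  then show ?thesis
    using C dependent_zero by blast
qed

end

global_interpretation wf: vector_space "\<lambda>c x (u::'a). (c::'k::field) * x u"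
  by unfold_locales (auto simp: fun_eq_iff algebra_simps)

text \<open>The coordinate functionals of \<open>W\<close> are extended to all functions supported
  on the finite set \<open>X\<close>, so they become fixed linear combinations of the values at
  points of \<open>X\<close>. An expansion of this kind carries over to functions with values in
  \<open>S\<close>.\<close>

lemma wf_dual_basis:
  fixes W :: "('a \<Rightarrow> 'k::field) set"
  assumes W: "wf.subspace W" and X: "finite X" and supp: "\<And>x u. x \<in> W \<Longrightarrow> u \<notin> X \<Longrightarrow> x u = 0"
  shows "\<exists>E c. finite E \<and> E \<subseteq> W \<and> (\<forall>x\<in>W. \<forall>u. x u = (\<Sum>e\<in>E. (\<Sum>q\<in>X. c e q * x q) * e u))"
proof -
  obtain B where B: "B \<subseteq> W" "wf.independent B" "W \<subseteq> wf.span B"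
    using wf.maximal_independent_subset by blast
  define \<delta> where "\<delta> = (\<lambda>(q::'a) u. if u = q then 1 else 0 :: 'k)"
  have expand: "x = (\<Sum>q\<in>X. (\<lambda>u. x q * \<delta> q u))" if "x \<in> W" for x
    using supp [OF that] X by (auto simp: fun_eq_iff sum_fun_apply \<delta>_def if_distrib cong: if_cong)
  have "x \<in> wf.span (\<delta> ` X)" if "x \<in> W" for x
    by (subst expand [OF that]) (intro wf.span_sum wf.span_scale wf.span_base imageI)
  then have "finite B"
    using wf.independent_span_bound [of "\<delta> ` X" B] B X by blast
  \<comment> \<open>A basis of the whole function space extending \<open>B\<close> lets the
    coordinates be evaluated at the point functions \<open>\<delta> q\<close>, which need not lie in
    \<open>W\<close>.\<close>
  obtain B' where B': "B \<subseteq> B'" "wf.independent B'" "UNIV \<subseteq> wf.span B'"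
    using wf.maximal_independent_subset_extend [of B UNIV] B by auto
  define c where "c = (\<lambda>e q. wf.representation B' (\<delta> q) e)"
  have "x u = (\<Sum>e\<in>B. (\<Sum>q\<in>X. c e q * x q) * e u)" if "x \<in> W" for x u
  proof -
    have sp: "v \<in> wf.span B'" for v using B' by blast
    have "x = (\<Sum>e\<in>B. (\<lambda>u. wf.representation B x e * e u))"
      using wf.sum_representation_eq [OF B(2), of x B] B \<open>finite B\<close> that by auto
    moreover have "wf.representation B x e = (\<Sum>q\<in>X. c e q * x q)" for e
    proof -
      have "wf.representation B x e = wf.representation B' x e"
        using wf.representation_extend [OF B'(2), of x B] B B' that by auto
      also have "\<dots> = wf.representation B' (\<Sum>q\<in>X. (\<lambda>u. x q * \<delta> q u)) e"
        using expand [OF that] by simp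
      also have "\<dots> = (\<Sum>q\<in>X. wf.representation B' (\<lambda>u. x q * \<delta> q u) e)"
        using wf.representation_sum [OF B'(2), of X "\<lambda>q u. x q * \<delta> q u"] sp by (simp add: sum_fun_apply)
      also have "\<dots> = (\<Sum>q\<in>X. c e q * x q)"
        unfolding c_def
        using wf.representation_scale [OF B'(2) sp] by (intro sum.cong) (auto simp: mult.commute)
      finally show ?thesis .
    qed
    ultimately have "x = (\<Sum>e\<in>B. (\<lambda>u. (\<Sum>q\<in>X. c e q * x q) * e u))"
      by simp
    from arg_cong [OF this, of "\<lambda>f. f u"] show ?thesis
      by (simp only: sum_fun_apply)
  qed
  then show ?thesis
    using \<open>finite B\<close> B(1) by blast
qed

section \<open>Homogeneous components\<close>

lemma add_subgroup_sum:
  assumes "add_subgroup C" and "\<And>i. i \<in> I \<Longrightarrow> f i \<in> C"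
  shows "sum f I \<in> C"
  using assms(2) by (induction I rule: infinite_finite_induct) (use assms(1) in \<open>auto simp: add_subgroup_def\<close>)

lemma internal_direct_sum_unique:
  assumes "internal_direct_sum D C" "x \<in> C"
    and "\<And>i. f i \<in> D i" "finite {i. f i \<noteq> 0}" "x = (\<Sum>i | f i \<noteq> 0. f i)"
    and "\<And>i. g i \<in> D i" "finite {i. g i \<noteq> 0}" "x = (\<Sum>i | g i \<noteq> 0. g i)"
  shows "f = g"
  using assms unfolding internal_direct_sum_def by blast

lemma sum_support_superset:
  assumes "finite J" "\<And>i. f i \<noteq> 0 \<Longrightarrow> i \<in> J"
  shows "(\<Sum>i | f i \<noteq> 0. f i) = sum f J"
  by (rule sum.mono_neutral_left) (use assms in auto)

context connected_graded_algebra
begin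

definition hcomp :: "nat \<Rightarrow> 's \<Rightarrow> 's" where
  "hcomp i x = (THE f. (\<forall>i. f i \<in> gr i) \<and> finite {i. f i \<noteq> 0} \<and> x = (\<Sum>i | f i \<noteq> 0. f i)) i"

lemma hcomp_props:
  "(\<forall>i. hcomp i x \<in> gr i) \<and> finite {i. hcomp i x \<noteq> 0} \<and> x = (\<Sum>i | hcomp i x \<noteq> 0. hcomp i x)"
proof -
  have "\<exists>!f. (\<forall>i. f i \<in> gr i) \<and> finite {i. f i \<noteq> 0} \<and> x = (\<Sum>i | f i \<noteq> 0. f i)"
    using direct_sum_gr unfolding internal_direct_sum_def by blast
  from theI' [OF this] show ?thesis
    unfolding hcomp_def .
qed

lemma hcomp_in [simp]: "hcomp i x \<in> gr i"
  and finite_hcomp: "finite {i. hcomp i x \<noteq> 0}"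
  and sum_hcomp: "(\<Sum>i | hcomp i x \<noteq> 0. hcomp i x) = x"
  using hcomp_props [of x] by auto

lemma sum_hcomp_superset:
  assumes "finite J" "{i. hcomp i x \<noteq> 0} \<subseteq> J"
  shows "(\<Sum>i\<in>J. hcomp i x) = x"
  using sum_support_superset [of J "\<lambda>i. hcomp i x"] assms sum_hcomp [of x] by (metis (mono_tags, lifting) mem_Collect_eq subsetD)

lemma gr_0 [simp]: "0 \<in> gr i"
  and gr_add: "x \<in> gr i \<Longrightarrow> y \<in> gr i \<Longrightarrow> x + y \<in> gr i"
  and gr_scale: "x \<in> gr i \<Longrightarrow> scale c x \<in> gr i"
  and gr_neg: "x \<in> gr i \<Longrightarrow> - x \<in> gr i"
  and gr_sum: "(\<And>a. a \<in> A \<Longrightarrow> f a \<in> gr i) \<Longrightarrow> sum f A \<in> gr i"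
  using subspace_gr by (auto intro: subspace_0 subspace_add subspace_scale subspace_neg subspace_sum)

lemma hcomp_eqI:
  assumes "\<And>i. f i \<in> gr i" "finite J" "\<And>i. i \<notin> J \<Longrightarrow> f i = 0" "x = sum f J"
  shows "hcomp i x = f i"
proof -
  have "(\<lambda>i. hcomp i x) = f"
  proof (rule internal_direct_sum_unique [OF direct_sum_gr UNIV_I])
    show "finite {i. f i \<noteq> 0}"
      using assms(2,3) by (rule_tac finite_subset [of _ J]) auto
    show "x = (\<Sum>i | f i \<noteq> 0. f i)"
      using sum_support_superset [of J f] assms by metis
  qed (use assms hcomp_props [of x] in auto)
  then show ?thesis by (simp add: fun_eq_iff)
qed

lemma hcomp_add: "hcomp i (x + y) = hcomp i x + hcomp i y"
proof (rule hcomp_eqI)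
  let ?J = "{i. hcomp i x \<noteq> 0} \<union> {i. hcomp i y \<noteq> 0}"
  show "finite ?J" using finite_hcomp by blast
  then show "x + y = (\<Sum>i\<in>?J. hcomp i x + hcomp i y)"
    by (simp add: sum.distrib sum_hcomp_superset)
qed (auto intro: gr_add)

lemma hcomp_0 [simp]: "hcomp i 0 = 0"
  by (rule hcomp_eqI [of "\<lambda>_. 0" "{}"]) auto

lemma hcomp_sum: "hcomp i (sum f A) = (\<Sum>a\<in>A. hcomp i (f a))"
  by (induction A rule: infinite_finite_induct) (auto simp: hcomp_add)

lemma hcomp_scale: "hcomp i (scale c x) = scale c (hcomp i x)"
proof (rule hcomp_eqI)
  show "finite {i. hcomp i x \<noteq> 0}" by (rule finite_hcomp)
  show "scale c x = (\<Sum>i | hcomp i x \<noteq> 0. scale c (hcomp i x))"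
    by (metis scale_sum_right sum_hcomp)
qed (auto intro: gr_scale)

lemma hcomp_homogeneous: "x \<in> gr j \<Longrightarrow> hcomp i x = (if i = j then x else 0)"
  by (rule hcomp_eqI [of _ "{j}"]) auto

lemma hcomp_mult_left:
  assumes a: "a \<in> gr i"
  shows "hcomp k (a * x) = (if i \<le> k then a * hcomp (k - i) x else 0)"
proof (rule hcomp_eqI)
  let ?J = "{i. hcomp i x \<noteq> 0}"
  have "a * x = (\<Sum>j\<in>?J. a * hcomp j x)"
    by (metis sum_distrib_left sum_hcomp)
  also have "\<dots> = (\<Sum>k\<in>(\<lambda>j. i + j) ` ?J. if i \<le> k then a * hcomp (k - i) x else 0)"
    by (subst sum.reindex) auto
  finally show "a * x = (\<Sum>k\<in>(\<lambda>j. i + j) ` ?J. if i \<le> k then a * hcomp (k - i) x else 0)" .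
  show "finite ((\<lambda>j. i + j) ` ?J)"
    using finite_hcomp by blast
  show "(if i \<le> k then a * hcomp (k - i) x else 0) \<in> gr k" for k
    using mult_gr [OF a hcomp_in, of "k - i" x] by auto
  show "(if i \<le> k then a * hcomp (k - i) x else 0) = 0" if "k \<notin> (\<lambda>j. i + j) ` ?J" for k
    using that by (auto simp: image_iff) (metis le_add_diff_inverse mult_zero_right)
qed

lemma hcomp_mult_right:
  assumes a: "a \<in> gr i"
  shows "hcomp k (x * a) = (if i \<le> k then hcomp (k - i) x * a else 0)"
proof (rule hcomp_eqI)
  let ?J = "{i. hcomp i x \<noteq> 0}"
  have "x * a = (\<Sum>j\<in>?J. hcomp j x * a)"
    by (metis sum_distrib_right sum_hcomp)
  also have "\<dots> = (\<Sum>k\<in>(\<lambda>j. j + i) ` ?J. if i \<le> k then hcomp (k - i) x * a else 0)"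
    by (subst sum.reindex) auto
  finally show "x * a = (\<Sum>k\<in>(\<lambda>j. j + i) ` ?J. if i \<le> k then hcomp (k - i) x * a else 0)" .
  show "finite ((\<lambda>j. j + i) ` ?J)"
    using finite_hcomp by blast
  show "(if i \<le> k then hcomp (k - i) x * a else 0) \<in> gr k" for k
    using mult_gr [OF hcomp_in a, of "k - i" x] by auto
  show "(if i \<le> k then hcomp (k - i) x * a else 0) = 0" if "k \<notin> (\<lambda>j. j + i) ` ?J" for k
    using that by (auto simp: image_iff) (metis le_add_diff_inverse2 mult_zero_left)
qed

lemma scale_1_eq_iff: "scale c (1::'s) = scale e 1 \<longleftrightarrow> c = e"
  by simp

definition \<epsilon> :: "'s \<Rightarrow> 'k" where
  "\<epsilon> a = (THE c. hcomp 0 a = scale c 1)"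

lemma hcomp_zero_eq: "hcomp 0 a = scale (\<epsilon> a) 1"
proof -
  obtain c where c: "hcomp 0 a = scale c 1"
    using hcomp_in [of 0 a] connected by auto
  then have "\<epsilon> a = c"
    unfolding \<epsilon>_def by (intro the_equality) auto
  with c show ?thesis by simp
qed

lemma \<epsilon>_eqI: "hcomp 0 a = scale c 1 \<Longrightarrow> \<epsilon> a = c"
  using hcomp_zero_eq scale_1_eq_iff by metis

lemma one_gr: "1 \<in> gr 0"
  using connected by (metis rangeI scale_one)

lemma \<epsilon>_0 [simp]: "\<epsilon> 0 = 0"
  by (rule \<epsilon>_eqI) simp

lemma \<epsilon>_1 [simp]: "\<epsilon> 1 = 1"
  by (rule \<epsilon>_eqI) (simp add: hcomp_homogeneous [OF one_gr])

lemma \<epsilon>_add: "\<epsilon> (a + b) = \<epsilon> a + \<epsilon> b"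
  by (rule \<epsilon>_eqI) (simp add: hcomp_add hcomp_zero_eq scale_left_distrib)

lemma \<epsilon>_scale: "\<epsilon> (scale c a) = c * \<epsilon> a"
  by (rule \<epsilon>_eqI) (simp add: hcomp_scale hcomp_zero_eq)

lemma \<epsilon>_sum: "\<epsilon> (sum f A) = (\<Sum>a\<in>A. \<epsilon> (f a))"
  by (induction A rule: infinite_finite_induct) (auto simp: \<epsilon>_add)

text \<open>A product of components of degrees \<open>i\<close> and \<open>j\<close> reaches degree
  0 only for \<open>i = j = 0\<close>. This makes the augmentation multiplicative.\<close>

lemma hcomp_zero_mult: "hcomp 0 (a * b) = hcomp 0 a * hcomp 0 b"
proof -
  let ?J = "insert 0 {i. hcomp i a \<noteq> 0}"
  have J: "finite ?J" using finite_hcomp by auto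
  have "hcomp 0 (a * b) = hcomp 0 (\<Sum>i\<in>?J. hcomp i a * b)"
    using sum_hcomp_superset [OF J, of a] by (metis subset_insertI sum_distrib_right)
  also have "\<dots> = (\<Sum>i\<in>?J. if i = 0 then hcomp 0 a * hcomp 0 b else 0)"
    unfolding hcomp_sum by (intro sum.cong) (auto simp: hcomp_mult_left [OF hcomp_in])
  also have "\<dots> = hcomp 0 a * hcomp 0 b"
    using J by (subst sum.delta) auto
  finally show ?thesis .
qed

lemma \<epsilon>_mult: "\<epsilon> (a * b) = \<epsilon> a * \<epsilon> b"
  by (rule \<epsilon>_eqI, subst hcomp_zero_mult) (simp add: hcomp_zero_eq scale_mult_left)

lemma \<epsilon>_gr: "a \<in> gr i \<Longrightarrow> 0 < i \<Longrightarrow> \<epsilon> a = 0"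
  by (rule \<epsilon>_eqI) (simp add: hcomp_homogeneous)

lemma augmentation_eq: "augmentation scale gr a = \<epsilon> a"
  unfolding augmentation_def
proof (rule the_equality)
  let ?I = "span (\<Union>i\<in>{1..}. gr i)"
  let ?J = "insert 0 {i. hcomp i a \<noteq> 0}"
  have J: "finite ?J" using finite_hcomp by auto
  have "a = (\<Sum>i\<in>?J. hcomp i a)"
    using sum_hcomp_superset [OF J, of a] by (metis subset_insertI)
  also have "\<dots> = hcomp 0 a + (\<Sum>i\<in>?J - {0}. hcomp i a)"
    using sum.remove [OF J, of 0] by auto
  finally have "a - scale (\<epsilon> a) 1 = (\<Sum>i\<in>?J - {0}. hcomp i a)"
    by (metis add_diff_cancel_left' hcomp_zero_eq)
  moreover have "hcomp i a \<in> ?I" if "i \<in> ?J - {0}" for i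
    using hcomp_in [of i a] that by (intro span_base UN_I [of i]) auto
  then have "(\<Sum>i\<in>?J - {0}. hcomp i a) \<in> ?I"
    by (intro span_sum)
  ultimately show "a - scale (\<epsilon> a) 1 \<in> ?I" by simp
  fix c assume c: "a - scale c 1 \<in> ?I"
  have "?I \<subseteq> {x. \<epsilon> x = 0}"
    by (rule span_minimal) (auto simp: subspace_def \<epsilon>_add \<epsilon>_scale intro: \<epsilon>_gr)
  then have "\<epsilon> (a - scale c 1) = 0"
    using c by blast
  then have "\<epsilon> a + - c * \<epsilon> 1 = 0"
    by (metis \<epsilon>_add \<epsilon>_scale add_uminus_conv_diff scale_minus_left)
  then show "c = \<epsilon> a"
    by simp
qed

text \<open>Cochains have negative degrees, so the grading is extended by zero to the integers;
  \<open>ci\<close> is the projection onto its components.\<close>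

definition gri :: "int \<Rightarrow> 's set" where
  "gri j = (if 0 \<le> j then gr (nat j) else {0})"

definition ci :: "int \<Rightarrow> 's \<Rightarrow> 's" where
  "ci j x = (if 0 \<le> j then hcomp (nat j) x else 0)"

lemma gri_nat [simp]: "gri (int n) = gr n"
  by (simp add: gri_def)

lemma gri_0 [simp]: "0 \<in> gri j"
  and gri_add: "x \<in> gri j \<Longrightarrow> y \<in> gri j \<Longrightarrow> x + y \<in> gri j"
  and gri_neg: "x \<in> gri j \<Longrightarrow> - x \<in> gri j"
  and gri_scale: "x \<in> gri j \<Longrightarrow> scale c x \<in> gri j"
  and gri_sum: "(\<And>a. a \<in> A \<Longrightarrow> f a \<in> gri j) \<Longrightarrow> sum f A \<in> gri j"
  by (auto simp: gri_def gr_add gr_neg gr_scale gr_sum)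

lemma gri_mult: "a \<in> gr i \<Longrightarrow> x \<in> gri j \<Longrightarrow> a * x \<in> gri (int i + j)"
  using mult_gr [of a i x "nat j"] by (cases "0 \<le> j") (auto simp: gri_def nat_add_distrib)

lemma gri_mult_right: "x \<in> gri j \<Longrightarrow> a \<in> gr i \<Longrightarrow> x * a \<in> gri (j + int i)"
  using mult_gr [of x "nat j" a i] by (cases "0 \<le> j") (auto simp: gri_def nat_add_distrib)

lemma gri_mult2: "x \<in> gri j \<Longrightarrow> y \<in> gri i \<Longrightarrow> x * y \<in> gri (j + i)"
  using gri_mult_right [of x j y "nat i"] by (auto simp: gri_def split: if_splits)

lemma ci_in [simp]: "ci j x \<in> gri j"
  by (simp add: ci_def gri_def)

lemma ci_0 [simp]: "ci j 0 = 0"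
  and ci_add: "ci j (x + y) = ci j x + ci j y"
  and ci_scale: "ci j (scale c x) = scale c (ci j x)"
  and ci_sum: "ci j (sum f A) = (\<Sum>a\<in>A. ci j (f a))"
  by (auto simp: ci_def hcomp_add hcomp_scale hcomp_sum)

lemma ci_homogeneous: "x \<in> gri j \<Longrightarrow> ci i x = (if i = j then x else 0)"
  by (auto simp: ci_def gri_def hcomp_homogeneous split: if_splits)

lemma ci_mult_left: "a \<in> gr i \<Longrightarrow> ci (int i + j) (a * x) = a * ci j x"
  by (auto simp: ci_def hcomp_mult_left nat_add_distrib)

lemma ci_mult_right: "a \<in> gr i \<Longrightarrow> ci (j + int i) (x * a) = ci j x * a"
  by (auto simp: ci_def hcomp_mult_right nat_add_distrib nat_le_iff nat_diff_distrib)

lemma finite_ci: "finite {j. ci j x \<noteq> 0}"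
proof -
  have "{j. ci j x \<noteq> 0} \<subseteq> int ` {i. hcomp i x \<noteq> 0}"
    by (auto simp: ci_def image_iff split: if_splits) (metis nat_0_le)
  then show ?thesis
    using finite_hcomp finite_surj by blast
qed

lemma sum_ci:
  assumes "finite J" "{j. ci j x \<noteq> 0} \<subseteq> J"
  shows "(\<Sum>j\<in>J. ci j x) = x"
proof -
  let ?I = "{i. hcomp i x \<noteq> 0}"
  have "(\<Sum>j\<in>J. ci j x) = (\<Sum>j\<in>int ` ?I. ci j x)"
  proof (rule sum.mono_neutral_right)
    show "int ` ?I \<subseteq> J"
      using assms(2) by (auto simp: ci_def)
    show "\<forall>i\<in>J - int ` ?I. ci i x = 0"
      by (auto simp: ci_def image_iff) (metis nat_0_le)
  qed (use assms in auto)
  also have "\<dots> = x"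
    by (subst sum.reindex) (auto simp: ci_def sum_hcomp)
  finally show ?thesis .
qed

lemma ci_0_eq: "ci 0 x = scale (\<epsilon> x) 1"
  by (simp add: ci_def hcomp_zero_eq)

end

section \<open>Modules and projectivity\<close>

lemma add_subgroup_0: "add_subgroup C \<Longrightarrow> 0 \<in> C"
  and add_subgroup_add: "add_subgroup C \<Longrightarrow> x \<in> C \<Longrightarrow> y \<in> C \<Longrightarrow> x + y \<in> C"
  and add_subgroup_neg: "add_subgroup C \<Longrightarrow> x \<in> C \<Longrightarrow> - x \<in> C"
  by (auto simp: add_subgroup_def)

lemma left_module_subgroup: "left_module M \<Longrightarrow> add_subgroup (Car M)"
  and left_module_act: "left_module M \<Longrightarrow> x \<in> Car M \<Longrightarrow> Act M a x \<in> Car M"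
  and left_module_act_add: "left_module M \<Longrightarrow> x \<in> Car M \<Longrightarrow> y \<in> Car M \<Longrightarrow> Act M a (x + y) = Act M a x + Act M a y"
  and left_module_add_act: "left_module M \<Longrightarrow> x \<in> Car M \<Longrightarrow> Act M (a + b) x = Act M a x + Act M b x"
  and left_module_act_act: "left_module M \<Longrightarrow> x \<in> Car M \<Longrightarrow> Act M (a * b) x = Act M a (Act M b x)"
  by (auto simp: left_module_def)

lemma left_module_0: "left_module M \<Longrightarrow> 0 \<in> Car M"
  by (simp add: add_subgroup_0 left_module_subgroup)

lemma left_module_0_act: "left_module M \<Longrightarrow> x \<in> Car M \<Longrightarrow> Act M 0 x = 0"
  using left_module_add_act [of M x 0 0] by simp

lemma left_module_act_0: "left_module M \<Longrightarrow> Act M a 0 = 0"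
  using left_module_act_add [of M 0 0 a] left_module_0 [of M] by simp

lemma left_module_act_sum:
  assumes M: "left_module M" and x: "\<And>i. i \<in> I \<Longrightarrow> x i \<in> Car M"
  shows "Act M a (\<Sum>i\<in>I. x i) = (\<Sum>i\<in>I. Act M a (x i))"
  using x
proof (induction I rule: infinite_finite_induct)
  case (insert i I)
  then have "sum x I \<in> Car M"
    using add_subgroup_sum [OF left_module_subgroup [OF M], of I x] by auto
  then show ?case
    using insert left_module_act_add [OF M, of "x i" "sum x I"] by simp
qed (simp_all add: left_module_act_0 [OF M])

lemma left_module_act_neg:
  assumes M: "left_module M" and x: "x \<in> Car M"
  shows "Act M a (- x) = - Act M a x"
proof -
  have "Act M a x + Act M a (- x) = 0"
    using left_module_act_add [OF M x, of "- x" a] left_module_act_0 [OF M]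
      add_subgroup_neg [OF left_module_subgroup [OF M] x] by simp
  then show ?thesis by (simp add: eq_neg_iff_add_eq_0 add.commute)
qed

lemma module_hom_on_closed: "module_hom_on M N f \<Longrightarrow> x \<in> Car M \<Longrightarrow> f x \<in> Car N"
  and module_hom_on_add: "module_hom_on M N f \<Longrightarrow> x \<in> Car M \<Longrightarrow> y \<in> Car M \<Longrightarrow> f (x + y) = f x + f y"
  and module_hom_on_act: "module_hom_on M N f \<Longrightarrow> x \<in> Car M \<Longrightarrow> f (Act M a x) = Act N a (f x)"
  by (auto simp: module_hom_on_def)

lemma module_hom_on_0:
  assumes "module_hom_on M N f" "left_module M"
  shows "f 0 = 0"
  using module_hom_on_add [OF assms(1), of 0 0] left_module_0 [OF assms(2)] by simp

lemma module_hom_on_neg: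
  assumes "module_hom_on M N f" "left_module M" "x \<in> Car M"
  shows "f (- x) = - f x"
proof -
  have "f x + f (- x) = 0"
    using module_hom_on_add [OF assms(1,3), of "- x"] module_hom_on_0 [OF assms(1,2)]
      add_subgroup_neg [OF left_module_subgroup [OF assms(2)] assms(3)] by simp
  then show ?thesis by (simp add: eq_neg_iff_add_eq_0 add.commute)
qed

lemma module_hom_on_diff:
  assumes "module_hom_on M N f" "left_module M" "x \<in> Car M" "y \<in> Car M"
  shows "f (x - y) = f x - f y"
  using module_hom_on_add [OF assms(1,3), of "- y"] module_hom_on_neg [OF assms(1,2,4)]
    add_subgroup_neg [OF left_module_subgroup [OF assms(2)] assms(4)] by simp

lemma module_hom_on_sum:
  assumes "module_hom_on M N f" "left_module M" "\<And>i. i \<in> I \<Longrightarrow> x i \<in> Car M"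
  shows "f (\<Sum>i\<in>I. x i) = (\<Sum>i\<in>I. f (x i))"
  using assms(3)
proof (induction I rule: infinite_finite_induct)
  case (insert i I)
  then have "sum x I \<in> Car M"
    using add_subgroup_sum [OF left_module_subgroup [OF assms(2)], of I x] by auto
  then show ?case
    using insert module_hom_on_add [OF assms(1), of "x i" "sum x I"] by simp
qed (simp_all add: module_hom_on_0 [OF assms(1,2)])

lemma module_hom_on_compose:
  "module_hom_on M N f \<Longrightarrow> module_hom_on N L g \<Longrightarrow> module_hom_on M L (\<lambda>x. g (f x))"
  by (auto simp: module_hom_on_def image_subset_iff)

lemma module_hom_on_plus:
  assumes "module_hom_on M N f" "module_hom_on M N g" "left_module N"
  shows "module_hom_on M N (\<lambda>x. f x + g x)"
  using assms by (auto simp: module_hom_on_def left_module_def add_subgroup_def image_subset_iff algebra_simps)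

lemma left_module_kernel:
  assumes "left_module M" "left_module N" "module_hom_on M N f"
  shows "left_module \<lparr>Car = {x \<in> Car M. f x = 0}, Act = Act M\<rparr>"
proof -
  have "f (- x) = 0" if "x \<in> Car M" "f x = 0" for x
    using module_hom_on_neg [OF assms(3,1) that(1)] that by simp
  then show ?thesis
    using assms module_hom_on_0 [OF assms(3,1)] left_module_act_0 [OF assms(2)]
    by (auto simp: left_module_def add_subgroup_def module_hom_on_def)
qed

lemma projective_left_module: "projective P \<Longrightarrow> left_module P"
  by (simp add: projective_def)

text \<open>\<open>projective\<close> provides lifts along surjections. Replacing \<open>N'\<close>
  by the image of \<open>g\<close> leaves only the condition that this image contains that of
  \<open>f\<close>, which is what exactness of a complex supplies.\<close>

lemma projective_lift:
  fixes P :: "('s::ring_1, 's univ, 'y) lmod_scheme"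
    and N :: "('s, 's univ, 'z) lmod_scheme" and N' :: "('s, 's univ, 'w) lmod_scheme"
  assumes P: "projective P" and N: "left_module N" and N': "left_module N'"
    and g: "module_hom_on N N' g" and f: "module_hom_on P N' f" and im: "f ` Car P \<subseteq> g ` Car N"
  shows "\<exists>h. module_hom_on P N h \<and> (\<forall>x\<in>Car P. g (h x) = f x)"
proof -
  let ?N = "\<lparr>Car = Car N, Act = Act N\<rparr>" and ?I = "\<lparr>Car = g ` Car N, Act = Act N'\<rparr>"
  have "left_module ?N"
    using N by (simp add: left_module_def)
  moreover have "left_module ?I"
  proof -
    have sub: "g ` Car N \<subseteq> Car N'"
      using g by (simp add: module_hom_on_def)
    have "0 \<in> g ` Car N"
      using module_hom_on_0 [OF g N] left_module_0 [OF N] by (metis image_eqI)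
    moreover have "g x + g y \<in> g ` Car N" if "x \<in> Car N" "y \<in> Car N" for x y
      using module_hom_on_add [OF g that] add_subgroup_add [OF left_module_subgroup [OF N] that]
      by (metis image_eqI)
    moreover have "- g x \<in> g ` Car N" if "x \<in> Car N" for x
      using module_hom_on_neg [OF g N that] add_subgroup_neg [OF left_module_subgroup [OF N] that]
      by (metis image_eqI)
    moreover have "Act N' a (g x) \<in> g ` Car N" if "x \<in> Car N" for a x
      using module_hom_on_act [OF g that] left_module_act [OF N that] by (metis image_eqI)
    ultimately show ?thesis
      using N' sub unfolding left_module_def add_subgroup_def by (auto simp: subset_iff image_iff)
  qed
  moreover have "module_hom_on ?N ?I g" "module_hom_on P ?I f"
    using g f im by (auto simp: module_hom_on_def)
  ultimately obtain h where h: "module_hom_on P ?N h" "\<forall>x\<in>Car P. g (h x) = f x"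
    using P unfolding projective_def by (metis lmod.select_convs(1))
  then show ?thesis
    by (auto simp: module_hom_on_def)
qed

text \<open>Dual basis criterion: if \<open>g (n j) = f (e j)\<close>, then mapping \<open>x\<close>
  to the sum of the terms \<open>lam j x\<close> times \<open>n j\<close> lifts \<open>f\<close>. It
  serves both for free modules and for the modules \<open>SW N\<close>.\<close>

lemma projective_dual_basis:
  fixes P :: "('s::ring_1, 's univ, 'y) lmod_scheme" and e :: "'j \<Rightarrow> 's univ" and lam :: "'j \<Rightarrow> 's univ \<Rightarrow> 's"
  assumes P: "left_module P" and e: "\<And>j. j \<in> J \<Longrightarrow> e j \<in> Car P"
    and add: "\<And>j x y. j \<in> J \<Longrightarrow> x \<in> Car P \<Longrightarrow> y \<in> Car P \<Longrightarrow> lam j (x + y) = lam j x + lam j y"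
    and act: "\<And>j a x. j \<in> J \<Longrightarrow> x \<in> Car P \<Longrightarrow> lam j (Act P a x) = a * lam j x"
    and fin: "\<And>x. x \<in> Car P \<Longrightarrow> finite {j \<in> J. lam j x \<noteq> 0}"
    and expand: "\<And>x. x \<in> Car P \<Longrightarrow> (\<Sum>j | j \<in> J \<and> lam j x \<noteq> 0. Act P (lam j x) (e j)) = x"
  shows "projective P"
  unfolding projective_def
proof (intro conjI allI impI P)
  fix N N' :: "('s, 's univ) lmod" and g f
  assume *: "left_module N \<and> left_module N' \<and> module_hom_on N N' g \<and> g ` Car N = Car N' \<and>
        module_hom_on P N' f"
  then have N: "left_module N" and N': "left_module N'" and g: "module_hom_on N N' g"
    and im: "g ` Car N = Car N'" and f: "module_hom_on P N' f" by auto
  have "\<exists>n. n \<in> Car N \<and> g n = f (e j)" if "j \<in> J" for j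
    using im module_hom_on_closed [OF f e [OF that]] by (metis imageE)
  then obtain n where n: "\<And>j. j \<in> J \<Longrightarrow> n j \<in> Car N" "\<And>j. j \<in> J \<Longrightarrow> g (n j) = f (e j)"
    by metis
  define h where "h = (\<lambda>x. \<Sum>j | j \<in> J \<and> lam j x \<noteq> 0. Act N (lam j x) (n j))"
  have hJ: "h x = (\<Sum>j\<in>K. Act N (lam j x) (n j))"
    if "finite K" "K \<subseteq> J" "{j \<in> J. lam j x \<noteq> 0} \<subseteq> K" for x K
    unfolding h_def
    by (rule sum.mono_neutral_left) (use that n left_module_0_act [OF N] in auto)
  have hc: "h x \<in> Car N" for x
    unfolding h_def using add_subgroup_sum [OF left_module_subgroup [OF N]] left_module_act [OF N] n
    by (metis (no_types, lifting) mem_Collect_eq)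
  have "module_hom_on P N h"
    unfolding module_hom_on_def
  proof (intro conjI ballI allI)
    show "h ` Car P \<subseteq> Car N" using hc by blast
    fix x assume x: "x \<in> Car P"
    show "h (x + y) = h x + h y" if y: "y \<in> Car P" for y
    proof -
      let ?K = "{j \<in> J. lam j x \<noteq> 0} \<union> {j \<in> J. lam j y \<noteq> 0}"
      have K: "finite ?K" "?K \<subseteq> J" using fin x y by auto
      have "h (x + y) = (\<Sum>j\<in>?K. Act N (lam j x + lam j y) (n j))"
        by (subst hJ [OF K]) (auto simp: add x y intro!: sum.cong)
      also have "\<dots> = (\<Sum>j\<in>?K. Act N (lam j x) (n j)) + (\<Sum>j\<in>?K. Act N (lam j y) (n j))"
        unfolding sum.distrib [symmetric] using K n
        by (intro sum.cong) (auto simp: left_module_add_act [OF N])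
      also have "\<dots> = h x + h y"
        using hJ [OF K, of x] hJ [OF K, of y] by auto
      finally show ?thesis .
    qed
    show "h (Act P a x) = Act N a (h x)" for a
    proof -
      let ?K = "{j \<in> J. lam j x \<noteq> 0}"
      have K: "finite ?K" "?K \<subseteq> J" using fin x by auto
      have "h (Act P a x) = (\<Sum>j\<in>?K. Act N (a * lam j x) (n j))"
        by (subst hJ [OF K]) (auto simp: act x)
      also have "\<dots> = (\<Sum>j\<in>?K. Act N a (Act N (lam j x) (n j)))"
        using n by (intro sum.cong) (auto simp: left_module_act_act [OF N])
      also have "\<dots> = Act N a (h x)"
        unfolding h_def by (subst left_module_act_sum [OF N]) (auto intro: left_module_act [OF N] n)
      finally show ?thesis .
    qed
  qed
  moreover have "g (h x) = f x" if x: "x \<in> Car P" for x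
  proof -
    have "g (h x) = (\<Sum>j | j \<in> J \<and> lam j x \<noteq> 0. g (Act N (lam j x) (n j)))"
      unfolding h_def by (rule module_hom_on_sum [OF g N]) (auto intro: left_module_act [OF N] n)
    also have "\<dots> = (\<Sum>j | j \<in> J \<and> lam j x \<noteq> 0. f (Act P (lam j x) (e j)))"
      by (intro sum.cong) (auto simp: module_hom_on_act [OF g] n module_hom_on_act [OF f] e)
    also have "\<dots> = f (\<Sum>j | j \<in> J \<and> lam j x \<noteq> 0. Act P (lam j x) (e j))"
      by (rule module_hom_on_sum [OF f P, symmetric]) (auto intro: left_module_act [OF P] e)
    finally show ?thesis
      by (simp add: expand [OF x])
  qed
  ultimately show "\<exists>h. module_hom_on P N h \<and> (\<forall>x\<in>Car P. g (h x) = f x)"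
    by blast
qed

section \<open>Graded modules of finitely supported functions\<close>

definition uact :: "'s::ring_1 \<Rightarrow> 's univ \<Rightarrow> 's univ" where
  "uact a f = (\<lambda>q. a * f q)"

lemma uact_apply [simp]: "uact a f q = a * f q"
  by (simp add: uact_def)

lemma uact_add_right: "uact a (f + g) = uact a f + uact a g"
  and uact_add_left: "uact (a + b) f = uact a f + uact b f"
  and uact_mult: "uact (a * b) f = uact a (uact b f)"
  and uact_1 [simp]: "uact 1 f = f"
  and uact_0_left [simp]: "uact 0 f = 0"
  and uact_0_right [simp]: "uact a 0 = 0"
  by (auto simp: fun_eq_iff algebra_simps)

context connected_graded_algebra
begin

definition usc :: "'k \<Rightarrow> 's univ \<Rightarrow> 's univ" where
  "usc c f = (\<lambda>q. scale c (f q))"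

lemma usc_apply [simp]: "usc c f q = scale c (f q)"
  by (simp add: usc_def)

sublocale uv: vector_space usc
  by unfold_locales (auto simp: fun_eq_iff scale_left_distrib scale_right_distrib)

lemma usc_eq_uact: "usc c f = uact (scale c 1) f"
  by (simp add: fun_eq_iff scale_mult_left)

text \<open>
  The function with value \<open>a\<close> at \<open>q\<close> and \<open>0\<close> elsewhere has degree \<open>i + \<delta> q\<close> if \<open>a \<in> gr i\<close>, so that
  the finitely supported functions form \<open>\<Oplus>\<^sub>q S(-\<delta> q)\<close>.
\<close>

definition ucomp :: "(nat \<Rightarrow> nat) \<Rightarrow> int \<Rightarrow> 's univ \<Rightarrow> 's univ" where
  "ucomp \<delta> j f = (\<lambda>q. ci (j - int (\<delta> q)) (f q))"

lemma ucomp_apply [simp]: "ucomp \<delta> j f q = ci (j - int (\<delta> q)) (f q)"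
  by (simp add: ucomp_def)

definition gdeg :: "(nat \<Rightarrow> nat) \<Rightarrow> int \<Rightarrow> 's univ set" where
  "gdeg \<delta> j = {f. \<forall>q. f q \<in> gri (j - int (\<delta> q))}"

lemma ucomp_gdeg [simp]: "ucomp \<delta> j f \<in> gdeg \<delta> j"
  by (simp add: gdeg_def)

lemma ucomp_0 [simp]: "ucomp \<delta> j 0 = 0"
  by (auto simp: fun_eq_iff)

lemma ucomp_sum: "ucomp \<delta> j (sum f A) = (\<Sum>i\<in>A. ucomp \<delta> j (f i))"
  by (rule ext) (simp add: sum_fun_apply ci_sum)

lemma ucomp_homogeneous: "f \<in> gdeg \<delta> j \<Longrightarrow> ucomp \<delta> i f = (if i = j then f else 0)"
  using ci_homogeneous [of "f q" "j - int (\<delta> q)" "i - int (\<delta> q)" for q] by (auto simp: fun_eq_iff gdeg_def)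

lemma gdeg_0 [simp]: "0 \<in> gdeg \<delta> j"
  and gdeg_add: "f \<in> gdeg \<delta> j \<Longrightarrow> g \<in> gdeg \<delta> j \<Longrightarrow> f + g \<in> gdeg \<delta> j"
  and gdeg_neg: "f \<in> gdeg \<delta> j \<Longrightarrow> - f \<in> gdeg \<delta> j"
  and gdeg_usc: "f \<in> gdeg \<delta> j \<Longrightarrow> usc c f \<in> gdeg \<delta> j"
  by (auto simp: gdeg_def gri_add gri_neg gri_scale)

lemma gdeg_uact: "a \<in> gr i \<Longrightarrow> f \<in> gdeg \<delta> j \<Longrightarrow> uact a f \<in> gdeg \<delta> (int i + j)"
  using gri_mult [of a i "f q" "j - int (\<delta> q)" for q] by (auto simp: gdeg_def add_diff_eq)

lemma gdeg_negative: "f \<in> gdeg \<delta> j \<Longrightarrow> j < 0 \<Longrightarrow> f = 0"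
  by (auto simp: gdeg_def gri_def fun_eq_iff)

lemma finite_ucomp:
  assumes "finite {q. f q \<noteq> 0}"
  shows "finite {j. ucomp \<delta> j f \<noteq> 0}"
proof (rule finite_subset)
  show "{j. ucomp \<delta> j f \<noteq> 0} \<subseteq> (\<Union>q\<in>{q. f q \<noteq> 0}. (\<lambda>j. j + int (\<delta> q)) ` {j. ci j (f q) \<noteq> 0})"
  proof
    fix j assume "j \<in> {j. ucomp \<delta> j f \<noteq> 0}"
    then obtain q where q: "ci (j - int (\<delta> q)) (f q) \<noteq> 0"
      by (auto simp: fun_eq_iff)
    then have "f q \<noteq> 0" by auto
    moreover have "j \<in> (\<lambda>j. j + int (\<delta> q)) ` {j. ci j (f q) \<noteq> 0}"
      using q by (intro image_eqI [of _ _ "j - int (\<delta> q)"]) auto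
    ultimately show "j \<in> (\<Union>q\<in>{q. f q \<noteq> 0}. (\<lambda>j. j + int (\<delta> q)) ` {j. ci j (f q) \<noteq> 0})"
      by blast
  qed
qed (use assms finite_ci in auto)

lemma sum_ucomp:
  assumes J: "finite J" "{j. ucomp \<delta> j f \<noteq> 0} \<subseteq> J"
  shows "(\<Sum>j\<in>J. ucomp \<delta> j f) = f"
proof
  fix q
  have "(\<Sum>j\<in>J. ci (j - int (\<delta> q)) (f q)) = (\<Sum>j\<in>(\<lambda>j. j - int (\<delta> q)) ` J. ci j (f q))"
    by (subst sum.reindex) (auto simp: inj_on_def)
  also have "\<dots> = f q"
  proof (rule sum_ci)
    show "{j. ci j (f q) \<noteq> 0} \<subseteq> (\<lambda>j. j - int (\<delta> q)) ` J"
    proof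
      fix j assume "j \<in> {j. ci j (f q) \<noteq> 0}"
      then have "ucomp \<delta> (j + int (\<delta> q)) f q \<noteq> 0" by simp
      then have "ucomp \<delta> (j + int (\<delta> q)) f \<noteq> 0" by (metis zero_fun_apply)
      then show "j \<in> (\<lambda>j. j - int (\<delta> q)) ` J"
        using J(2) by (intro image_eqI [of _ _ "j + int (\<delta> q)"]) auto
    qed
  qed (use J in auto)
  finally show "(\<Sum>j\<in>J. ucomp \<delta> j f) q = f q"
    by (simp add: sum_fun_apply)
qed

text \<open>Graded submodules of \<open>\<Oplus>\<^sub>q S(-\<delta> q)\<close>. Finite support is
  imposed on each element because an arbitrary element of the ambient product may have infinitely
  many homogeneous components.\<close>

definition gsub :: "(nat \<Rightarrow> nat) \<Rightarrow> 's univ set \<Rightarrow> bool" where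
  "gsub \<delta> C \<longleftrightarrow> add_subgroup C \<and> (\<forall>a. \<forall>f\<in>C. uact a f \<in> C) \<and> (\<forall>f\<in>C. finite {q. f q \<noteq> 0}) \<and>
     (\<forall>j. \<forall>f\<in>C. ucomp \<delta> j f \<in> C)"

definition gm :: "(nat \<Rightarrow> nat) \<Rightarrow> 's univ set \<Rightarrow> ('s, 's univ) gmod" where
  "gm \<delta> C = \<lparr>Car = C, Act = uact, Deg = (\<lambda>j. C \<inter> gdeg \<delta> j)\<rparr>"

lemma gm_simps [simp]: "Car (gm \<delta> C) = C" "Act (gm \<delta> C) = uact" "Deg (gm \<delta> C) j = C \<inter> gdeg \<delta> j"
  by (auto simp: gm_def)

lemma gsub_subgroup: "gsub \<delta> C \<Longrightarrow> add_subgroup C"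
  and gsub_act: "gsub \<delta> C \<Longrightarrow> f \<in> C \<Longrightarrow> uact a f \<in> C"
  and gsub_finite: "gsub \<delta> C \<Longrightarrow> f \<in> C \<Longrightarrow> finite {q. f q \<noteq> 0}"
  and gsub_ucomp: "gsub \<delta> C \<Longrightarrow> f \<in> C \<Longrightarrow> ucomp \<delta> j f \<in> C"
  by (auto simp: gsub_def)

lemma gsub_0: "gsub \<delta> C \<Longrightarrow> 0 \<in> C"
  and gsub_add: "gsub \<delta> C \<Longrightarrow> f \<in> C \<Longrightarrow> g \<in> C \<Longrightarrow> f + g \<in> C"
  and gsub_usc: "gsub \<delta> C \<Longrightarrow> f \<in> C \<Longrightarrow> usc c f \<in> C"
  by (auto simp: gsub_def add_subgroup_def usc_eq_uact)

lemma gsub_subspace: "gsub \<delta> C \<Longrightarrow> uv.subspace C"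
  by (auto simp: uv.subspace_def gsub_0 gsub_add gsub_usc)

lemma gdeg_subspace: "uv.subspace (gdeg \<delta> j)"
  by (auto simp: uv.subspace_def gdeg_add gdeg_usc)

lemma gsub_left_module: "gsub \<delta> C \<Longrightarrow> left_module (gm \<delta> C)"
  by (auto simp: gsub_def left_module_def uact_add_left uact_add_right uact_mult)

lemma gsub_graded_module:
  assumes C: "gsub \<delta> C"
  shows "graded_module gr (gm \<delta> C)"
  unfolding graded_module_def
proof (intro conjI allI ballI gsub_left_module [OF C])
  show "internal_direct_sum (Deg (gm \<delta> C)) (Car (gm \<delta> C))"
    unfolding internal_direct_sum_def gm_simps
  proof (intro conjI allI ballI)
    show "C \<inter> gdeg \<delta> i \<subseteq> C" for i by auto
    show "add_subgroup (C \<inter> gdeg \<delta> i)" for i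
      using gsub_subgroup [OF C] by (auto simp: add_subgroup_def gdeg_add gdeg_neg)
    fix f assume f: "f \<in> C"
    have fin: "finite {j. ucomp \<delta> j f \<noteq> 0}"
      using finite_ucomp gsub_finite [OF C f] by blast
    show "\<exists>!g. (\<forall>i. g i \<in> C \<inter> gdeg \<delta> i) \<and> finite {i. g i \<noteq> 0} \<and> f = (\<Sum>i | g i \<noteq> 0. g i)"
    proof (rule ex1I [of _ "\<lambda>j. ucomp \<delta> j f"])
      show "(\<forall>i. ucomp \<delta> i f \<in> C \<inter> gdeg \<delta> i) \<and> finite {i. ucomp \<delta> i f \<noteq> 0} \<and>
          f = (\<Sum>i | ucomp \<delta> i f \<noteq> 0. ucomp \<delta> i f)"
        using fin sum_ucomp [OF fin] gsub_ucomp [OF C f] by auto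
      fix g assume g: "(\<forall>i. g i \<in> C \<inter> gdeg \<delta> i) \<and> finite {i. g i \<noteq> 0} \<and> f = (\<Sum>i | g i \<noteq> 0. g i)"
      have "ucomp \<delta> j f = g j" for j
      proof -
        have "ucomp \<delta> j f = (\<Sum>i | g i \<noteq> 0. ucomp \<delta> j (g i))"
          using arg_cong [OF conjunct2 [OF conjunct2 [OF g]], of "ucomp \<delta> j"] unfolding ucomp_sum .
        also have "\<dots> = (\<Sum>i | g i \<noteq> 0. if j = i then g i else 0)"
          by (intro sum.cong refl ucomp_homogeneous) (use g in blast)
        also have "\<dots> = g j" using g by simp
        finally show ?thesis .
      qed
      then show "g = (\<lambda>j. ucomp \<delta> j f)" by auto
    qed
  qed
  show "Act (gm \<delta> C) a x \<in> Deg (gm \<delta> C) (int i + n)" if "a \<in> gr i" "x \<in> Deg (gm \<delta> C) n" for i n a x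
    using that gsub_act [OF C] gdeg_uact by auto
qed

text \<open>Natural degrees suffice, since \<open>S\<close> and the shifts \<open>\<delta> q\<close>
  live in nonnegative degrees.\<close>

definition pieces :: "(nat \<Rightarrow> nat) \<Rightarrow> 's univ set \<Rightarrow> nat \<Rightarrow> 's univ set" where
  "pieces \<delta> C j = C \<inter> gdeg \<delta> (int j)"

lemma gsub_ucomp_pieces:
  assumes "gsub \<delta> C" "f \<in> C"
  shows "ucomp \<delta> (int j) f \<in> pieces \<delta> C j"
  using gsub_ucomp [OF assms] by (simp add: pieces_def)

lemma gsub_sum_pieces:
  assumes C: "gsub \<delta> C" and f: "f \<in> C"
  shows "\<exists>J. finite J \<and> (\<forall>j. j \<notin> J \<longrightarrow> ucomp \<delta> (int j) f = 0) \<and> f = (\<Sum>j\<in>J. ucomp \<delta> (int j) f)"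
proof -
  let ?J = "{j. ucomp \<delta> j f \<noteq> 0}"
  have fin: "finite ?J"
    using finite_ucomp gsub_finite [OF C f] by blast
  have "0 \<le> j" if "j \<in> ?J" for j
    using gdeg_negative [OF ucomp_gdeg [of \<delta> j f]] that by force
  then have J: "?J = int ` (nat ` ?J)"
    by (auto simp: image_image intro!: image_eqI)
  have "f = (\<Sum>j\<in>?J. ucomp \<delta> j f)"
    using sum_ucomp [OF fin] by auto
  also have "\<dots> = (\<Sum>j\<in>nat ` ?J. ucomp \<delta> (int j) f)"
    by (subst J, subst sum.reindex) auto
  finally have "f = (\<Sum>j\<in>nat ` ?J. ucomp \<delta> (int j) f)" .
  moreover have "ucomp \<delta> (int j) f = 0" if "j \<notin> nat ` ?J" for j
    using that by (metis (mono_tags) image_eqI mem_Collect_eq nat_int)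
  ultimately show ?thesis
    using fin by (intro exI [of _ "nat ` ?J"]) blast
qed

lemma pieces_subspace: "gsub \<delta> C \<Longrightarrow> uv.subspace (pieces \<delta> C j)"
  unfolding pieces_def by (intro uv.subspace_inter gsub_subspace gdeg_subspace)

text \<open>Finite dimension of every component is what allows the generators of a free cover to be
  listed degree by degree and coded by natural numbers.\<close>

definition locfin :: "(nat \<Rightarrow> nat) \<Rightarrow> 's univ set \<Rightarrow> bool" where
  "locfin \<delta> C \<longleftrightarrow> (\<forall>j. \<exists>B. finite B \<and> pieces \<delta> C j \<subseteq> uv.span B)"

lemma locfin_mono: "locfin \<delta> C \<Longrightarrow> D \<subseteq> C \<Longrightarrow> locfin \<delta> D"
  unfolding locfin_def pieces_def by (meson Int_mono order_refl order_trans)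

end

section \<open>Comparison of resolutions\<close>

text \<open>The augmentation stands in for the differential out of term 0, so that exactness has the
  same form at all terms.\<close>

definition res_cycles :: "(nat \<Rightarrow> ('s::ring_1, 's univ, 'y) lmod_scheme) \<Rightarrow>
    (nat \<Rightarrow> 's univ \<Rightarrow> 's univ) \<Rightarrow> ('s univ \<Rightarrow> 'm::zero) \<Rightarrow> nat \<Rightarrow> 's univ set" where
  "res_cycles P d e i = (case i of 0 \<Rightarrow> {x \<in> Car (P 0). e x = 0} | Suc k \<Rightarrow> {x \<in> Car (P i). d k x = 0})"

lemma projective_resolutionD:
  assumes "projective_resolution P d e M"
  shows "projective (P i)" "left_module (P i)" "module_hom_on (P (Suc i)) (P i) (d i)" "module_hom_on (P 0) M e"
    "e ` Car (P 0) = Car M" "res_cycles P d e i = d i ` Car (P (Suc i))"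
  using assms unfolding projective_resolution_def res_cycles_def
  by (auto simp: projective_left_module split: nat.split)

lemma res_cycles_subset: "res_cycles P d e i \<subseteq> Car (P i)"
  by (auto simp: res_cycles_def split: nat.splits)

lemma projective_resolution_comp:
  assumes "projective_resolution P d e M" "x \<in> Car (P (Suc (Suc i)))"
  shows "d i (d (Suc i) x) = 0"
  using projective_resolutionD(6) [OF assms(1), of "Suc i"] assms(2) by (auto simp: res_cycles_def)

text \<open>Comparison theorem. No grading is involved, so a graded resolution can be compared with
  an ungraded one of finite length.\<close>

lemma chain_map_exists:
  fixes P :: "nat \<Rightarrow> ('s::ring_1, 's univ, 'y) lmod_scheme" and T :: "nat \<Rightarrow> ('s, 's univ, 'z) lmod_scheme"
    and M :: "('s, 's univ, 'w) lmod_scheme"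
  assumes M: "left_module M" and P: "projective_resolution P d e M" and T: "projective_resolution T d' e' M"
  shows "\<exists>\<alpha>. (\<forall>i. module_hom_on (P i) (T i) (\<alpha> i)) \<and> (\<forall>x\<in>Car (P 0). e' (\<alpha> 0 x) = e x) \<and>
    (\<forall>i. \<forall>x\<in>Car (P (Suc i)). d' i (\<alpha> (Suc i) x) = \<alpha> i (d i x))"
proof -
  note P' = projective_resolutionD [OF P] and T' = projective_resolutionD [OF T]
  \<comment> \<open>Besides being a module map, each component must send cycles to cycles: then its
    composite with \<open>d i\<close> takes values in the boundaries of \<open>T\<close>, by
    exactness, and can be lifted.\<close>
  define Q where "Q = (\<lambda>i a. module_hom_on (P i) (T i) a \<and> a ` res_cycles P d e i \<subseteq> res_cycles T d' e' i \<and>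
     (i = 0 \<longrightarrow> (\<forall>x\<in>Car (P 0). e' (a x) = e x)))"
  have "\<exists>\<alpha>. \<forall>i. Q i (\<alpha> i) \<and> (\<forall>x\<in>Car (P (Suc i)). d' i (\<alpha> (Suc i) x) = \<alpha> i (d i x))"
  proof (rule dependent_nat_choice)
    have "e ` Car (P 0) \<subseteq> e' ` Car (T 0)"
      using P' T' by auto
    from projective_lift [OF P'(1) T'(2) M T'(4) P'(4) this]
    obtain h where "module_hom_on (P 0) (T 0) h" "\<forall>x\<in>Car (P 0). e' (h x) = e x" by blast
    then show "\<exists>a. Q 0 a"
      by (intro exI [of _ h]) (auto simp: Q_def res_cycles_def module_hom_on_def)
  next
    fix a i assume "Q i a"
    then have a: "module_hom_on (P i) (T i) a" "a ` res_cycles P d e i \<subseteq> res_cycles T d' e' i"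
      by (auto simp: Q_def)
    have "(\<lambda>x. a (d i x)) ` Car (P (Suc i)) \<subseteq> d' i ` Car (T (Suc i))"
      using a(2) unfolding P'(6) T'(6) by auto
    from projective_lift [OF P'(1) T'(2) T'(2) T'(3) module_hom_on_compose [OF P'(3) a(1)] this]
    obtain h where h: "module_hom_on (P (Suc i)) (T (Suc i)) h" "\<forall>x\<in>Car (P (Suc i)). d' i (h x) = a (d i x)"
      by blast
    have "a 0 = 0"
      using module_hom_on_0 [OF a(1) P'(2)] .
    then have "Q (Suc i) h"
      using h by (auto simp: Q_def res_cycles_def module_hom_on_def)
    then show "\<exists>h. Q (Suc i) h \<and> (\<forall>x\<in>Car (P (Suc i)). d' i (h x) = a (d i x))"
      using h by blast
  qed
  then obtain \<alpha> where "\<forall>i. Q i (\<alpha> i) \<and> (\<forall>x\<in>Car (P (Suc i)). d' i (\<alpha> (Suc i) x) = \<alpha> i (d i x))"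
    by blast
  then show ?thesis
    unfolding Q_def by (intro exI [of _ \<alpha>]) auto
qed

text \<open>A chain map from \<open>P\<close> to itself that covers zero on \<open>M\<close> is
  null-homotopic. The homotopy equation is recorded from term 1 upwards, which is where it will be
  applied.\<close>

lemma homotopy_exists:
  fixes P :: "nat \<Rightarrow> ('s::ring_1, 's univ, 'y) lmod_scheme" and M :: "('s, 's univ, 'w) lmod_scheme"
  assumes P: "projective_resolution P d e M"
    and \<phi>: "\<And>i. module_hom_on (P i) (P i) (\<phi> i)" "\<And>x. x \<in> Car (P 0) \<Longrightarrow> e (\<phi> 0 x) = 0"
      "\<And>i x. x \<in> Car (P (Suc i)) \<Longrightarrow> d i (\<phi> (Suc i) x) = \<phi> i (d i x)"
  shows "\<exists>h. (\<forall>i. module_hom_on (P i) (P (Suc i)) (h i)) \<and>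
    (\<forall>i. \<forall>x\<in>Car (P (Suc i)). \<phi> (Suc i) x = d (Suc i) (h (Suc i) x) + h i (d i x))"
proof -
  note P' = projective_resolutionD [OF P]
  \<comment> \<open>On cycles only the summand \<open>d i (h y)\<close> of the homotopy equation
    survives; requiring the equation there makes the next difference a cycle.\<close>
  define Q where "Q = (\<lambda>i h. module_hom_on (P i) (P (Suc i)) h \<and> (\<forall>y\<in>res_cycles P d e i. d i (h y) = \<phi> i y))"
  have "\<exists>h. \<forall>i. Q i (h i) \<and> (\<forall>x\<in>Car (P (Suc i)). \<phi> (Suc i) x = d (Suc i) (h (Suc i) x) + h i (d i x))"
  proof (rule dependent_nat_choice)
    have "\<phi> 0 ` Car (P 0) \<subseteq> d 0 ` Car (P (Suc 0))"
      using \<phi>(2) module_hom_on_closed [OF \<phi>(1)] unfolding P'(6) [symmetric] by (auto simp: res_cycles_def)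
    from projective_lift [OF P'(1) P'(2) P'(2) P'(3) \<phi>(1) this]
    show "\<exists>h. Q 0 h"
      unfolding Q_def using res_cycles_subset by blast
  next
    fix h i assume "Q i h"
    then have h: "module_hom_on (P i) (P (Suc i)) h" "\<forall>y\<in>res_cycles P d e i. d i (h y) = \<phi> i y"
      by (auto simp: Q_def)
    \<comment> \<open>The requirement on \<open>h\<close> applies to \<open>d i x\<close>, so
      applying \<open>d i\<close> to this difference gives
      \<open>\<phi> i (d i x) - \<phi> i (d i x) = 0\<close>.\<close>
    let ?f = "\<lambda>x. \<phi> (Suc i) x + (- h (d i x))"
    have hd: "module_hom_on (P (Suc i)) (P (Suc i)) (\<lambda>x. h (d i x))"
      by (rule module_hom_on_compose [OF P'(3) h(1)])
    have "module_hom_on (P (Suc i)) (P (Suc i)) (\<lambda>x. - h (d i x))"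
      using hd add_subgroup_neg [OF left_module_subgroup [OF P'(2)]]
      by (auto simp: module_hom_on_def image_subset_iff left_module_act_neg [OF P'(2)])
    from module_hom_on_plus [OF \<phi>(1) this P'(2)]
    have f: "module_hom_on (P (Suc i)) (P (Suc i)) ?f" .
    have "?f ` Car (P (Suc i)) \<subseteq> d (Suc i) ` Car (P (Suc (Suc i)))"
    proof
      fix y assume "y \<in> ?f ` Car (P (Suc i))"
      then obtain x where x: "x \<in> Car (P (Suc i))" and y: "y = \<phi> (Suc i) x - h (d i x)" by auto
      have "d i y = d i (\<phi> (Suc i) x) - d i (h (d i x))"
        unfolding y using x module_hom_on_closed [OF \<phi>(1)] module_hom_on_closed [OF hd]
        by (intro module_hom_on_diff [OF P'(3) P'(2)]) auto
      moreover have "d i x \<in> res_cycles P d e i"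
        using x P'(6) by blast
      ultimately have "d i y = 0"
        using h(2) \<phi>(3) [OF x] by simp
      moreover have "y \<in> Car (P (Suc i))"
        using module_hom_on_closed [OF f x] y by simp
      ultimately show "y \<in> d (Suc i) ` Car (P (Suc (Suc i)))"
        unfolding P'(6) [symmetric] by (simp add: res_cycles_def)
    qed
    from projective_lift [OF P'(1) P'(2) P'(2) P'(3) f this]
    obtain h' where h': "module_hom_on (P (Suc i)) (P (Suc (Suc i))) h'"
      "\<forall>x\<in>Car (P (Suc i)). d (Suc i) (h' x) = \<phi> (Suc i) x + - h (d i x)" by blast
    have "h 0 = 0"
      using module_hom_on_0 [OF h(1) P'(2)] .
    then have "Q (Suc i) h'"
      using h' by (auto simp: Q_def res_cycles_def)
    then show "\<exists>h'. Q (Suc i) h' \<and> (\<forall>x\<in>Car (P (Suc i)). \<phi> (Suc i) x = d (Suc i) (h' x) + h (d i x))"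
      using h' by (auto intro!: exI [of _ h'])
  qed
  then obtain h where "\<forall>i. Q i (h i) \<and> (\<forall>x\<in>Car (P (Suc i)). \<phi> (Suc i) x = d (Suc i) (h (Suc i) x) + h i (d i x))"
    by blast
  then show ?thesis
    unfolding Q_def by (intro exI [of _ h]) auto
qed

section \<open>Finite global dimension and lifting of top cocycles\<close>

lemma gldim_finite_resolution:
  fixes M :: "('s::ring_1, 's univ) lmod"
  assumes "gldim TYPE('s) = enat n" and "left_module M"
  shows "\<exists>(T :: nat \<Rightarrow> ('s, 's univ) lmod) d e. projective_resolution T d e M \<and> (\<forall>i>n. Car (T i) = {0})"
proof (rule ccontr)
  assume no: "\<not> ?thesis"
  have "enat (Suc n) \<le> proj_dim M"
    unfolding proj_dim_def
  proof (rule Inf_greatest, clarify)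
    fix k and T :: "nat \<Rightarrow> ('s, 's univ) lmod" and d e
    assume "projective_resolution T d e M" "\<forall>i>k. Car (T i) = {0}"
    then have "\<not> k \<le> n"
      using no by (meson le_less_trans)
    then show "enat (Suc n) \<le> enat k" by simp
  qed
  also have "proj_dim M \<le> gldim TYPE('s)"
    unfolding gldim_def using assms(2) by (intro SUP_upper) auto
  finally show False
    using assms(1) by simp
qed

text \<open>Right exactness of the top Ext group: a cocycle in degree \<open>gldim\<close> with
  values in the image of \<open>\<pi>\<close> lifts to a cocycle. Over a resolution \<open>T\<close>
  that ends at this term every homomorphism on the last term is a cocycle, so lifting there is a
  matter of projectivity alone. Comparison maps carry the lift back to \<open>P\<close>, up to a
  coboundary that lifts as well.\<close>

lemma gldim_lift_cocycle:
  fixes P :: "nat \<Rightarrow> ('s::ring_1, 's univ, 'y) lmod_scheme" and M :: "('s, 's univ) lmod"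
    and N :: "('s, 's univ, 'z) lmod_scheme" and N' :: "('s, 's univ, 'w) lmod_scheme"
  assumes gl: "gldim TYPE('s) = enat (Suc n)" and M: "left_module M" and P: "projective_resolution P d e M"
    and N: "left_module N" and N': "left_module N'" and \<pi>: "module_hom_on N N' \<pi>"
    and f: "module_hom_on (P (Suc n)) N' f" and f0: "\<And>x. x \<in> Car (P (Suc (Suc n))) \<Longrightarrow> f (d (Suc n) x) = 0"
    and im: "f ` Car (P (Suc n)) \<subseteq> \<pi> ` Car N"
  shows "\<exists>g. module_hom_on (P (Suc n)) N g \<and> (\<forall>x\<in>Car (P (Suc n)). \<pi> (g x) = f x) \<and>
    (\<forall>x\<in>Car (P (Suc (Suc n))). g (d (Suc n) x) = 0)"
proof -
  obtain T :: "nat \<Rightarrow> ('s, 's univ) lmod" and d' e'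
    where T: "projective_resolution T d' e' M" and T0: "\<forall>i>Suc n. Car (T i) = {0}"
    using gldim_finite_resolution [OF gl M] by blast
  note P' = projective_resolutionD [OF P] and T' = projective_resolutionD [OF T]
  obtain \<alpha> where \<alpha>: "\<forall>i. module_hom_on (P i) (T i) (\<alpha> i)" "\<forall>x\<in>Car (P 0). e' (\<alpha> 0 x) = e x"
    "\<forall>i. \<forall>x\<in>Car (P (Suc i)). d' i (\<alpha> (Suc i) x) = \<alpha> i (d i x)"
    using chain_map_exists [OF M P T] by blast
  obtain \<beta> where \<beta>: "\<forall>i. module_hom_on (T i) (P i) (\<beta> i)" "\<forall>x\<in>Car (T 0). e (\<beta> 0 x) = e' x"
    "\<forall>i. \<forall>x\<in>Car (T (Suc i)). d i (\<beta> (Suc i) x) = \<beta> i (d' i x)"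
    using chain_map_exists [OF M T P] by blast
  have \<alpha>c: "\<alpha> i x \<in> Car (T i)" if "x \<in> Car (P i)" for i x
    using \<alpha>(1) that module_hom_on_closed by blast
  have \<beta>c: "\<beta> i x \<in> Car (P i)" if "x \<in> Car (T i)" for i x
    using \<beta>(1) that module_hom_on_closed by blast
  have dc: "d i x \<in> Car (P i)" if "x \<in> Car (P (Suc i))" for i x
    using P'(3) that module_hom_on_closed by blast
  \<comment> \<open>The composite through \<open>T\<close> minus the identity covers zero on
    \<open>M\<close>, which provides a homotopy.\<close>
  define \<phi> where "\<phi> = (\<lambda>i x. \<beta> i (\<alpha> i x) - x)"
  have ba: "module_hom_on (P i) (P i) (\<lambda>x. \<beta> i (\<alpha> i x))" for i
    using \<alpha>(1) \<beta>(1) module_hom_on_compose by blast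
  have neg: "module_hom_on (P i) (P i) (\<lambda>x. - x)" for i
    using add_subgroup_neg [OF left_module_subgroup [OF P'(2)]]
    by (auto simp: module_hom_on_def left_module_act_neg [OF P'(2)])
  have "\<exists>h. (\<forall>i. module_hom_on (P i) (P (Suc i)) (h i)) \<and>
    (\<forall>i. \<forall>x\<in>Car (P (Suc i)). \<phi> (Suc i) x = d (Suc i) (h (Suc i) x) + h i (d i x))"
  proof (rule homotopy_exists [OF P])
    show "module_hom_on (P i) (P i) (\<phi> i)" for i
      using module_hom_on_plus [OF ba neg P'(2)] by (simp add: \<phi>_def)
    show "e (\<phi> 0 x) = 0" if x: "x \<in> Car (P 0)" for x
      using \<alpha>(2) \<beta>(2) \<alpha>c \<beta>c x module_hom_on_diff [OF P'(4) P'(2)] by (simp add: \<phi>_def)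
    show "d i (\<phi> (Suc i) x) = \<phi> i (d i x)" if x: "x \<in> Car (P (Suc i))" for i x
      using \<alpha>(3) \<beta>(3) \<alpha>c \<beta>c x module_hom_on_diff [OF P'(3) P'(2)] by (simp add: \<phi>_def)
  qed
  then obtain h where h: "\<And>i. module_hom_on (P i) (P (Suc i)) (h i)"
    "\<And>i x. x \<in> Car (P (Suc i)) \<Longrightarrow> \<phi> (Suc i) x = d (Suc i) (h (Suc i) x) + h i (d i x)" by blast
  have hc: "h i x \<in> Car (P (Suc i))" if "x \<in> Car (P i)" for i x
    using h(1) that module_hom_on_closed by blast
  have "module_hom_on (T (Suc n)) N' (\<lambda>x. f (\<beta> (Suc n) x))"
    using \<beta>(1) f module_hom_on_compose by blast
  moreover have "(\<lambda>x. f (\<beta> (Suc n) x)) ` Car (T (Suc n)) \<subseteq> \<pi> ` Car N"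
    using \<beta>c im by blast
  ultimately obtain g1 where g1: "module_hom_on (T (Suc n)) N g1" "\<forall>x\<in>Car (T (Suc n)). \<pi> (g1 x) = f (\<beta> (Suc n) x)"
    using projective_lift [OF T'(1) N N' \<pi>] by metis
  have "module_hom_on (P n) (P (Suc n)) (\<lambda>x. - h n x)"
    using module_hom_on_compose [OF h(1) neg] .
  then have "module_hom_on (P n) N' (\<lambda>x. f (- h n x))"
    using f module_hom_on_compose by blast
  moreover have "(\<lambda>x. f (- h n x)) ` Car (P n) \<subseteq> \<pi> ` Car N"
    using hc im add_subgroup_neg [OF left_module_subgroup [OF P'(2)]] by blast
  ultimately obtain g2 where g2: "module_hom_on (P n) N g2" "\<forall>x\<in>Car (P n). \<pi> (g2 x) = f (- h n x)"
    using projective_lift [OF P'(1) N N' \<pi>] by metis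
  \<comment> \<open>\<open>g1\<close> lifts \<open>f \<circ> \<beta>\<close> on \<open>T\<close>,
    and \<open>g2\<close> lifts \<open>x \<mapsto> f (- h n x)\<close> on \<open>P n\<close>. Since
    \<open>\<beta> \<alpha> - 1 = d h + h d\<close>, applying \<open>\<pi>\<close> to the sum gives
    \<open>f x + f (d (h x))\<close>, and the last term is 0.\<close>
  define g where "g = (\<lambda>x. g1 (\<alpha> (Suc n) x) + g2 (d n x))"
  have "module_hom_on (P (Suc n)) N g"
    unfolding g_def
    using module_hom_on_compose [OF \<alpha>(1) [rule_format] g1(1)] module_hom_on_compose [OF P'(3) g2(1)] N
    by (rule module_hom_on_plus)
  moreover have "\<pi> (g x) = f x" if x: "x \<in> Car (P (Suc n))" for x
  proof -
    have c: "d (Suc n) (h (Suc n) x) \<in> Car (P (Suc n))" "h n (d n x) \<in> Car (P (Suc n))" "- h n (d n x) \<in> Car (P (Suc n))"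
      using x hc dc add_subgroup_neg [OF left_module_subgroup [OF P'(2)]] by auto
    have "\<pi> (g x) = \<pi> (g1 (\<alpha> (Suc n) x)) + \<pi> (g2 (d n x))"
      unfolding g_def using x \<alpha>c dc module_hom_on_closed [OF g1(1)] module_hom_on_closed [OF g2(1)]
      by (intro module_hom_on_add [OF \<pi>]) auto
    also have "\<dots> = f (\<beta> (Suc n) (\<alpha> (Suc n) x)) + f (- h n (d n x))"
      using g1(2) g2(2) x \<alpha>c dc by simp
    also have "\<dots> = f (\<beta> (Suc n) (\<alpha> (Suc n) x) + - h n (d n x))"
      using x \<alpha>c \<beta>c c by (intro module_hom_on_add [OF f, symmetric]) auto
    also have "\<beta> (Suc n) (\<alpha> (Suc n) x) + - h n (d n x) = x + d (Suc n) (h (Suc n) x)"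
      using h(2) [OF x] by (simp add: \<phi>_def algebra_simps)
    also have "f \<dots> = f x"
      using module_hom_on_add [OF f x c(1)] f0 hc x by simp
    finally show ?thesis .
  qed
  moreover have "g (d (Suc n) x) = 0" if x: "x \<in> Car (P (Suc (Suc n)))" for x
  proof -
    \<comment> \<open>Both summands of \<open>g\<close> vanish on boundaries: the first because
      \<open>T\<close> is zero past its last term, the second because two successive differentials
      compose to zero.\<close>
    have "\<alpha> (Suc (Suc n)) x = 0"
      using T0 \<alpha>c [OF x] by auto
    then have "\<alpha> (Suc n) (d (Suc n) x) = 0"
      using \<alpha>(3) x module_hom_on_0 [OF T'(3) T'(2)] by metis
    then show ?thesis
      using projective_resolution_comp [OF P x] module_hom_on_0 [OF g1(1) T'(2)] module_hom_on_0 [OF g2(1) P'(2)]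
      by (simp add: g_def)
  qed
  ultimately show ?thesis by blast
qed

section \<open>Free covers\<close>

definition usingle :: "nat \<Rightarrow> 's::ring_1 \<Rightarrow> 's univ" where
  "usingle q a = (\<lambda>p. if p = q then a else 0)"

lemma usingle_apply [simp]: "usingle q a p = (if p = q then a else 0)"
  by (simp add: usingle_def)

lemma usingle_expand:
  fixes x :: "'s::ring_1 univ"
  assumes "finite K" "{q. x q \<noteq> 0} \<subseteq> K"
  shows "(\<Sum>q\<in>K. uact (x q) (usingle q 1)) = x"
  using assms by (auto simp: fun_eq_iff sum_fun_apply if_distrib cong: if_cong)

definition lincomb :: "('s::ring_1 \<Rightarrow> 'm \<Rightarrow> 'm::ab_group_add) \<Rightarrow> (nat \<Rightarrow> 'm) \<Rightarrow> 's univ \<Rightarrow> 'm" where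
  "lincomb act g x = (\<Sum>q | x q \<noteq> 0. act (x q) (g q))"

lemma lincomb_superset:
  assumes "finite K" "{q. x q \<noteq> 0} \<subseteq> K" "\<And>q. q \<in> K \<Longrightarrow> x q = 0 \<Longrightarrow> act 0 (g q) = 0"
  shows "lincomb act g x = (\<Sum>q\<in>K. act (x q) (g q))"
  unfolding lincomb_def by (rule sum.mono_neutral_left) (use assms in auto)

lemma lincomb_usingle:
  assumes "act 0 (g q) = 0"
  shows "lincomb act g (usingle q a) = act a (g q)"
  by (subst lincomb_superset [of "{q}"]) (use assms in auto)

definition free_on :: "nat set \<Rightarrow> 's::ring_1 univ set" where
  "free_on I = {x. finite {q. x q \<noteq> 0} \<and> {q. x q \<noteq> 0} \<subseteq> I}"

lemma usingle_free_on: "q \<in> I \<Longrightarrow> usingle q a \<in> free_on I"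
  by (auto simp: free_on_def)

lemma free_on_add: "x \<in> free_on I \<Longrightarrow> y \<in> free_on I \<Longrightarrow> x + y \<in> free_on I"
proof -
  assume "x \<in> free_on I" "y \<in> free_on I"
  moreover have "{q. (x + y) q \<noteq> 0} \<subseteq> {q. x q \<noteq> 0} \<union> {q. y q \<noteq> 0}" by auto
  ultimately show ?thesis
    unfolding free_on_def by (auto intro: finite_subset)
qed

lemma free_on_act: "x \<in> free_on I \<Longrightarrow> uact a x \<in> free_on I"
proof -
  assume "x \<in> free_on I"
  moreover have "{q. uact a x q \<noteq> 0} \<subseteq> {q. x q \<noteq> 0}" by auto
  ultimately show ?thesis
    unfolding free_on_def by (auto intro: finite_subset)
qed

context connected_graded_algebra
begin

lemma free_on_gsub: "gsub \<delta> (free_on I)"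
proof -
  have "ucomp \<delta> j x \<in> free_on I" if "x \<in> free_on I" for j x
  proof -
    have "{q. ucomp \<delta> j x q \<noteq> 0} \<subseteq> {q. x q \<noteq> 0}" by auto
    then show ?thesis
      using that unfolding free_on_def by (auto intro: finite_subset)
  qed
  moreover have "add_subgroup (free_on I :: 's univ set)"
    unfolding add_subgroup_def by (auto intro: free_on_add) (auto simp: free_on_def)
  moreover have "finite {q. x q \<noteq> 0}" if "x \<in> free_on I" for x :: "'s univ"
    using that by (simp add: free_on_def)
  ultimately show ?thesis
    unfolding gsub_def using free_on_act by blast
qed

lemma lincomb_hom:
  fixes N :: "('s, 'm::ab_group_add, 'z) lmod_scheme"
  assumes N: "left_module N" and g: "\<And>q. q \<in> I \<Longrightarrow> g q \<in> Car N"
  shows "module_hom_on (gm \<delta> (free_on I)) N (lincomb (Act N) g)"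
proof -
  note c = left_module_act [OF N g]
  have sup: "lincomb (Act N) g x = (\<Sum>q\<in>K. Act N (x q) (g q))" if "finite K" "{q. x q \<noteq> 0} \<subseteq> K" "K \<subseteq> I" for x :: "'s univ" and K
    using that left_module_0_act [OF N g] by (intro lincomb_superset) auto
  show ?thesis
    unfolding module_hom_on_def gm_simps
  proof (intro conjI ballI allI)
    fix x :: "'s univ" assume x: "x \<in> free_on I"
    show "lincomb (Act N) g (x + y) = lincomb (Act N) g x + lincomb (Act N) g y" if y: "y \<in> free_on I" for y :: "'s univ"
    proof -
      let ?K = "{q. x q \<noteq> 0} \<union> {q. y q \<noteq> 0}"
      have K: "finite ?K" "?K \<subseteq> I"
        using x y by (auto simp: free_on_def)
      have "lincomb (Act N) g (x + y) = (\<Sum>q\<in>?K. Act N (x q + y q) (g q))"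
        by (subst sup [OF K(1) _ K(2)]) auto
      also have "\<dots> = (\<Sum>q\<in>?K. Act N (x q) (g q) + Act N (y q) (g q))"
        using K by (intro sum.cong left_module_add_act [OF N] g) auto
      also have "\<dots> = lincomb (Act N) g x + lincomb (Act N) g y"
        unfolding sum.distrib using sup [OF K(1) _ K(2)] by auto
      finally show ?thesis .
    qed
    show "lincomb (Act N) g (uact a x) = Act N a (lincomb (Act N) g x)" for a
    proof -
      let ?K = "{q. x q \<noteq> 0}"
      have K: "finite ?K" "?K \<subseteq> I"
        using x by (auto simp: free_on_def)
      have "lincomb (Act N) g (uact a x) = (\<Sum>q\<in>?K. Act N (a * x q) (g q))"
        by (subst sup [OF K(1) _ K(2)]) auto
      also have "\<dots> = (\<Sum>q\<in>?K. Act N a (Act N (x q) (g q)))"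
        using K by (intro sum.cong left_module_act_act [OF N] g) auto
      also have "\<dots> = Act N a (lincomb (Act N) g x)"
        unfolding lincomb_def using K c by (subst left_module_act_sum [OF N]) auto
      finally show ?thesis .
    qed
  next
    have "lincomb (Act N) g x \<in> Car N" if "x \<in> free_on I" for x
      unfolding lincomb_def using that c
      by (intro add_subgroup_sum [OF left_module_subgroup [OF N]]) (auto simp: free_on_def)
    then show "lincomb (Act N) g ` free_on I \<subseteq> Car N" by blast
  qed
qed

lemma hom_eq_lincomb:
  fixes N :: "('s, 'm::ab_group_add, 'z) lmod_scheme"
  assumes "module_hom_on (gm \<delta> (free_on I)) N h" "x \<in> free_on I"
  shows "h x = lincomb (Act N) (\<lambda>q. h (usingle q 1)) x"
proof -
  let ?K = "{q. x q \<noteq> 0}"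
  have K: "finite ?K" "?K \<subseteq> I"
    using assms(2) by (auto simp: free_on_def)
  have "h x = h (\<Sum>q\<in>?K. uact (x q) (usingle q 1))"
    by (simp add: usingle_expand K)
  also have "\<dots> = (\<Sum>q\<in>?K. h (uact (x q) (usingle q 1)))"
    using K by (intro module_hom_on_sum [OF assms(1)] gsub_left_module [OF free_on_gsub])
      (auto simp del: uact_apply intro!: free_on_act usingle_free_on)
  also have "\<dots> = (\<Sum>q\<in>?K. Act N (x q) (h (usingle q 1)))"
  proof (intro sum.cong refl)
    fix q assume "q \<in> ?K"
    then have "usingle q 1 \<in> Car (gm \<delta> (free_on I))"
      using K usingle_free_on by auto
    from module_hom_on_act [OF assms(1) this]
    show "h (uact (x q) (usingle q 1)) = Act N (x q) (h (usingle q 1))" by simp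
  qed
  finally show ?thesis
    by (simp add: lincomb_def)
qed

lemma free_on_projective: "projective (gm \<delta> (free_on I))"
proof (rule projective_dual_basis [where J = I and e = "\<lambda>q. usingle q 1" and lam = "\<lambda>q x. x q"])
  show "left_module (gm \<delta> (free_on I))"
    by (rule gsub_left_module [OF free_on_gsub])
  fix x assume x: "x \<in> Car (gm \<delta> (free_on I))"
  show "finite {j \<in> I. x j \<noteq> 0}"
    using x by (auto simp: free_on_def intro: rev_finite_subset)
  have "{j \<in> I. x j \<noteq> 0} = {j. x j \<noteq> 0}"
    using x by (auto simp: free_on_def)
  then show "(\<Sum>j | j \<in> I \<and> x j \<noteq> 0. Act (gm \<delta> (free_on I)) (x j) (usingle j 1)) = x"
    using x usingle_expand [of "{j. x j \<noteq> 0}" x] by (simp add: free_on_def)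
qed (auto intro: usingle_free_on)

text \<open>Index \<open>prod_encode (j, r)\<close> stands for the \<open>r\<close>-th generator of degree \<open>j\<close>.\<close>

definition gens :: "(nat \<Rightarrow> nat) \<Rightarrow> 's univ set \<Rightarrow> nat \<Rightarrow> 's univ list" where
  "gens \<delta> C j = (SOME zs. set zs \<subseteq> pieces \<delta> C j - {0} \<and> pieces \<delta> C j \<subseteq> uv.span (set zs))"

definition fdeg :: "nat \<Rightarrow> nat" where
  "fdeg q = fst (prod_decode q)"

definition fgen :: "(nat \<Rightarrow> nat) \<Rightarrow> 's univ set \<Rightarrow> nat \<Rightarrow> 's univ" where
  "fgen \<delta> C q = gens \<delta> C (fdeg q) ! snd (prod_decode q)"

definition fidx :: "(nat \<Rightarrow> nat) \<Rightarrow> 's univ set \<Rightarrow> nat set" where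
  "fidx \<delta> C = {q. snd (prod_decode q) < length (gens \<delta> C (fdeg q))}"

text \<open>The cover is far from minimal: every component contributes a whole spanning list of
  generators. Surjectivity is then immediate, and redundant generators are dealt with by the
  functional in \<open>Ext_trivial_nonvanishing\<close>.\<close>

definition cover_map :: "(nat \<Rightarrow> nat) \<Rightarrow> 's univ set \<Rightarrow> 's univ \<Rightarrow> 's univ" where
  "cover_map \<delta> C = lincomb uact (fgen \<delta> C)"

definition cover_kernel :: "(nat \<Rightarrow> nat) \<Rightarrow> 's univ set \<Rightarrow> 's univ set" where
  "cover_kernel \<delta> C = {x \<in> free_on (fidx \<delta> C). cover_map \<delta> C x = 0}"

lemma gens_props:
  assumes "gsub \<delta> C" "locfin \<delta> C"
  shows "set (gens \<delta> C j) \<subseteq> pieces \<delta> C j - {0}" "pieces \<delta> C j \<subseteq> uv.span (set (gens \<delta> C j))"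
proof -
  obtain B where "finite B" "pieces \<delta> C j \<subseteq> uv.span B"
    using assms(2) by (auto simp: locfin_def)
  then have "\<exists>zs. set zs \<subseteq> pieces \<delta> C j - {0} \<and> pieces \<delta> C j \<subseteq> uv.span (set zs)"
    using uv.finite_spanning_list pieces_subspace [OF assms(1)] by blast
  from someI_ex [OF this] show "set (gens \<delta> C j) \<subseteq> pieces \<delta> C j - {0}" "pieces \<delta> C j \<subseteq> uv.span (set (gens \<delta> C j))"
    unfolding gens_def by auto
qed

lemma fgen_in:
  assumes "gsub \<delta> C" "locfin \<delta> C" "q \<in> fidx \<delta> C"
  shows "fgen \<delta> C q \<in> pieces \<delta> C (fdeg q)" "fgen \<delta> C q \<noteq> 0"
  using gens_props(1) [OF assms(1,2), of "fdeg q"] assms(3) nth_mem unfolding fgen_def fidx_def by blast+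

lemma gens_fgen:
  assumes "z \<in> set (gens \<delta> C j)"
  shows "\<exists>q\<in>fidx \<delta> C. fdeg q = j \<and> fgen \<delta> C q = z"
proof -
  obtain r where "r < length (gens \<delta> C j)" "z = gens \<delta> C j ! r"
    using assms by (metis in_set_conv_nth)
  then show ?thesis
    by (intro bexI [of _ "prod_encode (j, r)"]) (auto simp: fdeg_def fgen_def fidx_def)
qed

lemma finite_fidx_fdeg: "finite {q \<in> fidx \<delta> C. fdeg q \<le> j}"
proof (rule finite_subset)
  show "{q \<in> fidx \<delta> C. fdeg q \<le> j} \<subseteq> prod_encode ` (SIGMA i:{..j}. {..<length (gens \<delta> C i)})"
  proof
    fix q assume "q \<in> {q \<in> fidx \<delta> C. fdeg q \<le> j}"
    then have "prod_decode q \<in> (SIGMA i:{..j}. {..<length (gens \<delta> C i)})"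
      by (cases "prod_decode q") (auto simp: fidx_def fdeg_def)
    then show "q \<in> prod_encode ` (SIGMA i:{..j}. {..<length (gens \<delta> C i)})"
      by (metis image_eqI prod_decode_inverse)
  qed
qed auto

context
  fixes \<delta> C assumes C: "gsub \<delta> C" "locfin \<delta> C"
begin

lemma cover_map_hom: "module_hom_on (gm \<delta>' (free_on (fidx \<delta> C))) (gm \<delta>'' C) (cover_map \<delta> C)"
proof -
  have "left_module (gm \<delta>'' C)"
    using gsub_left_module [OF C(1)] by (simp add: left_module_def)
  from lincomb_hom [OF this, of "fidx \<delta> C" "fgen \<delta> C"]
  show ?thesis
    using fgen_in [OF C] by (simp add: cover_map_def pieces_def)
qed

lemma cover_map_usingle: "cover_map \<delta> C (usingle q a) = uact a (fgen \<delta> C q)"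
  unfolding cover_map_def by (rule lincomb_usingle) simp

text \<open>The generator with index \<open>q\<close> is homogeneous of degree
  \<open>fdeg q\<close>, so giving the \<open>q\<close>-th free summand the shift
  \<open>fdeg q\<close> makes the cover respect degrees.\<close>

lemma cover_map_ucomp:
  assumes x: "x \<in> free_on (fidx \<delta> C)"
  shows "cover_map \<delta> C (ucomp fdeg j x) = ucomp \<delta> j (cover_map \<delta> C x)"
proof -
  let ?K = "{q. x q \<noteq> 0}"
  have K: "finite ?K" "?K \<subseteq> fidx \<delta> C"
    using x by (auto simp: free_on_def)
  have "ucomp \<delta> j (uact (x q) (fgen \<delta> C q)) = uact (ucomp fdeg j x q) (fgen \<delta> C q)" if "q \<in> fidx \<delta> C" for q
  proof
    fix p
    have "fgen \<delta> C q p \<in> gri (int (fdeg q) - int (\<delta> p))"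
      using fgen_in(1) [OF C that] by (auto simp: pieces_def gdeg_def)
    \<comment> \<open>Where \<open>fdeg q < \<delta> p\<close> the generator has value 0; otherwise
      its value has the natural degree \<open>fdeg q - \<delta> p\<close>, and multiplying by it
      shifts components.\<close>
    then have "ci (j - int (\<delta> p)) (x q * fgen \<delta> C q p) = ci (j - int (fdeg q)) (x q) * fgen \<delta> C q p"
      using ci_mult_right [of "fgen \<delta> C q p" "nat (int (fdeg q) - int (\<delta> p))" "j - int (fdeg q)" "x q"]
      by (cases "int (fdeg q) \<ge> int (\<delta> p)") (auto simp: gri_def algebra_simps)
    then show "ucomp \<delta> j (uact (x q) (fgen \<delta> C q)) p = uact (ucomp fdeg j x q) (fgen \<delta> C q) p"
      by simp
  qed
  then have "ucomp \<delta> j (cover_map \<delta> C x) = (\<Sum>q\<in>?K. uact (ucomp fdeg j x q) (fgen \<delta> C q))"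
    unfolding cover_map_def lincomb_def ucomp_sum using K by (intro sum.cong) auto
  also have "\<dots> = cover_map \<delta> C (ucomp fdeg j x)"
    unfolding cover_map_def using K by (subst lincomb_superset [of ?K]) auto
  finally show ?thesis by simp
qed

lemma cover_map_gdeg:
  assumes "x \<in> free_on (fidx \<delta> C)" "x \<in> gdeg fdeg j"
  shows "cover_map \<delta> C x \<in> gdeg \<delta> j"
  using cover_map_ucomp [OF assms(1), of j] ucomp_homogeneous [OF assms(2), of j] ucomp_gdeg by metis

lemma cover_map_image: "cover_map \<delta> C ` free_on (fidx \<delta> C) = C"
proof
  show "cover_map \<delta> C ` free_on (fidx \<delta> C) \<subseteq> C"
    using cover_map_hom by (auto simp: module_hom_on_def)
  let ?F = "free_on (fidx \<delta> C)"
  have F: "left_module (gm fdeg ?F)"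
    by (rule gsub_left_module [OF free_on_gsub])
  have "uv.subspace (cover_map \<delta> C ` ?F)"
    unfolding uv.subspace_def
  proof (intro conjI ballI allI)
    show "0 \<in> cover_map \<delta> C ` ?F"
      using module_hom_on_0 [OF cover_map_hom [of fdeg \<delta>] F] gsub_0 [OF free_on_gsub] by (metis image_eqI)
    fix x assume x: "x \<in> cover_map \<delta> C ` ?F"
    then obtain x' where x': "x = cover_map \<delta> C x'" "x' \<in> ?F" by blast
    show "x + y \<in> cover_map \<delta> C ` ?F" if y: "y \<in> cover_map \<delta> C ` ?F" for y
    proof -
      obtain y' where y': "y = cover_map \<delta> C y'" "y' \<in> ?F" using y by blast
      have "x + y = cover_map \<delta> C (x' + y')"
        using module_hom_on_add [OF cover_map_hom [of fdeg \<delta>]] x' y' by simp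
      then show ?thesis
        using free_on_add x'(2) y'(2) by blast
    qed
    show "usc c x \<in> cover_map \<delta> C ` ?F" for c
    proof -
      have "usc c x = cover_map \<delta> C (uact (scale c 1) x')"
        using module_hom_on_act [OF cover_map_hom [of fdeg \<delta>]] x' by (simp add: usc_eq_uact)
      then show ?thesis
        using free_on_act x'(2) by blast
    qed
  qed
  moreover have "set (gens \<delta> C j) \<subseteq> cover_map \<delta> C ` ?F" for j
  proof
    fix z assume "z \<in> set (gens \<delta> C j)"
    then obtain q where "q \<in> fidx \<delta> C" "fgen \<delta> C q = z"
      using gens_fgen by blast
    then show "z \<in> cover_map \<delta> C ` ?F"
      using cover_map_usingle [of q 1] usingle_free_on by (metis image_eqI uact_1)
  qed
  ultimately have "pieces \<delta> C j \<subseteq> cover_map \<delta> C ` ?F" for j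
    using gens_props(2) [OF C] uv.span_minimal by blast
  then have p: "ucomp \<delta> (int j) x \<in> cover_map \<delta> C ` ?F" if "x \<in> C" for x j
    using gsub_ucomp_pieces [OF C(1) that] by blast
  have "x \<in> cover_map \<delta> C ` ?F" if x: "x \<in> C" for x
  proof -
    obtain J where "finite J" "x = (\<Sum>j\<in>J. ucomp \<delta> (int j) x)"
      using gsub_sum_pieces [OF C(1) x] by blast
    then show ?thesis
      using uv.subspace_sum [OF \<open>uv.subspace (cover_map \<delta> C ` ?F)\<close>, of J "\<lambda>j. ucomp \<delta> (int j) x"] p [OF x] by simp
  qed
  then show "C \<subseteq> cover_map \<delta> C ` ?F" by blast
qed

lemma cover_kernel_gsub: "gsub fdeg (cover_kernel \<delta> C)"
proof -
  have "left_module \<lparr>Car = cover_kernel \<delta> C, Act = uact\<rparr>"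
    using left_module_kernel [OF gsub_left_module [OF free_on_gsub] gsub_left_module [OF C(1)] cover_map_hom]
    by (simp add: cover_kernel_def)
  moreover have "ucomp fdeg j x \<in> cover_kernel \<delta> C" if "x \<in> cover_kernel \<delta> C" for j x
    using that cover_map_ucomp [of x j] gsub_ucomp [OF free_on_gsub] by (auto simp: cover_kernel_def)
  ultimately show ?thesis
    by (auto simp: gsub_def left_module_def) (auto simp: cover_kernel_def free_on_def)
qed

end

end

locale locally_finite_graded_algebra = connected_graded_algebra scale gr
  for scale :: "'k::field \<Rightarrow> 's::ring_1 \<Rightarrow> 's" and gr +
  assumes fin_gr: "\<exists>B. finite B \<and> gr i \<subseteq> span B"
begin

text \<open>In degree \<open>j\<close> only positions with \<open>\<delta> q \<le> j\<close> can
  carry a nonzero value, and each value lies in a finite-dimensional component of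
  \<open>S\<close>.\<close>

lemma locfin_support:
  assumes X: "\<And>f q. f \<in> C \<Longrightarrow> f q \<noteq> 0 \<Longrightarrow> q \<in> X" and fin: "\<And>j. finite {q \<in> X. \<delta> q \<le> j}"
  shows "locfin \<delta> C"
  unfolding locfin_def
proof
  fix j
  obtain B where B: "\<And>i. finite (B i)" "\<And>i. gr i \<subseteq> span (B i)"
    using fin_gr by metis
  let ?X = "{q \<in> X. \<delta> q \<le> j}"
  let ?G = "\<Union>q\<in>?X. usingle q ` B (j - \<delta> q)"
  have "f \<in> uv.span ?G" if f: "f \<in> pieces \<delta> C j" for f
  proof -
    have fq: "f q \<in> gri (int j - int (\<delta> q))" for q
      using f by (simp add: pieces_def gdeg_def)
    have supp: "f q = 0" if "q \<notin> ?X" for q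
      using that X f fq [of q] by (auto simp: pieces_def gri_def)
    have e: "f = (\<Sum>q\<in>?X. usingle q (f q))"
      using fin [of j] supp by (auto simp: fun_eq_iff sum_fun_apply if_distrib cong: if_cong)
    have m: "usingle q (f q) \<in> uv.span ?G" if q: "q \<in> ?X" for q
    proof -
      have "f q \<in> gr (j - \<delta> q)"
        using fq [of q] q by (auto simp: gri_def nat_diff_distrib split: if_splits)
      then have "f q \<in> span (B (j - \<delta> q))"
        using B by blast
      then show ?thesis
      proof (induction rule: span_induct_alt)
        case base
        have z: "usingle q (0::'s) = 0" by auto
        show ?case unfolding z by (rule uv.span_zero)
      next
        case (step c b s)
        have "usingle q (scale c b + s) = usc c (usingle q b) + usingle q s" by auto
        moreover have "usingle q b \<in> uv.span ?G"
          using step(1) q by (intro uv.span_base) blast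
        ultimately show ?case
          using step(2) by (simp only: uv.span_add uv.span_scale)
      qed
    qed
    show ?thesis
      by (subst e) (intro uv.span_sum m)
  qed
  moreover have "finite ?G"
    using B fin by blast
  ultimately show "\<exists>B. finite B \<and> pieces \<delta> C j \<subseteq> uv.span B"
    by blast
qed

lemma free_cover_locfin: "locfin fdeg (free_on (fidx \<delta> C))"
  using finite_fidx_fdeg by (intro locfin_support [where X = "fidx \<delta> C"]) (auto simp: free_on_def)

lemma cover_kernel_locfin: "locfin fdeg (cover_kernel \<delta> C)"
  using free_cover_locfin by (rule locfin_mono) (auto simp: cover_kernel_def)

end

section \<open>Extending partial resolutions of the trivial module\<close>

context connected_graded_algebra
begin

abbreviation triv :: "('s, 'k) gmod" where
  "triv \<equiv> trivial_module scale gr"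

lemma triv_simps [simp]: "Car triv = UNIV" "Act triv = (\<lambda>a c. \<epsilon> a * c)" "Deg triv i = (if i = 0 then UNIV else {0})"
  by (auto simp: trivial_module_def augmentation_eq)

lemma triv_left_module: "left_module triv"
  by (auto simp: left_module_def add_subgroup_def \<epsilon>_add \<epsilon>_mult algebra_simps)

lemma hom_ucomp:
  assumes C: "gsub \<delta> C" and f: "module_hom_on (gm \<delta> C) (gm \<delta>' C') f"
    and deg: "\<And>j x. x \<in> C \<Longrightarrow> x \<in> gdeg \<delta> j \<Longrightarrow> f x \<in> gdeg \<delta>' j" and x: "x \<in> C"
  shows "f (ucomp \<delta> (int j) x) = ucomp \<delta>' (int j) (f x)"
proof -
  obtain J where J: "finite J" "\<forall>j. j \<notin> J \<longrightarrow> ucomp \<delta> (int j) x = 0" "x = (\<Sum>j\<in>J. ucomp \<delta> (int j) x)"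
    using gsub_sum_pieces [OF C x] by blast
  have f0: "f 0 = 0"
    using module_hom_on_0 [OF f gsub_left_module [OF C]] .
  have "f x = f (\<Sum>i\<in>J. ucomp \<delta> (int i) x)"
    using J(3) by (rule arg_cong)
  also have "\<dots> = (\<Sum>i\<in>J. f (ucomp \<delta> (int i) x))"
    using gsub_ucomp [OF C x] by (intro module_hom_on_sum [OF f gsub_left_module [OF C]]) simp
  finally have "f x = (\<Sum>i\<in>J. f (ucomp \<delta> (int i) x))" .
  then have "ucomp \<delta>' (int j) (f x) = (\<Sum>i\<in>J. ucomp \<delta>' (int j) (f (ucomp \<delta> (int i) x)))"
    by (simp add: ucomp_sum)
  also have "\<dots> = (\<Sum>i\<in>J. if i = j then f (ucomp \<delta> (int j) x) else 0)"
    by (intro sum.cong refl) (auto simp: ucomp_homogeneous [OF deg [OF gsub_ucomp [OF C x] ucomp_gdeg]])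
  also have "\<dots> = f (ucomp \<delta> (int j) x)"
    using J(1,2) f0 by auto
  finally show ?thesis by simp
qed

definition top_cycles :: "(nat \<Rightarrow> 's univ set) \<Rightarrow> (nat \<Rightarrow> 's univ \<Rightarrow> 's univ) \<Rightarrow> ('s univ \<Rightarrow> 'k) \<Rightarrow> nat \<Rightarrow> 's univ set" where
  "top_cycles C d e k = (case k of 0 \<Rightarrow> {x \<in> C 0. e x = 0} | Suc k' \<Rightarrow> {x \<in> C k. d k' x = 0})"

text \<open>Exactness is required below term \<open>i\<close> only: the kernel at term
  \<open>i\<close> is the object to be studied. Local finiteness is included so that the complex can
  be continued by free covers.\<close>

definition partial_resolution ::
    "nat \<Rightarrow> (nat \<Rightarrow> nat \<Rightarrow> nat) \<Rightarrow> (nat \<Rightarrow> 's univ set) \<Rightarrow> (nat \<Rightarrow> 's univ \<Rightarrow> 's univ) \<Rightarrow> ('s univ \<Rightarrow> 'k) \<Rightarrow> bool" where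
  "partial_resolution i \<delta> C d e \<longleftrightarrow>
     (\<forall>k\<le>i. gsub (\<delta> k) (C k) \<and> projective (gm (\<delta> k) (C k)) \<and> locfin (\<delta> k) (C k)) \<and>
     (\<forall>k<i. module_hom_on (gm (\<delta> (Suc k)) (C (Suc k))) (gm (\<delta> k) (C k)) (d k) \<and>
        (\<forall>j x. x \<in> C (Suc k) \<longrightarrow> x \<in> gdeg (\<delta> (Suc k)) j \<longrightarrow> d k x \<in> gdeg (\<delta> k) j)) \<and>
     module_hom_on (gm (\<delta> 0) (C 0)) triv e \<and> e ` C 0 = UNIV \<and>
     (\<forall>j x. x \<in> C 0 \<longrightarrow> x \<in> gdeg (\<delta> 0) j \<longrightarrow> j \<noteq> 0 \<longrightarrow> e x = 0) \<and>
     (\<forall>k<i. top_cycles C d e k = d k ` C (Suc k))"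

lemma partial_resolutionD:
  assumes "partial_resolution i \<delta> C d e"
  shows "k \<le> i \<Longrightarrow> gsub (\<delta> k) (C k)" "k \<le> i \<Longrightarrow> projective (gm (\<delta> k) (C k))" "k \<le> i \<Longrightarrow> locfin (\<delta> k) (C k)"
    "k < i \<Longrightarrow> module_hom_on (gm (\<delta> (Suc k)) (C (Suc k))) (gm (\<delta> k) (C k)) (d k)"
    "k < i \<Longrightarrow> x \<in> C (Suc k) \<Longrightarrow> x \<in> gdeg (\<delta> (Suc k)) j \<Longrightarrow> d k x \<in> gdeg (\<delta> k) j"
    "module_hom_on (gm (\<delta> 0) (C 0)) triv e" "e ` C 0 = UNIV"
    "x \<in> C 0 \<Longrightarrow> x \<in> gdeg (\<delta> 0) j \<Longrightarrow> j \<noteq> 0 \<Longrightarrow> e x = 0"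
    "k < i \<Longrightarrow> top_cycles C d e k = d k ` C (Suc k)"
  using assms unfolding partial_resolution_def by simp_all

lemma top_cycles_subset: "top_cycles C d e i \<subseteq> C i"
  by (auto simp: top_cycles_def split: nat.splits)

lemma top_cycles_gsub:
  assumes R: "partial_resolution i \<delta> C d e"
  shows "gsub (\<delta> i) (top_cycles C d e i)"
proof -
  note R' = partial_resolutionD [OF R]
  have "left_module \<lparr>Car = top_cycles C d e i, Act = uact\<rparr> \<and>
    (\<forall>j. \<forall>x\<in>top_cycles C d e i. ucomp (\<delta> i) (int j) x \<in> top_cycles C d e i)"
  proof (cases i)
    case 0
    have "e (ucomp (\<delta> 0) (int j) x) = 0" if x: "x \<in> C 0" "e x = 0" for j x
    proof -
      obtain J where J: "finite J" "\<forall>j. j \<notin> J \<longrightarrow> ucomp (\<delta> 0) (int j) x = 0" "x = (\<Sum>j\<in>J. ucomp (\<delta> 0) (int j) x)"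
        using gsub_sum_pieces [OF R'(1) [of 0] x(1)] by blast
      have u: "ucomp (\<delta> 0) (int j) x \<in> C 0" for j
        using gsub_ucomp [OF R'(1) [of 0] x(1)] by simp
      have e0: "e 0 = 0"
        using module_hom_on_0 [OF R'(6) gsub_left_module [OF R'(1)]] by simp
      have "0 = e (\<Sum>j\<in>J. ucomp (\<delta> 0) (int j) x)"
        using x(2) arg_cong [OF J(3), of e] by metis
      also have "\<dots> = (\<Sum>j\<in>J. e (ucomp (\<delta> 0) (int j) x))"
        using u by (intro module_hom_on_sum [OF R'(6) gsub_left_module [OF R'(1)]]) auto
      \<comment> \<open>The augmentation vanishes on components of nonzero degree, so a single
        summand remains.\<close>
      also have "\<dots> = (\<Sum>j\<in>J. if j = 0 then e (ucomp (\<delta> 0) (int 0) x) else 0)"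
        using R'(8) [OF u ucomp_gdeg] by (intro sum.cong) auto
      also have "\<dots> = e (ucomp (\<delta> 0) (int 0) x)"
        using J(1,2) e0 by auto
      finally show ?thesis
        using R'(8) [OF u ucomp_gdeg, of j] by (cases "j = 0") auto
    qed
    then show ?thesis
      using left_module_kernel [OF gsub_left_module [OF R'(1)] triv_left_module R'(6)] gsub_ucomp [OF R'(1)] 0
      by (auto simp: top_cycles_def)
  next
    case (Suc k)
    then have k: "k < i" by simp
    have "left_module \<lparr>Car = top_cycles C d e i, Act = uact\<rparr>"
      using left_module_kernel [OF gsub_left_module [OF R'(1)] gsub_left_module [OF R'(1)] R'(4) [OF k]] Suc
      by (auto simp: top_cycles_def)
    moreover have "d k (ucomp (\<delta> i) (int j) x) = 0" if "x \<in> C i" "d k x = 0" for j x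
      using hom_ucomp [OF R'(1) R'(4) [OF k], of x j] R'(5) [OF k] Suc that by simp
    ultimately show ?thesis
      using gsub_ucomp [OF R'(1)] Suc by (auto simp: top_cycles_def)
  qed
  moreover have "ucomp (\<delta> i) j x = 0" if "j < 0" for j x
    using gdeg_negative [OF ucomp_gdeg that] .
  then have "ucomp (\<delta> i) j x \<in> top_cycles C d e i"
    if "left_module \<lparr>Car = top_cycles C d e i, Act = uact\<rparr>"
      "\<forall>j. \<forall>x\<in>top_cycles C d e i. ucomp (\<delta> i) (int j) x \<in> top_cycles C d e i" "x \<in> top_cycles C d e i" for j x
    using that left_module_0 [OF that(1)] by (cases "0 \<le> j") (auto dest!: zero_le_imp_eq_int)
  ultimately show ?thesis
    using gsub_finite [OF R'(1) [OF order_refl]] top_cycles_subset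
    unfolding gsub_def left_module_def by (auto simp: subset_iff)
qed

lemma top_cycles_locfin:
  assumes R: "partial_resolution i \<delta> C d e"
  shows "locfin (\<delta> i) (top_cycles C d e i)"
  by (rule locfin_mono [where C = "C i" and D = "top_cycles C d e i", OF partial_resolutionD(3) [OF R order_refl] top_cycles_subset])

text \<open>Iterated kernels of free covers. The degree function is carried along because it is
  \<open>\<delta>\<close> at the start and \<open>fdeg\<close> after the first cover.\<close>

primrec syz :: "(nat \<Rightarrow> nat) \<Rightarrow> 's univ set \<Rightarrow> nat \<Rightarrow> (nat \<Rightarrow> nat) \<times> 's univ set" where
  "syz \<delta> C 0 = (\<delta>, C)"
| "syz \<delta> C (Suc n) = (fdeg, cover_kernel (fst (syz \<delta> C n)) (snd (syz \<delta> C n)))"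

definition syz_idx :: "(nat \<Rightarrow> nat) \<Rightarrow> 's univ set \<Rightarrow> nat \<Rightarrow> nat set" where
  "syz_idx \<delta> C n = fidx (fst (syz \<delta> C n)) (snd (syz \<delta> C n))"

definition syz_cov :: "(nat \<Rightarrow> nat) \<Rightarrow> 's univ set \<Rightarrow> nat \<Rightarrow> 's univ \<Rightarrow> 's univ" where
  "syz_cov \<delta> C n = cover_map (fst (syz \<delta> C n)) (snd (syz \<delta> C n))"

definition res_P :: "nat \<Rightarrow> (nat \<Rightarrow> nat \<Rightarrow> nat) \<Rightarrow> (nat \<Rightarrow> 's univ set) \<Rightarrow> (nat \<Rightarrow> 's univ \<Rightarrow> 's univ) \<Rightarrow> ('s univ \<Rightarrow> 'k) \<Rightarrow>
    nat \<Rightarrow> ('s, 's univ) gmod" where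
  "res_P i \<delta> C d e k = (if k \<le> i then gm (\<delta> k) (C k)
     else gm fdeg (free_on (syz_idx (\<delta> i) (top_cycles C d e i) (k - Suc i))))"

text \<open>At place \<open>i\<close> the cover of \<open>top_cycles\<close> is read as a map into
  \<open>C i\<close>, and later covers as maps into the free module containing the syzygy; the image
  is in each case the kernel of the map out of that term.\<close>

definition res_d :: "nat \<Rightarrow> (nat \<Rightarrow> nat \<Rightarrow> nat) \<Rightarrow> (nat \<Rightarrow> 's univ set) \<Rightarrow> (nat \<Rightarrow> 's univ \<Rightarrow> 's univ) \<Rightarrow> ('s univ \<Rightarrow> 'k) \<Rightarrow>
    nat \<Rightarrow> 's univ \<Rightarrow> 's univ" where
  "res_d i \<delta> C d e k = (if k < i then d k else syz_cov (\<delta> i) (top_cycles C d e i) (k - i))"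

end

section \<open>Splicing free covers onto a partial resolution; generators of its kernel\<close>

context locally_finite_graded_algebra
begin

lemma syz_good:
  assumes "gsub \<delta> C" "locfin \<delta> C"
  shows "gsub (fst (syz \<delta> C n)) (snd (syz \<delta> C n))" "locfin (fst (syz \<delta> C n)) (snd (syz \<delta> C n))"
  by (induction n) (use assms cover_kernel_gsub cover_kernel_locfin in auto)

text \<open>This is how the conditions on Ext become usable: any partial resolution can be
  prescribed as the beginning of a genuine graded projective resolution of \<open>k\<close>.\<close>

lemma graded_resolution_extend:
  assumes R: "partial_resolution i \<delta> C d e"
  shows "graded_projective_resolution gr (res_P i \<delta> C d e) (res_d i \<delta> C d e) e triv"
proof -
  note R' = partial_resolutionD [OF R]
  let ?Z = "top_cycles C d e i" and ?P = "res_P i \<delta> C d e" and ?d = "res_d i \<delta> C d e"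
  let ?s = "syz (\<delta> i) ?Z"
  note good = syz_good [OF top_cycles_gsub [OF R] top_cycles_locfin [OF R]]
  have P1: "?P k = gm (\<delta> k) (C k)" if "k \<le> i" for k
    using that by (simp add: res_P_def)
  have P2: "?P (Suc (i + n)) = gm fdeg (free_on (syz_idx (\<delta> i) ?Z n))" for n
    by (simp add: res_P_def)
  have d1: "?d k = d k" if "k < i" for k
    using that by (simp add: res_d_def)
  have d2: "?d (i + n) = cover_map (fst (?s n)) (snd (?s n))" for n
    by (simp add: res_d_def syz_cov_def)
  have tail: "module_hom_on (?P (Suc (i + n))) (?P (i + n)) (?d (i + n)) \<and>
     ?d (i + n) ` Car (?P (Suc (i + n))) = snd (?s n) \<and>
     (\<forall>j x. x \<in> Car (?P (Suc (i + n))) \<longrightarrow> x \<in> gdeg fdeg j \<longrightarrow> ?d (i + n) x \<in> gdeg (fst (?s n)) j)" for n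
  proof -
    have "snd (?s n) \<subseteq> Car (?P (i + n))"
      using top_cycles_subset by (cases n) (auto simp: P1 P2 cover_kernel_def syz_idx_def)
    moreover have "Act (?P (i + n)) = uact"
      by (cases n) (auto simp: P1 P2)
    ultimately have "module_hom_on (?P (Suc (i + n))) (?P (i + n)) (?d (i + n))"
      using cover_map_hom [OF good(1) [of n] good(2) [of n], where \<delta>' = fdeg and \<delta>'' = "fst (?s n)"] unfolding P2 d2 syz_idx_def
      by (auto simp: module_hom_on_def)
    then show ?thesis
      using cover_map_image [OF good] cover_map_gdeg [OF good] by (simp add: P2 d2 syz_idx_def)
  qed
  have split: "k < i \<or> (\<exists>n. k = i + n)" for k
    by (metis le_iff_add not_less)
  have "projective_resolution ?P ?d e triv"
    unfolding projective_resolution_def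
  proof (intro conjI allI)
    show "projective (?P k)" for k
      using R'(2) free_on_projective by (auto simp: res_P_def)
    show "module_hom_on (?P (Suc k)) (?P k) (?d k)" for k
      using split [of k] R'(4) tail by (auto simp: P1 d1)
    show "module_hom_on (?P 0) triv e" "e ` Car (?P 0) = Car triv"
      using R'(6,7) by (auto simp: P1)
    show "{x \<in> Car (?P 0). e x = 0} = ?d 0 ` Car (?P 1)"
    proof (cases "i = 0")
      case True
      then show ?thesis
        using tail [of 0] P1 [of 0] by (auto simp: top_cycles_def)
    next
      case False
      then show ?thesis
        using R'(9) [of 0] by (simp add: P1 d1 top_cycles_def)
    qed
    show "{x \<in> Car (?P (Suc k)). ?d k x = 0} = ?d (Suc k) ` Car (?P (Suc (Suc k)))" for k
    proof -
      consider "Suc k < i" | "Suc k = i" | n where "k = i + n"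
        by (metis Suc_leI le_iff_add not_less order_le_less)
      then show ?thesis
      proof cases
        case 1
        then show ?thesis
          using R'(9) [of "Suc k"] by (simp add: P1 d1 top_cycles_def)
      next
        case 2
        then show ?thesis
          using tail [of 0] by (auto simp: P1 d1 top_cycles_def)
      next
        case 3
        then have "?d (Suc k) ` Car (?P (Suc (Suc k))) = snd (?s (Suc n))"
          using tail [of "Suc n"] by simp
        then show ?thesis
          using 3 by (simp add: P2 d2 cover_kernel_def syz_idx_def)
      qed
    qed
  qed
  moreover have "graded_module gr (?P k)" for k
    using gsub_graded_module [OF R'(1)] gsub_graded_module [OF free_on_gsub] by (auto simp: res_P_def)
  moreover have "?d k ` Deg (?P (Suc k)) n \<subseteq> Deg (?P k) n" for k n
  proof (cases "k < i")
    case True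
    then show ?thesis
      using R'(5) [OF True] module_hom_on_closed [OF R'(4) [OF True]] by (auto simp: P1 d1)
  next
    case False
    then obtain j where k: "k = i + j"
      by (metis le_iff_add not_less)
    have "Deg (?P k) n = Car (?P k) \<inter> gdeg (fst (?s j)) n"
      unfolding k by (cases j) (auto simp: P1 P2)
    moreover have "Deg (?P (Suc k)) n = Car (?P (Suc k)) \<inter> gdeg fdeg n"
      unfolding k by (simp add: P2)
    ultimately show ?thesis
      using tail [of j] module_hom_on_closed [of "?P (Suc k)" "?P k" "?d k"] by (auto simp: k)
  qed
  moreover have "e ` Deg (?P 0) n \<subseteq> Deg triv n" for n
    using R'(8) by (auto simp: P1)
  ultimately show ?thesis
    unfolding graded_projective_resolution_def by blast
qed

lemma res_P_le: "k \<le> i \<Longrightarrow> res_P i \<delta> C d e k = gm (\<delta> k) (C k)"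
  by (simp add: res_P_def)

lemma res_d_less: "k < i \<Longrightarrow> res_d i \<delta> C d e k = d k"
  by (simp add: res_d_def)

lemma res_P_Suc: "res_P i \<delta> C d e (Suc i) = gm fdeg (free_on (fidx (\<delta> i) (top_cycles C d e i)))"
  by (simp add: res_P_def syz_idx_def)

lemma res_d_top: "res_d i \<delta> C d e i = cover_map (\<delta> i) (top_cycles C d e i)"
  by (simp add: res_d_def syz_cov_def)

text \<open>A minimal generator of the kernel yields a class in Ext. The functional
  \<open>\<phi>\<close> sees degree \<open>j\<close> modulo products with elements of positive
  degree; sending each degree \<open>j\<close> generator of the free cover to the value of
  \<open>\<phi>\<close> there defines a cocycle. Coboundaries factor through homomorphisms from
  \<open>C i\<close> to \<open>k\<close>, restricted to the kernel, and these are zero by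
  \<open>min\<close>.\<close>

lemma Ext_trivial_nonvanishing:
  assumes R: "partial_resolution i \<delta> C d e"
    and min: "\<And>t z. module_hom_on (gm (\<delta> i) (C i)) triv t \<Longrightarrow> z \<in> top_cycles C d e i \<Longrightarrow> t z = 0"
    and \<phi>: "Vector_Spaces.linear usc (*) \<phi>" and z0: "z0 \<in> pieces (\<delta> i) (top_cycles C d e i) j" "\<phi> z0 \<noteq> 0"
    and kill: "\<And>a a' z k. a \<in> gr a' \<Longrightarrow> 0 < a' \<Longrightarrow> z \<in> pieces (\<delta> i) (top_cycles C d e i) k \<Longrightarrow> k + a' = j \<Longrightarrow> \<phi> (uact a z) = 0"
  shows "\<not> Ext_vanishes gr triv triv (Suc i) (- int j)"
proof
  assume "Ext_vanishes gr triv triv (Suc i) (- int j)"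
  let ?P = "res_P i \<delta> C d e" and ?d = "res_d i \<delta> C d e" and ?Z = "top_cycles C d e i"
  let ?I = "fidx (\<delta> i) ?Z" and ?g = "fgen (\<delta> i) ?Z"
  note good = top_cycles_gsub [OF R] top_cycles_locfin [OF R]
  have res: "graded_projective_resolution gr ?P ?d e triv"
    by (rule graded_resolution_extend [OF R])
  then have pres: "projective_resolution ?P ?d e triv"
    by (simp add: graded_projective_resolution_def)
  have eq: "cocycles ?P ?d triv (Suc i) (- int j) = coboundaries ?P ?d triv (Suc i) (- int j)"
    using \<open>Ext_vanishes gr triv triv (Suc i) (- int j)\<close> res unfolding Ext_vanishes_def by blast
  interpret \<phi>: Vector_Spaces.linear usc "(*)" \<phi> by (rule \<phi>)
  define v where "v = (\<lambda>q. if fdeg q = j then \<phi> (?g q) else 0)"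
  define f where "f = (\<lambda>x. if x \<in> free_on ?I then lincomb (Act triv) v x else 0)"
  have lch: "module_hom_on (gm fdeg (free_on ?I)) triv (lincomb (Act triv) v)"
    by (rule lincomb_hom [OF triv_left_module]) simp
  have "f \<in> graded_Hom (?P (Suc i)) triv (- int j)"
    unfolding graded_Hom_def
  proof (intro CollectI conjI allI impI)
    show "module_hom_on (?P (Suc i)) triv f"
      using lch unfolding res_P_Suc by (auto simp: module_hom_on_def f_def free_on_add free_on_act)
    show "f x = 0" if "x \<notin> Car (?P (Suc i))" for x
      using that by (simp add: res_P_Suc f_def)
    show "f ` Deg (?P (Suc i)) n \<subseteq> Deg triv (n + - int j)" for n
    proof (cases "n = int j")
      case False
      have "lincomb (Act triv) v x = 0" if "x \<in> gdeg fdeg n" for x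
        unfolding lincomb_def
      proof (rule sum.neutral, rule ballI)
        fix q
        have "x q \<in> gri (n - int (fdeg q))"
          using that by (simp add: gdeg_def)
        then show "Act triv (x q) (v q) = 0"
          using False \<epsilon>_gr [of "x q" "nat (n - int (fdeg q))"]
          by (cases "fdeg q = j") (auto simp: v_def gri_def split: if_splits)
      qed
      then show ?thesis
        using False by (auto simp: res_P_Suc f_def)
    qed auto
  qed
  moreover have "f (?d (Suc i) x) = 0" if x: "x \<in> Car (?P (Suc (Suc i)))" for x
  proof -
    let ?y = "?d (Suc i) x"
    have "?d i ?y = 0"
      by (rule projective_resolution_comp [OF pres x])
    then have cov0: "cover_map (\<delta> i) ?Z ?y = 0"
      by (simp add: res_d_top)
    have "?y \<in> Car (?P (Suc i))"
      using projective_resolutionD(3) [OF pres] x by (rule module_hom_on_closed)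
    then have y: "?y \<in> free_on ?I"
      by (simp add: res_P_Suc)
    let ?K = "{q. ?y q \<noteq> 0}"
    have K: "finite ?K" "?K \<subseteq> ?I"
      using y by (auto simp: free_on_def)
    \<comment> \<open>The component of degree \<open>j\<close> of a relation among the generators is
      again a relation; applying \<open>\<phi>\<close> to it computes the value of
      \<open>f\<close>.\<close>
    have "cover_map (\<delta> i) ?Z (ucomp fdeg (int j) ?y) = (\<Sum>q\<in>?K. uact (ucomp fdeg (int j) ?y q) (?g q))"
      unfolding cover_map_def using K by (subst lincomb_superset [of ?K]) auto
    then have "0 = \<phi> (\<Sum>q\<in>?K. uact (ucomp fdeg (int j) ?y q) (?g q))"
      using cover_map_ucomp [OF good y, of "int j"] cov0 by simp
    also have "\<dots> = (\<Sum>q\<in>?K. \<phi> (uact (ucomp fdeg (int j) ?y q) (?g q)))"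
      by (rule \<phi>.sum)
    also have "\<dots> = (\<Sum>q\<in>?K. Act triv (?y q) (v q))"
    proof (intro sum.cong refl)
      fix q assume "q \<in> ?K"
      then have g: "?g q \<in> pieces (\<delta> i) ?Z (fdeg q)"
        using K fgen_in(1) [OF good] by blast
      \<comment> \<open>In degree \<open>j\<close> a generator of degree \<open>j\<close> has a
        scalar coefficient, one of larger degree has coefficient 0, and one of smaller degree is
        multiplied by an element of positive degree, where \<open>kill\<close> applies.\<close>
      consider "fdeg q = j" | "fdeg q > j" | "fdeg q < j" by linarith
      then show "\<phi> (uact (ucomp fdeg (int j) ?y q) (?g q)) = Act triv (?y q) (v q)"
      proof cases
        case 1
        then have "\<phi> (uact (ucomp fdeg (int j) ?y q) (?g q)) = \<phi> (usc (\<epsilon> (?y q)) (?g q))"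
          by (simp add: ci_0_eq usc_eq_uact)
        then show ?thesis
          using 1 by (simp add: v_def \<phi>.scale del: usc_apply)
      next
        case 2
        then have "ucomp fdeg (int j) ?y q = 0" by (simp add: ci_def)
        then show ?thesis using 2 by (simp add: v_def)
      next
        case 3
        have "ucomp fdeg (int j) ?y q \<in> gr (j - fdeg q)"
          using 3 ci_in [of "int j - int (fdeg q)" "?y q"] by (simp add: gri_def nat_diff_distrib)
        then have "\<phi> (uact (ucomp fdeg (int j) ?y q) (?g q)) = 0"
          using kill [OF _ _ g] 3 by auto
        then show ?thesis using 3 by (simp add: v_def)
      qed
    qed
    finally show ?thesis
      using y by (simp add: f_def lincomb_def)
  qed
  ultimately have "f \<in> coboundaries ?P ?d triv (Suc i) (- int j)"
    using eq by (auto simp: cocycles_def)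
  then obtain t where t: "t \<in> graded_Hom (?P i) triv (- int j)"
    and ft: "f = (\<lambda>x. if x \<in> Car (?P (Suc i)) then t (?d i x) else 0)"
    by (auto simp: coboundaries_def)
  have th: "module_hom_on (gm (\<delta> i) (C i)) triv t"
    using t by (simp add: graded_Hom_def res_P_le)
  have "\<exists>q\<in>?I. fdeg q = j \<and> \<phi> (?g q) \<noteq> 0"
  proof (rule ccontr)
    assume no: "\<not> ?thesis"
    have "set (gens (\<delta> i) ?Z j) \<subseteq> {z. \<phi> z = 0}"
      using no gens_fgen [of _ "\<delta> i" ?Z j] by blast
    then have "uv.span (set (gens (\<delta> i) ?Z j)) \<subseteq> {z. \<phi> z = 0}"
      by (intro uv.span_minimal \<phi>.subspace_kernel)
    then show False
      using z0 gens_props(2) [OF good] by blast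
  qed
  then obtain q where q: "q \<in> ?I" "fdeg q = j" "\<phi> (?g q) \<noteq> 0" by blast
  have "f (usingle q 1) = \<phi> (?g q)"
    using q usingle_free_on [OF q(1)] by (simp add: f_def lincomb_usingle v_def)
  moreover have "f (usingle q 1) = t (?g q)"
    by (simp add: ft res_P_Suc res_d_top usingle_free_on [OF q(1)] cover_map_usingle [OF good])
  moreover have "t (?g q) = 0"
    using fgen_in(1) [OF good q(1)] by (intro min [OF th]) (simp add: pieces_def)
  ultimately show False
    using q by simp
qed

text \<open>A generator in the lowest degree \<open>N\<close> forces the single degree of Ext to be
  \<open>-N\<close>; a further minimal generator in a degree \<open>j > N\<close> would give a class
  in degree \<open>-j\<close>. The submodule \<open>D\<close> is later taken to be the image of the
  next Koszul map.\<close>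

lemma kernel_generated:
  assumes R: "partial_resolution i \<delta> C d e"
    and min: "\<And>t z. module_hom_on (gm (\<delta> i) (C i)) triv t \<Longrightarrow> z \<in> top_cycles C d e i \<Longrightarrow> t z = 0"
    and conc: "\<exists>n. \<forall>j. j \<noteq> n \<longrightarrow> Ext_vanishes gr triv triv (Suc i) j"
    and low: "\<And>k. k < N \<Longrightarrow> pieces (\<delta> i) (top_cycles C d e i) k \<subseteq> {0}"
    and N: "\<not> pieces (\<delta> i) (top_cycles C d e i) N \<subseteq> {0}"
    and D: "uv.subspace D" "\<And>a x. x \<in> D \<Longrightarrow> uact a x \<in> D" "pieces (\<delta> i) (top_cycles C d e i) N \<subseteq> D"
  shows "top_cycles C d e i \<subseteq> D"
proof -
  let ?Z = "top_cycles C d e i"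
  note good = top_cycles_gsub [OF R] top_cycles_locfin [OF R]
  obtain n where n: "\<And>j. j \<noteq> n \<Longrightarrow> Ext_vanishes gr triv triv (Suc i) j"
    using conc by blast
  have "\<exists>z0\<in>pieces (\<delta> i) ?Z N. z0 \<noteq> 0"
    using N by blast
  then obtain z0 where z0: "z0 \<in> pieces (\<delta> i) ?Z N" "z0 \<notin> {0}" by blast
  obtain \<phi> where \<phi>: "Vector_Spaces.linear usc (*) \<phi>" "\<phi> z0 = 1"
    using uv.linear_functional_extend [OF uv.subspace_single_0 z0(2)] by blast
  interpret \<phi>: Vector_Spaces.linear usc "(*)" \<phi> by (rule \<phi>(1))
  have "\<not> Ext_vanishes gr triv triv (Suc i) (- int N)"
  proof (rule Ext_trivial_nonvanishing [where i = i and \<delta> = \<delta> and C = C and d = d and e = e and j = N and \<phi> = \<phi> and ?z0.0 = z0],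
      rule R, erule (1) min, rule \<phi>(1), rule z0(1))
    show "\<phi> z0 \<noteq> 0" using \<phi>(2) by simp
    \<comment> \<open>Nothing nonzero lies below degree \<open>N\<close>, so the condition holds for
      an arbitrary functional.\<close>
    fix a a' z k assume "0 < a'" "z \<in> pieces (\<delta> i) ?Z k" "k + a' = N"
    then have "z = 0" using low [of k] by auto
    then show "\<phi> (uact a z) = 0" by simp
  qed
  then have nN: "n = - int N" using n [of "- int N"] by metis
  have pD: "pieces (\<delta> i) ?Z j \<subseteq> D" for j
  proof (induction j rule: less_induct)
    case (less j)
    consider "j < N" | "j = N" | "j > N" by linarith
    then show ?case
    proof cases
      case 1
      then show ?thesis using low D(1) uv.subspace_0 by blast
    next
      case 2
      then show ?thesis using D(3) by simp
    next
      case 3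
      \<comment> \<open>The part of degree \<open>j\<close> generated from lower degrees. It lies in
        \<open>D\<close> by induction, so it is enough that it exhausts the component.\<close>
      define Y where "Y = uv.span {uact a z | a z a' k. a \<in> gr a' \<and> 0 < a' \<and> z \<in> pieces (\<delta> i) ?Z k \<and> k + a' = j}"
      have "z \<in> Y" if z: "z \<in> pieces (\<delta> i) ?Z j" for z
      proof (rule ccontr)
        assume "z \<notin> Y"
        then obtain \<psi> where \<psi>: "Vector_Spaces.linear usc (*) \<psi>" "\<forall>y\<in>Y. \<psi> y = 0" "\<psi> z = 1"
          using uv.linear_functional_extend [of Y z] by (auto simp: Y_def)
        have "\<not> Ext_vanishes gr triv triv (Suc i) (- int j)"
        proof (rule Ext_trivial_nonvanishing [where i = i and \<delta> = \<delta> and C = C and d = d and e = e and j = j and \<phi> = \<psi> and ?z0.0 = z],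
          rule R, erule (1) min, rule \<psi>(1), rule z)
          show "\<psi> z \<noteq> 0" using \<psi>(3) by simp
          show "\<psi> (uact a z) = 0" if "a \<in> gr a'" "0 < a'" "z \<in> pieces (\<delta> i) ?Z k" "k + a' = j" for a a' z k
            using \<psi>(2) that unfolding Y_def by (blast intro: uv.span_base)
        qed
        then show False
          using n [of "- int j"] nN 3 by simp
      qed
      moreover have "Y \<subseteq> D"
        unfolding Y_def
      proof (intro uv.span_minimal D(1) subsetI, clarify)
        fix a z a' k assume "0 < a'" "z \<in> pieces (\<delta> i) ?Z k" "j = k + a'"
        then show "uact a z \<in> D"
          using less.IH [of k] D(2) by auto
      qed
      ultimately show ?thesis by blast
    qed
  qed
  show ?thesis
  proof
    fix z assume z: "z \<in> ?Z"
    then obtain J where J: "z = (\<Sum>j\<in>J. ucomp (\<delta> i) (int j) z)"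
      using gsub_sum_pieces [OF good(1)] by blast
    have "ucomp (\<delta> i) (int j) z \<in> D" for j
      using gsub_ucomp_pieces [OF good(1) z] pD by blast
    then show "z \<in> D"
      by (subst J) (intro uv.subspace_sum [OF D(1)])
  qed
qed

text \<open>Generators of covers are nonzero, so a module that vanishes up to degree
  \<open>L\<close> has generators of degree above \<open>L\<close> only; its free cover, and hence
  the kernel, again vanish up to \<open>L\<close>.\<close>

lemma syz_low:
  assumes good: "gsub \<delta> C" "locfin \<delta> C" and low: "\<And>k. k \<le> L \<Longrightarrow> pieces \<delta> C k \<subseteq> {0}" and q: "q \<in> syz_idx \<delta> C n"
  shows "L < fdeg q"
proof -
  have "\<forall>k\<le>L. pieces (fst (syz \<delta> C n)) (snd (syz \<delta> C n)) k \<subseteq> {0}"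
  proof (induction n)
    case 0
    show ?case unfolding syz.simps fst_conv snd_conv using low by blast
  next
    case (Suc n)
    let ?\<delta> = "fst (syz \<delta> C n)" and ?C = "snd (syz \<delta> C n)"
    note g = syz_good [OF good, of n]
    have "x = 0" if k: "k \<le> L" and x: "x \<in> pieces fdeg (cover_kernel ?\<delta> ?C) k" for k x
    proof (rule ext)
      fix q
      show "x q = 0 q"
      proof (cases "q \<in> fidx ?\<delta> ?C")
        case True
        then have "L < fdeg q"
          using fgen_in [OF g True] Suc.IH by (meson not_less singletonD subsetD)
        then have "int k - int (fdeg q) < 0" using k by simp
        moreover have "x q \<in> gri (int k - int (fdeg q))"
          using x by (simp add: pieces_def gdeg_def)
        ultimately show ?thesis by (simp add: gri_def)
      next
        case False
        then show ?thesis using x by (auto simp: pieces_def cover_kernel_def free_on_def)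
      qed
    qed
    then show ?case unfolding syz.simps fst_conv snd_conv by blast
  qed
  then show ?thesis
    using fgen_in [OF syz_good [OF good, of n]] q unfolding syz_idx_def by (meson not_less singletonD subsetD)
qed

end

section \<open>The Koszul complex in coordinates\<close>

definition words :: "nat \<Rightarrow> nat \<Rightarrow> nat list set" where
  "words n k = {u. length u = k \<and> set u \<subseteq> {..<n}}"

lemma finite_words [simp]: "finite (words n k)"
  using finite_lists_length_eq [of "{..<n}" k] by (simp add: words_def conj_commute)

lemma words_length: "u \<in> words n k \<Longrightarrow> length u = k"
  by (simp add: words_def)

lemma words_0 [simp]: "words n 0 = {[]}"
  by (auto simp: words_def)

lemma append_words: "length p = k \<Longrightarrow> p @ u \<in> words n (k + N) \<longleftrightarrow> p \<in> words n k \<and> u \<in> words n N"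
  by (auto simp: words_def)

lemma sum_words_add: "(\<Sum>r\<in>words n (k + k'). f r) = (\<Sum>p\<in>words n k. \<Sum>q\<in>words n k'. f (p @ q))"
proof -
  have "(\<Sum>r\<in>words n (k + k'). f r) = (\<Sum>(p, q)\<in>words n k \<times> words n k'. f (p @ q))"
    by (rule sum.reindex_bij_witness [of _ "\<lambda>(p, q). p @ q" "\<lambda>r. (take k r, drop k r)"])
      (auto simp: words_def dest: in_set_takeD in_set_dropD)
  then show ?thesis
    by (simp add: sum.cartesian_product)
qed

text \<open>What the Koszul complex uses of the presentation: words in the letters
  \<open>b i\<close> span every component, and words shorter than \<open>m\<close> satisfy no
  relations.\<close>

locale word_presentation = connected_graded_algebra scale gr
  for scale :: "'k::field \<Rightarrow> 's::ring_1 \<Rightarrow> 's" and gr +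
  fixes n m :: nat and b :: "nat \<Rightarrow> 's"
  assumes m2: "2 \<le> m"
    and b_gr: "i < n \<Longrightarrow> b i \<in> gr 1"
    and gr_words: "gr j \<subseteq> span ((\<lambda>u. prod_list (map b u)) ` words n j)"
    and words_indep: "k < m \<Longrightarrow> (\<Sum>u\<in>words n k. scale (x u) (prod_list (map b u))) = 0 \<Longrightarrow> u \<in> words n k \<Longrightarrow> x u = 0"
begin

sublocale locally_finite_graded_algebra scale gr
proof
  show "\<exists>B. finite B \<and> gr i \<subseteq> span B" for i
    using gr_words [of i] finite_imageI [OF finite_words] by blast
qed

section \<open>Words and the spaces \<open>W N\<close>\<close>

definition bw :: "nat list \<Rightarrow> 's" where
  "bw u = prod_list (map b u)"

lemma bw_Nil [simp]: "bw [] = 1"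
  and bw_append: "bw (u @ v) = bw u * bw v"
  by (auto simp: bw_def)

lemma bw_gr: "u \<in> words n k \<Longrightarrow> bw u \<in> gr k"
proof (induction u arbitrary: k)
  case (Cons a u)
  then obtain k' where k: "k = 1 + k'" "u \<in> words n k'" "a < n"
    by (cases k) (auto simp: words_def)
  then show ?case
    using mult_gr [OF b_gr [OF k(3)] Cons.IH [OF k(2)]] by (simp add: bw_def)
qed (auto simp: words_def one_gr)

definition W :: "nat \<Rightarrow> (nat list \<Rightarrow> 'k) set" where
  "W N = {x. (\<forall>u. u \<notin> words n N \<longrightarrow> x u = 0) \<and>
     (\<forall>p q. length p + m + length q = N \<longrightarrow> (\<Sum>u\<in>words n m. scale (x (p @ u @ q)) (bw u)) = 0)}"

lemma W_support: "x \<in> W N \<Longrightarrow> u \<notin> words n N \<Longrightarrow> x u = 0"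
  by (simp add: W_def)

lemma W_rel: "x \<in> W N \<Longrightarrow> length p + m + length q = N \<Longrightarrow> (\<Sum>u\<in>words n m. scale (x (p @ u @ q)) (bw u)) = 0"
  by (simp add: W_def)

lemma W_subspace: "wf.subspace (W N)"
  unfolding wf.subspace_def
proof (intro conjI ballI allI)
  show "0 \<in> W N" by (simp add: W_def)
  fix x assume x: "x \<in> W N"
  show "x + y \<in> W N" if "y \<in> W N" for y
    using x that by (simp add: W_def scale_left_distrib sum.distrib)
  show "(\<lambda>u. c * x u) \<in> W N" for c
    using x by (simp add: W_def scale_sum_right [symmetric] flip: scale_scale)
qed

lemma W_slice:
  assumes "x \<in> W (k + N)" "length p = k"
  shows "(\<lambda>u. x (p @ u)) \<in> W N"
proof -
  have "x (p @ u) = 0" if "u \<notin> words n N" for u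
    using assms that append_words [OF assms(2), of u n N] by (auto intro: W_support)
  moreover have "(\<Sum>u\<in>words n m. scale (x (p @ p' @ u @ q)) (bw u)) = 0" if "length p' + m + length q = N" for p' q
    using W_rel [OF assms(1), of "p @ p'" q] that assms(2) by simp
  ultimately show ?thesis
    by (simp add: W_def)
qed

text \<open>Slicing along the first letters of a word in the support leaves a nonzero element. In
  this way \<open>W l \<noteq> {0}\<close> is passed on to all smaller degrees.\<close>

lemma W_nonzero_mono:
  assumes "W (k + N) \<noteq> {0}"
  shows "W N \<noteq> {0}"
proof -
  obtain x where x: "x \<in> W (k + N)" "x \<noteq> 0"
    using assms wf.subspace_0 [OF W_subspace] by blast
  then obtain v where v: "x v \<noteq> 0" by (auto simp: fun_eq_iff)
  then have "length v = k + N"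
    using W_support [OF x(1)] words_length by blast
  then have "(\<lambda>u. x (take k v @ u)) \<in> W N"
    by (intro W_slice [OF x(1)]) simp
  moreover have "(\<lambda>u. x (take k v @ u)) \<noteq> 0"
    using v by (metis append_take_drop_id zero_fun_apply)
  ultimately show ?thesis by auto
qed

text \<open>
  \<open>SW N\<close> is \<open>S \<otimes> W N\<close>, as functions on words with values in \<open>S\<close>; \<open>list_encode\<close> turns words into indices,
  \<open>emb\<close> is \<open>x \<mapsto> 1 \<otimes> x\<close>, and the differential \<open>dK k\<close> is \<open>s \<otimes> p u \<mapsto> s p \<otimes> u\<close> for words \<open>p\<close> of length \<open>k\<close>.
\<close>

definition SW :: "nat \<Rightarrow> 's univ set" where
  "SW N = {g. \<forall>\<phi>. Vector_Spaces.linear scale (*) \<phi> \<longrightarrow> (\<lambda>u. \<phi> (g (list_encode u))) \<in> W N}"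

lemma linear_scale_0: "Vector_Spaces.linear scale (*) \<phi> \<Longrightarrow> \<phi> 0 = 0"
  and linear_scale_add: "Vector_Spaces.linear scale (*) \<phi> \<Longrightarrow> \<phi> (x + y) = \<phi> x + \<phi> y"
  and linear_scale_scale: "Vector_Spaces.linear scale (*) \<phi> \<Longrightarrow> \<phi> (scale c x) = c * \<phi> x"
  by (auto dest: module_hom.zero module_hom.add module_hom.scale simp: linear_iff_module_hom)

lemma linear_scale_sum: "Vector_Spaces.linear scale (*) \<phi> \<Longrightarrow> \<phi> (sum f A) = (\<Sum>a\<in>A. \<phi> (f a))"
  by (induction A rule: infinite_finite_induct) (auto simp: linear_scale_0 linear_scale_add)

lemma linear_scale_compose:
  assumes "Vector_Spaces.linear scale (*) \<phi>" and "\<And>x y. f (x + y) = f x + f y" "\<And>c x. f (scale c x) = scale c (f x)"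
  shows "Vector_Spaces.linear scale (*) (\<lambda>x. \<phi> (f x))"
  using assms unfolding Vector_Spaces.linear_iff by simp

lemma SW_D: "g \<in> SW N \<Longrightarrow> Vector_Spaces.linear scale (*) \<phi> \<Longrightarrow> (\<lambda>u. \<phi> (g (list_encode u))) \<in> W N"
  by (simp add: SW_def)

lemma SW_support:
  assumes "g \<in> SW N" "u \<notin> words n N"
  shows "g (list_encode u) = 0"
proof (rule linear_functional_eqI)
  fix \<phi> assume "Vector_Spaces.linear scale (*) \<phi>"
  then show "\<phi> (g (list_encode u)) = \<phi> 0"
    using assms W_support linear_scale_0 unfolding SW_def by fastforce
qed

lemma SW_support': "g \<in> SW N \<Longrightarrow> g q \<noteq> 0 \<Longrightarrow> q \<in> list_encode ` words n N"
  using SW_support [of g N "list_decode q"] by (metis image_eqI list_decode_inverse)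

lemma SW_gsub: "gsub \<delta> (SW N)" if "\<delta> = (\<lambda>_. N)"
  unfolding gsub_def
proof (intro conjI allI ballI)
  show "add_subgroup (SW N)"
    unfolding add_subgroup_def
  proof (intro conjI ballI)
    show "0 \<in> SW N"
      using wf.subspace_0 [OF W_subspace] by (auto simp: SW_def linear_scale_0 zero_fun_def)
    fix g assume g: "g \<in> SW N"
    show "g + h \<in> SW N" if "h \<in> SW N" for h
      using wf.subspace_add [OF W_subspace] g that by (auto simp: SW_def linear_scale_add plus_fun_def)
    show "- g \<in> SW N"
      unfolding SW_def
    proof (intro CollectI allI impI)
      fix \<phi> assume \<phi>: "Vector_Spaces.linear scale (*) \<phi>"
      have "(\<lambda>u. \<phi> ((- g) (list_encode u))) = (\<lambda>u. - 1 * \<phi> (g (list_encode u)))"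
        using linear_scale_scale [OF \<phi>, of "-1" "g (list_encode u)" for u] by auto
      then show "(\<lambda>u. \<phi> ((- g) (list_encode u))) \<in> W N"
        using wf.subspace_scale [OF W_subspace SW_D [OF g \<phi>], of "-1"] by simp
    qed
  qed
  fix g assume g: "g \<in> SW N"
  show "uact a g \<in> SW N" for a
    unfolding SW_def
  proof (intro CollectI allI impI)
    fix \<phi> assume "Vector_Spaces.linear scale (*) \<phi>"
    then have "Vector_Spaces.linear scale (*) (\<lambda>x. \<phi> (a * x))"
      by (rule linear_scale_compose) (auto simp: distrib_left scale_mult_right)
    from SW_D [OF g this] show "(\<lambda>u. \<phi> (uact a g (list_encode u))) \<in> W N"
      by simp
  qed
  show "ucomp \<delta> j g \<in> SW N" for j
    unfolding SW_def
  proof (intro CollectI allI impI)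
    fix \<phi> assume "Vector_Spaces.linear scale (*) \<phi>"
    then have "Vector_Spaces.linear scale (*) (\<lambda>x. \<phi> (ci (j - int N) x))"
      by (rule linear_scale_compose) (auto simp: ci_add ci_scale)
    from SW_D [OF g this] show "(\<lambda>u. \<phi> (ucomp \<delta> j g (list_encode u))) \<in> W N"
      using that by simp
  qed
  show "finite {q. g q \<noteq> 0}"
    by (rule finite_subset [of _ "list_encode ` words n N"]) (use SW_support' [OF g] in auto)
qed

definition emb :: "(nat list \<Rightarrow> 'k) \<Rightarrow> 's univ" where
  "emb x = (\<lambda>q. scale (x (list_decode q)) 1)"

lemma emb_apply [simp]: "emb x (list_encode u) = scale (x u) 1"
  by (simp add: emb_def)

lemma emb_SW: "x \<in> W N \<Longrightarrow> emb x \<in> SW N"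
  using wf.subspace_scale [OF W_subspace, of x N] by (simp add: SW_def linear_scale_scale mult.commute)

lemma emb_gdeg: "emb x \<in> gdeg (\<lambda>_. N) (int N)"
  by (simp add: emb_def gdeg_def gri_def gr_scale one_gr)

text \<open>The coordinates from \<open>wf_dual_basis\<close> are linear in the values, so the
  expansion holds after applying any functional on \<open>S\<close>, and functionals separate
  points.\<close>

lemma SW_basis:
  "\<exists>E c. finite E \<and> E \<subseteq> W N \<and> (\<forall>g\<in>SW N. \<forall>u. g (list_encode u) =
      (\<Sum>e\<in>E. scale (e u) (\<Sum>q\<in>words n N. scale (c e q) (g (list_encode q)))))"
proof -
  obtain E c where E: "finite E" "E \<subseteq> W N" "\<forall>x\<in>W N. \<forall>u. x u = (\<Sum>e\<in>E. (\<Sum>q\<in>words n N. c e q * x q) * e u)"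
    using wf_dual_basis [OF W_subspace [of N] finite_words [of n N]] W_support by meson
  have "g (list_encode u) = (\<Sum>e\<in>E. scale (e u) (\<Sum>q\<in>words n N. scale (c e q) (g (list_encode q))))"
    if g: "g \<in> SW N" for g u
  proof (rule linear_functional_eqI)
    fix \<phi> assume \<phi>: "Vector_Spaces.linear scale (*) \<phi>"
    then have "(\<lambda>u. \<phi> (g (list_encode u))) \<in> W N"
      using g by (simp add: SW_def)
    from E(3) [rule_format, OF this, of u]
    show "\<phi> (g (list_encode u)) = \<phi> (\<Sum>e\<in>E. scale (e u) (\<Sum>q\<in>words n N. scale (c e q) (g (list_encode q))))"
      by (simp add: linear_scale_sum [OF \<phi>] linear_scale_scale [OF \<phi>] mult.commute)
  qed
  then show ?thesis
    using E(1,2) by blast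
qed

text \<open>A finite family in \<open>W N\<close> with \<open>S\<close>-linear coordinates,
  exhibiting \<open>S \<otimes> W N\<close> as a module generated by \<open>1 \<otimes> W N\<close>.
  The last clause, that coordinates have augmentation 0 as soon as all values do, serves minimality
  of the complex.\<close>

definition SW_frame :: "nat \<Rightarrow> (nat list \<Rightarrow> 'k) set \<Rightarrow> ((nat list \<Rightarrow> 'k) \<Rightarrow> 's univ \<Rightarrow> 's) \<Rightarrow> bool" where
  "SW_frame N E lam \<longleftrightarrow> finite E \<and> E \<subseteq> W N \<and> (\<forall>g\<in>SW N. g = (\<Sum>e\<in>E. uact (lam e g) (emb e))) \<and>
     (\<forall>e g h. lam e (g + h) = lam e g + lam e h) \<and> (\<forall>e a g. lam e (uact a g) = a * lam e g) \<and>
     (\<forall>e g. (\<forall>q. \<epsilon> (g q) = 0) \<longrightarrow> \<epsilon> (lam e g) = 0)"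

lemma SW_frameD:
  assumes "SW_frame N E lam"
  shows "finite E" "E \<subseteq> W N" "\<And>g. g \<in> SW N \<Longrightarrow> g = (\<Sum>e\<in>E. uact (lam e g) (emb e))"
    "\<And>e g h. lam e (g + h) = lam e g + lam e h" "\<And>e a g. lam e (uact a g) = a * lam e g"
    "\<And>e g. (\<And>q. \<epsilon> (g q) = 0) \<Longrightarrow> \<epsilon> (lam e g) = 0"
  using assms unfolding SW_frame_def by simp_all

lemma SW_frame_exists: "\<exists>E lam. SW_frame N E lam"
proof -
  obtain E c where E: "finite E" "E \<subseteq> W N" "\<forall>g\<in>SW N. \<forall>u. g (list_encode u) =
      (\<Sum>e\<in>E. scale (e u) (\<Sum>q\<in>words n N. scale (c e q) (g (list_encode q))))"
    using SW_basis by meson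
  define lam where "lam = (\<lambda>e (g :: 's univ). \<Sum>q\<in>words n N. scale (c e q) (g (list_encode q)))"
  have "g = (\<Sum>e\<in>E. uact (lam e g) (emb e))" if g: "g \<in> SW N" for g
  proof
    fix q
    have "g q = (\<Sum>e\<in>E. scale (e (list_decode q)) (lam e g))"
      using E(3) [rule_format, OF g, of "list_decode q"] by (simp add: lam_def)
    then show "g q = (\<Sum>e\<in>E. uact (lam e g) (emb e)) q"
      by (simp add: sum_fun_apply emb_def scale_mult_right)
  qed
  moreover have "lam e (g + h) = lam e g + lam e h" for e g h
    by (simp add: lam_def scale_right_distrib sum.distrib)
  moreover have "lam e (uact a g) = a * lam e g" for e a g
    by (simp add: lam_def sum_distrib_left scale_mult_right)
  moreover have "\<epsilon> (lam e g) = 0" if "\<forall>q. \<epsilon> (g q) = 0" for e g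
    using that by (simp add: lam_def \<epsilon>_sum \<epsilon>_scale)
  ultimately show ?thesis
    using E(1,2) unfolding SW_frame_def by (intro exI [of _ E] exI [of _ lam]) blast
qed

lemma SW_projective: "projective (gm (\<lambda>_. N) (SW N))"
proof -
  obtain E lam where "SW_frame N E lam"
    using SW_frame_exists by blast
  note E = SW_frameD [OF this]
  show ?thesis
  proof (rule projective_dual_basis [where J = E and e = emb and lam = lam])
    show "left_module (gm (\<lambda>_. N) (SW N))"
      by (rule gsub_left_module [OF SW_gsub]) simp
    show "emb e \<in> Car (gm (\<lambda>_. N) (SW N))" if "e \<in> E" for e
      using E(2) emb_SW that by auto
    fix g assume g: "g \<in> Car (gm (\<lambda>_. N) (SW N))"
    show "finite {j \<in> E. lam j g \<noteq> 0}" using E(1) by simp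
    have "(\<Sum>j | j \<in> E \<and> lam j g \<noteq> 0. uact (lam j g) (emb j)) = (\<Sum>e\<in>E. uact (lam e g) (emb e))"
      by (rule sum.mono_neutral_left) (use E(1) in auto)
    then show "(\<Sum>j | j \<in> E \<and> lam j g \<noteq> 0. Act (gm (\<lambda>_. N) (SW N)) (lam j g) (emb j)) = g"
      using E(3) g by simp
  qed (use E in auto)
qed

lemma SW_locfin: "locfin (\<lambda>_. N) (SW N)"
  by (rule locfin_support [where X = "list_encode ` words n N"]) (auto dest: SW_support')

definition dK :: "nat \<Rightarrow> 's univ \<Rightarrow> 's univ" where
  "dK k g = (\<lambda>q. \<Sum>p\<in>words n k. g (list_encode (p @ list_decode q)) * bw p)"

lemma dK_apply: "dK k g (list_encode u) = (\<Sum>p\<in>words n k. g (list_encode (p @ u)) * bw p)"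
  by (simp add: dK_def)

lemma dK_SW:
  assumes g: "g \<in> SW (k + N)"
  shows "dK k g \<in> SW N"
  unfolding SW_def
proof (intro CollectI allI impI)
  fix \<phi> assume \<phi>: "Vector_Spaces.linear scale (*) \<phi>"
  have "(\<lambda>u. \<phi> (g (list_encode (p @ u)) * bw p)) \<in> W N" if p: "p \<in> words n k" for p
  proof -
    have "Vector_Spaces.linear scale (*) (\<lambda>x. \<phi> (x * bw p))"
      using \<phi> by (rule linear_scale_compose) (auto simp: distrib_right scale_mult_left)
    from SW_D [OF g this] have "(\<lambda>u. \<phi> (g (list_encode u) * bw p)) \<in> W (k + N)" .
    from W_slice [OF this words_length [OF p]] show ?thesis .
  qed
  then have "(\<Sum>p\<in>words n k. (\<lambda>u. \<phi> (g (list_encode (p @ u)) * bw p))) \<in> W N"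
    by (intro wf.subspace_sum [OF W_subspace])
  moreover have "(\<Sum>p\<in>words n k. (\<lambda>u. \<phi> (g (list_encode (p @ u)) * bw p))) = (\<lambda>u. \<phi> (dK k g (list_encode u)))"
    by (rule ext) (simp add: dK_apply sum_fun_apply linear_scale_sum [OF \<phi>])
  ultimately show "(\<lambda>u. \<phi> (dK k g (list_encode u))) \<in> W N" by simp
qed

lemma dK_hom: "module_hom_on (gm \<delta> (SW (k + N))) (gm \<delta>' (SW N)) (dK k)"
  unfolding module_hom_on_def using dK_SW
  by (auto simp: dK_def fun_eq_iff distrib_right sum.distrib sum_distrib_left mult.assoc)

lemma dK_gdeg: "g \<in> gdeg (\<lambda>_. k + N) j \<Longrightarrow> dK k g \<in> gdeg (\<lambda>_. N) j"
  using gri_mult_right [of "g q" "j - int (k + N)" "bw p" k for q p] bw_gr [of _ k]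
  by (auto simp: gdeg_def dK_def intro!: gri_sum)

text \<open>Two successive differentials move a prefix of \<open>m\<close> letters into the
  coefficient, and this prefix is the leftmost window of an element of \<open>W\<close>.\<close>

lemma dK_dK:
  assumes g: "g \<in> SW (k + (k' + N))" and k: "k + k' = m"
  shows "dK k' (dK k g) = 0"
proof
  fix q
  obtain u where q: "q = list_encode u"
    by (metis list_decode_inverse)
  have "dK k' (dK k g) q = (\<Sum>p\<in>words n k'. \<Sum>r\<in>words n k. g (list_encode (r @ p @ u)) * bw r * bw p)"
    by (simp add: q dK_apply sum_distrib_right)
  also have "\<dots> = (\<Sum>r\<in>words n k. \<Sum>p\<in>words n k'. g (list_encode ((r @ p) @ u)) * bw (r @ p))"
    by (subst sum.swap) (simp add: bw_append mult.assoc)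
  also have "\<dots> = (\<Sum>v\<in>words n m. g (list_encode (v @ u)) * bw v)"
    unfolding k [symmetric] sum_words_add ..
  also have "\<dots> = 0"
  proof (cases "length u = N")
    case True
    \<comment> \<open>In a frame the coefficients from \<open>S\<close> come out on the left, and
      what remains is the defining relation of the elements \<open>e\<close>.\<close>
    obtain E lam where "SW_frame (k + (k' + N)) E lam"
      using SW_frame_exists by blast
    note E = SW_frameD [OF this]
    have gv: "g (list_encode v) = (\<Sum>e\<in>E. scale (e v) (lam e g))" for v
    proof -
      have "g (list_encode v) = (\<Sum>e\<in>E. uact (lam e g) (emb e)) (list_encode v)"
        using E(3) [OF g] by (rule arg_cong)
      then show ?thesis
        by (simp add: sum_fun_apply scale_mult_right)
    qed
    have "(\<Sum>v\<in>words n m. g (list_encode (v @ u)) * bw v) = (\<Sum>v\<in>words n m. \<Sum>e\<in>E. lam e g * scale (e (v @ u)) (bw v))"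
      by (simp add: gv sum_distrib_right scale_mult_left scale_mult_right)
    also have "\<dots> = (\<Sum>e\<in>E. lam e g * (\<Sum>v\<in>words n m. scale (e (v @ u)) (bw v)))"
      by (subst sum.swap) (simp add: sum_distrib_left)
    also have "\<dots> = 0"
    proof (intro sum.neutral ballI)
      fix e assume "e \<in> E"
      then have "e \<in> W (k + (k' + N))" using E(2) by blast
      from W_rel [OF this, of "[]" u] True k
      show "lam e g * (\<Sum>v\<in>words n m. scale (e (v @ u)) (bw v)) = 0" by simp
    qed
    finally show ?thesis .
  next
    case False
    then have "g (list_encode (v @ u)) = 0" if "v \<in> words n m" for v
      using that k by (intro SW_support [OF g]) (auto simp: words_def)
    then show ?thesis by simp
  qed
  finally show "dK k' (dK k g) q = 0 q" by simp
qed

text \<open>Below degree \<open>m\<close> the words form a basis of the component. The dual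
  functionals are linear on all of \<open>S\<close>, so that they can be applied to the values of an
  element of \<open>SW N\<close>.\<close>

lemma gr_expand:
  assumes c: "c < m"
  shows "\<exists>\<phi>. (\<forall>p\<in>words n c. Vector_Spaces.linear scale (*) (\<phi> p)) \<and>
    (\<forall>s\<in>gr c. s = (\<Sum>p\<in>words n c. scale (\<phi> p s) (bw p)))"
proof -
  have "\<exists>\<phi>. Vector_Spaces.linear scale (*) \<phi> \<and> (\<forall>q\<in>words n c. \<phi> (bw q) = (if q = p then 1 else 0))"
    if p: "p \<in> words n c" for p
    by (rule linear_functional_dual [OF finite_words _ p]) (rule words_indep [OF c], auto simp: bw_def)
  then obtain \<phi> where \<phi>: "\<And>p. p \<in> words n c \<Longrightarrow> Vector_Spaces.linear scale (*) (\<phi> p)"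
    "\<And>p q. p \<in> words n c \<Longrightarrow> q \<in> words n c \<Longrightarrow> \<phi> p (bw q) = (if q = p then 1 else 0)"
    by metis
  have "s = (\<Sum>p\<in>words n c. scale (\<phi> p s) (bw p))" if "s \<in> gr c" for s
  proof -
    have "s \<in> span (bw ` words n c)"
      using gr_words [of c] that by (auto simp: bw_def [abs_def])
    then show ?thesis
    proof (induction rule: span_induct_alt)
      case base
      then show ?case by (simp add: linear_scale_0 [OF \<phi>(1)])
    next
      case (step a x y)
      then obtain q where q: "q \<in> words n c" "x = bw q" by blast
      have "(\<Sum>p\<in>words n c. scale (\<phi> p (scale a x + y)) (bw p)) =
          (\<Sum>p\<in>words n c. scale (a * \<phi> p x) (bw p) + scale (\<phi> p y) (bw p))"
        by (intro sum.cong) (auto simp: linear_scale_add [OF \<phi>(1)] linear_scale_scale [OF \<phi>(1)] scale_left_distrib)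
      also have "\<dots> = (\<Sum>p\<in>words n c. scale (a * \<phi> p x) (bw p)) + (\<Sum>p\<in>words n c. scale (\<phi> p y) (bw p))"
        by (rule sum.distrib)
      also have "(\<Sum>p\<in>words n c. scale (a * \<phi> p x) (bw p)) = (\<Sum>p\<in>words n c. if q = p then scale a (bw p) else 0)"
        using q \<phi>(2) by (intro sum.cong) auto
      also have "\<dots> = scale a x"
        using q by simp
      finally show ?case using step(2) by simp
    qed
  qed
  then show ?thesis using \<phi>(1) by blast
qed

text \<open>For \<open>c < m\<close> the component \<open>S\<^sub>c\<close> is a full tensor power
  of \<open>V\<close>, so an element of \<open>S\<^sub>c \<otimes> W N\<close> is a tensor on words
  of length \<open>c + N\<close> whose slices along \<open>c\<close> letters lie in
  \<open>W N\<close>.\<close>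

lemma SW_coordinates:
  assumes c: "c < m" and g: "g \<in> SW N" "g \<in> gdeg (\<lambda>_. N) (int (c + N))"
  shows "\<exists>x. (\<forall>v. v \<notin> words n (c + N) \<longrightarrow> x v = 0) \<and> (\<forall>p. length p = c \<longrightarrow> (\<lambda>u. x (p @ u)) \<in> W N) \<and>
    (\<forall>u. g (list_encode u) = (\<Sum>p\<in>words n c. scale (x (p @ u)) (bw p)))"
proof -
  obtain \<phi> where \<phi>: "\<And>p. p \<in> words n c \<Longrightarrow> Vector_Spaces.linear scale (*) (\<phi> p)"
    "\<And>s. s \<in> gr c \<Longrightarrow> s = (\<Sum>p\<in>words n c. scale (\<phi> p s) (bw p))"
    using gr_expand [OF c] by blast
  define x where "x = (\<lambda>v. if take c v \<in> words n c then \<phi> (take c v) (g (list_encode (drop c v))) else 0)"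
  have xp: "x (p @ u) = \<phi> p (g (list_encode u))" if "p \<in> words n c" for p u
    using that words_length [OF that] by (simp add: x_def)
  have xp0: "x (p @ u) = 0" if "length p = c" "p \<notin> words n c" for p u
    using that by (simp add: x_def)
  have "(\<lambda>u. x (p @ u)) \<in> W N" if p: "length p = c" for p
  proof (cases "p \<in> words n c")
    case True
    then have "(\<lambda>u. x (p @ u)) = (\<lambda>u. \<phi> p (g (list_encode u)))"
      using xp by simp
    then show ?thesis
      using g(1) \<phi>(1) [OF True] by (simp add: SW_def)
  next
    case False
    then have "(\<lambda>u. x (p @ u)) = 0"
      using xp0 p by auto
    then show ?thesis
      using wf.subspace_0 [OF W_subspace] by simp
  qed
  moreover have "x v = 0" if v: "v \<notin> words n (c + N)" for v
  proof (cases "take c v \<in> words n c")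
    case True
    then have "length (take c v) = c" by (rule words_length)
    then have "drop c v \<notin> words n N"
      using append_words [of "take c v" c "drop c v" n N] True v by simp
    then show ?thesis
      using SW_support [OF g(1)] linear_scale_0 [OF \<phi>(1) [OF True]] True by (simp add: x_def)
  qed (simp add: x_def)
  moreover have "g (list_encode u) = (\<Sum>p\<in>words n c. scale (x (p @ u)) (bw p))" for u
  proof -
    have "g (list_encode u) \<in> gr c"
      using g(2) by (simp add: gdeg_def gri_def split: if_splits)
    from \<phi>(2) [OF this] show ?thesis
      by (rule trans) (intro sum.cong refl, simp add: xp)
  qed
  ultimately show ?thesis by blast
qed

text \<open>The differential only regroups letters: the coordinates \<open>x\<close> stay the same,
  while the prefix that is multiplied out grows from \<open>c\<close> to \<open>c + k\<close>
  letters.\<close>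

lemma dK_coordinates:
  assumes "\<And>u. g (list_encode u) = (\<Sum>p\<in>words n c. scale (x (p @ u)) (bw p))"
  shows "dK k g (list_encode u) = (\<Sum>r\<in>words n (c + k). scale (x (r @ u)) (bw r))"
proof -
  have "dK k g (list_encode u) = (\<Sum>q\<in>words n k. \<Sum>p\<in>words n c. scale (x (p @ q @ u)) (bw p * bw q))"
    by (simp add: dK_apply assms sum_distrib_right scale_mult_left)
  also have "\<dots> = (\<Sum>p\<in>words n c. \<Sum>q\<in>words n k. scale (x ((p @ q) @ u)) (bw (p @ q)))"
    by (subst sum.swap) (simp add: bw_append)
  finally show ?thesis
    by (simp add: sum_words_add)
qed

lemma dK_emb: "dK k (emb x) (list_encode u) = (\<Sum>p\<in>words n k. scale (x (p @ u)) (bw p))"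
  by (simp add: dK_apply scale_mult_left)

text \<open>Since \<open>k < m\<close>, the products of the prefixes are independent, so a nonzero
  coefficient of \<open>x\<close> survives.\<close>

lemma dK_emb_nonzero:
  assumes "k < m" "x \<in> W (k + N)" "x \<noteq> 0"
  shows "dK k (emb x) \<noteq> 0"
proof
  assume z: "dK k (emb x) = 0"
  obtain v where v: "x v \<noteq> 0" using assms(3) by (auto simp: fun_eq_iff)
  then have vw: "take k v @ drop k v \<in> words n (k + N)"
    using W_support [OF assms(2)] by auto
  then have "take k v \<in> words n k"
    using append_words [of "take k v" k "drop k v" n N] words_length by fastforce
  moreover have "(\<Sum>p\<in>words n k. scale (x (p @ drop k v)) (bw p)) = 0"
    using dK_emb [of k x "drop k v"] z by simp
  ultimately have "x (take k v @ drop k v) = 0"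
    using words_indep [OF assms(1), of "\<lambda>p. x (p @ drop k v)" "take k v"] unfolding bw_def by blast
  then show False using v by simp
qed

section \<open>The Koszul complex and its degree pattern\<close>

definition kd :: "nat \<Rightarrow> nat" where
  "kd i = (if even i then i div 2 * m else i div 2 * m + 1)"

text \<open>The number of letters moved by the differential out of term \<open>i + 1\<close>. Each
  value is below \<open>m\<close>, where words are independent, and two consecutive ones add up to
  \<open>m\<close>, which makes the maps a complex.\<close>

definition ks :: "nat \<Rightarrow> nat" where
  "ks i = (if even i then 1 else m - 1)"

lemma kd_Suc: "kd (Suc i) = ks i + kd i"
  using m2 by (auto simp: kd_def ks_def elim!: oddE evenE)

lemma ks_bounds: "0 < ks i" "ks i < m" and ks_Suc: "ks (Suc i) + ks i = m"
  using m2 by (auto simp: ks_def)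

lemma kd_values [simp]: "kd 0 = 0" "kd (Suc 0) = 1" "kd 2 = m" "kd 3 = m + 1"
  by (auto simp: kd_def)

definition KD :: "nat \<Rightarrow> nat \<Rightarrow> nat" where "KD i = (\<lambda>_. kd i)"
definition KC :: "nat \<Rightarrow> 's univ set" where "KC i = SW (kd i)"
definition Kd :: "nat \<Rightarrow> 's univ \<Rightarrow> 's univ" where "Kd i = dK (ks i)"
text \<open>Position 0 is the code of the empty word, the only possible support of an element of
  \<open>SW 0\<close>.\<close>

definition Ke :: "'s univ \<Rightarrow> 'k" where "Ke g = \<epsilon> (g 0)"

lemma KC_gsub: "gsub (KD i) (KC i)"
  unfolding KC_def KD_def by (rule SW_gsub) simp

lemma Kd_hom: "module_hom_on (gm (KD (Suc i)) (KC (Suc i))) (gm (KD i) (KC i)) (Kd i)"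
  unfolding KC_def Kd_def kd_Suc by (rule dK_hom)

lemma Kd_gdeg: "x \<in> gdeg (KD (Suc i)) j \<Longrightarrow> Kd i x \<in> gdeg (KD i) j"
  unfolding KD_def Kd_def kd_Suc by (rule dK_gdeg)

lemma Kd_Kd: "x \<in> KC (Suc (Suc i)) \<Longrightarrow> Kd i (Kd (Suc i) x) = 0"
  unfolding KC_def Kd_def kd_Suc using dK_dK [of x "ks (Suc i)" "ks i" "kd i"] ks_Suc by simp

abbreviation Kcycles :: "nat \<Rightarrow> 's univ set" where
  "Kcycles \<equiv> top_cycles KC Kd Ke"

lemma Ke_hom: "module_hom_on (gm \<delta> (KC 0)) triv Ke"
  by (auto simp: module_hom_on_def Ke_def \<epsilon>_add \<epsilon>_mult)

lemma Ke_surj: "Ke ` KC 0 = UNIV"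
proof -
  have "\<exists>g\<in>KC 0. Ke g = c" for c
  proof (rule bexI)
    let ?x = "\<lambda>u. if u = [] then c else 0"
    have "?x \<in> W 0" using m2 by (auto simp: W_def)
    then show "emb ?x \<in> KC 0"
      using emb_SW by (simp add: KC_def)
    show "Ke (emb ?x) = c"
      by (simp add: Ke_def emb_def \<epsilon>_scale)
  qed
  then show ?thesis by (metis UNIV_eq_I image_eqI)
qed

lemma Koszul_partial_resolution:
  assumes "\<And>k. k < i \<Longrightarrow> Kcycles k = Kd k ` KC (Suc k)"
  shows "partial_resolution i KD KC Kd Ke"
  unfolding partial_resolution_def
proof (intro conjI allI impI)
  show "gsub (KD k) (KC k)" for k by (rule KC_gsub)
  show "projective (gm (KD k) (KC k))" "locfin (KD k) (KC k)" for k
    unfolding KC_def KD_def by (rule SW_projective, rule SW_locfin)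
  show "Ke x = 0" if "x \<in> gdeg (KD 0) j" "j \<noteq> 0" for j x
    using that \<epsilon>_gr [of "x 0" "nat j"] by (auto simp: Ke_def gdeg_def KD_def gri_def dest!: spec [of _ 0] split: if_splits)
qed (use assms Kd_hom Kd_gdeg Ke_hom Ke_surj in auto)

lemma Kd_cycle: "x \<in> KC (Suc i) \<Longrightarrow> Kd i x \<in> Kcycles i"
proof (cases i)
  case 0
  assume x: "x \<in> KC (Suc i)"
  have "Ke (dK 1 x) = (\<Sum>p\<in>words n 1. \<epsilon> (x (list_encode p)) * \<epsilon> (bw p))"
    using dK_apply [of 1 x "[]"] by (simp add: Ke_def \<epsilon>_sum \<epsilon>_mult)
  also have "\<dots> = 0"
    using \<epsilon>_gr [OF bw_gr] by (intro sum.neutral) auto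
  finally show ?thesis
    using x 0 module_hom_on_closed [OF Kd_hom, of x i] by (simp add: top_cycles_def Kd_def ks_def)
next
  case (Suc k)
  assume x: "x \<in> KC (Suc i)"
  then show ?thesis
    using Suc Kd_Kd module_hom_on_closed [OF Kd_hom, of x i] by (simp add: top_cycles_def)
qed

text \<open>Berger's extra condition, a consequence of exactness at the third term.\<close>

lemma extra_condition:
  assumes ex: "Kcycles 2 = Kd 2 ` KC (Suc 2)" and s: "0 < s" "s < m"
    and supp: "\<And>v. v \<notin> words n (s + m) \<Longrightarrow> y v = 0"
    and left: "\<And>q. length q = s \<Longrightarrow> (\<Sum>r\<in>words n m. scale (y (r @ q)) (bw r)) = 0"
    and right: "\<And>p. length p = s \<Longrightarrow> (\<Sum>r\<in>words n m. scale (y (p @ r)) (bw r)) = 0"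
    and pq: "length p = s - 1" "length q = 1"
  shows "(\<Sum>r\<in>words n m. scale (y (p @ r @ q)) (bw r)) = 0"
proof -
  \<comment> \<open>The class of \<open>y\<close> in \<open>S \<otimes> W m\<close>: the first
    \<open>s\<close> letters are multiplied out, and the conditions on the right put the slices of
    \<open>y\<close> in \<open>W m\<close>.\<close>
  define g where "g = (\<lambda>c. \<Sum>p\<in>words n s. scale (y (p @ list_decode c)) (bw p))"
  have gu: "g (list_encode u) = (\<Sum>p\<in>words n s. scale (y (p @ u)) (bw p))" for u
    by (simp add: g_def)
  have yW: "(\<lambda>u. y (p @ u)) \<in> W m" if p: "length p = s" for p
  proof -
    have "y (p @ u) = 0" if "u \<notin> words n m" for u
      using that append_words [OF p, of u n m] by (intro supp) simp
    then show ?thesis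
      using right [OF p] by (simp add: W_def)
  qed
  have gSW: "g \<in> SW m"
    unfolding SW_def
  proof (intro CollectI allI impI)
    fix \<phi> assume \<phi>: "Vector_Spaces.linear scale (*) \<phi>"
    have "(\<Sum>p\<in>words n s. (\<lambda>u. \<phi> (bw p) * y (p @ u))) \<in> W m"
      using yW words_length by (intro wf.subspace_sum [OF W_subspace] wf.subspace_scale [OF W_subspace]) blast
    moreover have "(\<Sum>p\<in>words n s. (\<lambda>u. \<phi> (bw p) * y (p @ u))) = (\<lambda>u. \<phi> (g (list_encode u)))"
      by (rule ext) (simp add: gu sum_fun_apply linear_scale_sum [OF \<phi>] linear_scale_scale [OF \<phi>] mult.commute)
    ultimately show "(\<lambda>u. \<phi> (g (list_encode u))) \<in> W m" by simp
  qed
  have gdeg: "g \<in> gdeg (\<lambda>_. m) (int (s + m))"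
    using bw_gr by (auto simp: gdeg_def g_def intro!: gr_sum gr_scale)
  have "dK (m - 1) g = 0"
  proof
    fix c
    obtain u where c: "c = list_encode u" by (metis list_decode_inverse)
    \<comment> \<open>Altogether \<open>s + (m - 1) = m + (s - 1)\<close> letters are multiplied
      out, and the first \<open>m\<close> of them already give 0 by \<open>left\<close>.\<close>
    have "dK (m - 1) g c = (\<Sum>r\<in>words n (m + (s - 1)). scale (y (r @ u)) (bw r))"
      unfolding c dK_coordinates [OF gu] using s m2 by (simp add: add.commute)
    also have "\<dots> = (\<Sum>r\<in>words n m. \<Sum>r'\<in>words n (s - 1). scale (y (r @ r' @ u)) (bw r) * bw r')"
      by (simp add: sum_words_add bw_append scale_mult_left)
    also have "\<dots> = (\<Sum>r'\<in>words n (s - 1). (\<Sum>r\<in>words n m. scale (y (r @ r' @ u)) (bw r)) * bw r')"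
      by (subst sum.swap) (simp add: sum_distrib_right)
    also have "\<dots> = 0"
    proof (intro sum.neutral ballI)
      fix r' assume r': "r' \<in> words n (s - 1)"
      show "(\<Sum>r\<in>words n m. scale (y (r @ r' @ u)) (bw r)) * bw r' = 0"
      proof (cases "length u = 1")
        case True
        then show ?thesis using left [of "r' @ u"] words_length [OF r'] s by simp
      next
        case False
        then have "y (r @ r' @ u) = 0" if "r \<in> words n m" for r
          using that words_length [OF r'] s by (intro supp) (auto simp: words_def)
        then show ?thesis by simp
      qed
    qed
    finally show "dK (m - 1) g c = 0 c" by simp
  qed
  then have "g \<in> Kcycles 2"
    using gSW by (simp add: numeral_2_eq_2 top_cycles_def KC_def Kd_def ks_def) (simp flip: numeral_2_eq_2)
  then obtain h where h: "h \<in> KC (Suc 2)" "g = Kd 2 h"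
    using ex by blast
  \<comment> \<open>The component of degree \<open>s + m\<close> of a preimage still maps to
    \<open>g\<close>, because \<open>g\<close> is homogeneous of that degree.\<close>
  define h' where "h' = ucomp (KD (Suc 2)) (int (s + m)) h"
  have "Kd 2 h' = ucomp (KD 2) (int (s + m)) g"
    unfolding h'_def h(2) by (rule hom_ucomp [OF KC_gsub Kd_hom Kd_gdeg h(1)])
  then have dh: "dK 1 h' = g"
    using gdeg by (simp add: ucomp_homogeneous KD_def Kd_def ks_def)
  have h'SW: "h' \<in> SW (m + 1)"
    using gsub_ucomp [OF KC_gsub h(1)] unfolding h'_def KC_def by (simp add: eval_nat_numeral(3) [symmetric])
  have "h' \<in> gdeg (KD (Suc 2)) (int (s + m))"
    unfolding h'_def by simp
  then have h'deg: "h' \<in> gdeg (\<lambda>_. m + 1) (int ((s - 1) + (m + 1)))"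
    using s by (simp add: KD_def eval_nat_numeral(3) [symmetric])
  have "s - 1 < m" using s by simp
  from SW_coordinates [OF this h'SW h'deg]
  obtain z where z: "\<forall>p. length p = s - 1 \<longrightarrow> (\<lambda>u. z (p @ u)) \<in> W (m + 1)"
    "\<forall>u. h' (list_encode u) = (\<Sum>p\<in>words n (s - 1). scale (z (p @ u)) (bw p))" "\<forall>v. v \<notin> words n (s - 1 + (m + 1)) \<longrightarrow> z v = 0"
    by blast
  \<comment> \<open>The tensors \<open>y\<close> and \<open>z\<close> agree after multiplying out
    \<open>s < m\<close> letters, and there are no relations in that degree, so they coincide. Thus
    \<open>y\<close> inherits the window condition at position \<open>s - 1\<close> from
    \<open>W (m + 1)\<close>.\<close>
  have yz: "y (r @ u) = z (r @ u)" if r: "length r = s" for r u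
  proof (cases "r \<in> words n s")
    case True
    have "dK 1 h' (list_encode u) = (\<Sum>r\<in>words n (s - 1 + 1). scale (z (r @ u)) (bw r))"
      using z(2) by (intro dK_coordinates) simp
    then have "(\<Sum>r\<in>words n s. scale (z (r @ u)) (bw r)) = (\<Sum>r\<in>words n s. scale (y (r @ u)) (bw r))"
      unfolding dh gu using s by simp
    then have "(\<Sum>r\<in>words n s. scale (y (r @ u) - z (r @ u)) (bw r)) = 0"
      by (simp add: scale_left_diff_distrib sum_subtractf)
    then have "y (r @ u) - z (r @ u) = 0"
      using words_indep [OF s(2) _ True, of "\<lambda>r. y (r @ u) - z (r @ u)"] by (simp add: bw_def)
    then show ?thesis by simp
  next
    case False
    then have "r @ u \<notin> words n (s + m)"
      using append_words [OF r, of u n m] by simp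
    then show ?thesis
      using supp z(3) s by simp
  qed
  have "(\<Sum>r\<in>words n m. scale (z (p @ r @ q)) (bw r)) = 0"
    using W_rel [OF z(1) [rule_format, OF pq(1)], of "[]" q] pq by simp
  moreover have "y (p @ r @ q) = z (p @ r @ q)" if "r \<in> words n m" for r
  proof -
    have "p @ r @ q = take s (p @ r @ q) @ drop s (p @ r @ q)"
      by (simp only: append_take_drop_id)
    moreover have "length (take s (p @ r @ q)) = s"
      using pq s words_length [OF that] by simp
    ultimately show ?thesis using yz by metis
  qed
  ultimately show ?thesis by simp
qed

end

section \<open>Exactness of the Koszul complex\<close>

context connected_graded_algebra
begin

abbreviation reg :: "('s, 's) gmod" where
  "reg \<equiv> regular_module gr"

lemma reg_simps [simp]: "Car reg = UNIV" "Act reg = (*)" "Deg reg j = gri j"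
  by (auto simp: regular_module_def gri_def)

lemma reg_left_module: "left_module reg"
  by (auto simp: left_module_def add_subgroup_def algebra_simps)

lemma cocycles_reg_add:
  assumes "f \<in> cocycles P d reg i j" "g \<in> cocycles P d reg i j"
  shows "f + g \<in> cocycles P d reg i j"
  using assms by (auto simp: cocycles_def graded_Hom_def module_hom_on_def image_subset_iff gri_add algebra_simps)

lemma cocycles_reg_mult:
  assumes "f \<in> cocycles P d reg i j" "s \<in> gr k"
  shows "(\<lambda>x. f x * s) \<in> cocycles P d reg i (j + int k)"
  using assms gri_mult_right [OF _ assms(2)]
  by (auto simp: cocycles_def graded_Hom_def module_hom_on_def image_subset_iff distrib_right mult.assoc add.assoc [symmetric])

lemma cocycles_reg_0:
  assumes "left_module (P i)"
  shows "(\<lambda>x. 0) \<in> cocycles P d reg i j"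
  by (auto simp: cocycles_def graded_Hom_def module_hom_on_def)

end

section \<open>Cycles of the Koszul complex in low degrees\<close>

context word_presentation
begin

lemma strict_mono_kd: "strict_mono kd"
  unfolding strict_mono_Suc_iff kd_Suc using ks_bounds by auto

lemma Kcycles_subset: "Kcycles i \<subseteq> SW (kd i)"
  using top_cycles_subset [of KC Kd Ke i] by (simp add: KC_def)

text \<open>As \<open>c \<le> ks i < m\<close>, the coefficients lie in degrees where
  \<open>S\<close> agrees with the tensor algebra. The cycle condition then says that prefixes of
  length \<open>c + ks k\<close> multiply out to 0.\<close>

lemma Kcycles_coordinates:
  assumes g: "g \<in> pieces (KD i) (Kcycles i) (c + kd i)" and c: "c \<le> ks i"
  obtains x where "\<And>v. v \<notin> words n (c + kd i) \<Longrightarrow> x v = 0" "\<And>p. length p = c \<Longrightarrow> (\<lambda>u. x (p @ u)) \<in> W (kd i)"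
    "\<And>u. g (list_encode u) = (\<Sum>p\<in>words n c. scale (x (p @ u)) (bw p))"
    "\<And>k u. i = Suc k \<Longrightarrow> (\<Sum>r\<in>words n (c + ks k). scale (x (r @ u)) (bw r)) = 0"
proof -
  have "c < m" using c ks_bounds(2) [of i] by simp
  moreover have "g \<in> SW (kd i)" "g \<in> gdeg (\<lambda>_. kd i) (int (c + kd i))"
    using g Kcycles_subset by (auto simp: pieces_def KD_def)
  ultimately obtain x where x: "\<forall>v. v \<notin> words n (c + kd i) \<longrightarrow> x v = 0" "\<forall>p. length p = c \<longrightarrow> (\<lambda>u. x (p @ u)) \<in> W (kd i)"
    "\<forall>u. g (list_encode u) = (\<Sum>p\<in>words n c. scale (x (p @ u)) (bw p))"
    using SW_coordinates by blast
  have "(\<Sum>r\<in>words n (c + ks k). scale (x (r @ u)) (bw r)) = 0" if "i = Suc k" for k u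
  proof -
    have "dK (ks k) g = 0"
      using g that by (simp add: pieces_def top_cycles_def Kd_def)
    then show ?thesis
      using dK_coordinates [where g = g and c = c and x = x and k = "ks k" and u = u] x(3) by simp
  qed
  then show thesis using that x by blast
qed

text \<open>With \<open>c < ks i\<close> the prefixes in the cycle condition have length
  \<open>c + ks (i - 1) < m\<close>, so independence of words forces the coordinates to vanish. For
  \<open>i = 0\<close> only degree 0 remains, where the augmentation is injective.\<close>

lemma Kcycles_low:
  assumes k: "k < kd (Suc i)"
  shows "pieces (KD i) (Kcycles i) k \<subseteq> {0}"
proof
  fix g assume g: "g \<in> pieces (KD i) (Kcycles i) k"
  show "g \<in> {0}"
  proof (cases "k < kd i")
    case True
    then have "g q = 0" for q
      using g by (auto simp: pieces_def gdeg_def KD_def gri_def)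
    then show ?thesis by auto
  next
    case False
    then obtain c where kc: "k = c + kd i"
      by (metis add.commute le_add_diff_inverse not_less)
    then have c: "c < ks i"
      using k by (simp add: kd_Suc)
    from g obtain x where x: "\<And>v. v \<notin> words n (c + kd i) \<Longrightarrow> x v = 0"
      "\<And>u. g (list_encode u) = (\<Sum>p\<in>words n c. scale (x (p @ u)) (bw p))"
      "\<And>k u. i = Suc k \<Longrightarrow> (\<Sum>r\<in>words n (c + ks k). scale (x (r @ u)) (bw r)) = 0"
      unfolding kc by (rule Kcycles_coordinates) (use c in auto)
    have "x v = 0" for v
    proof (cases i)
      case 0
      then have "c = 0" using c by (simp add: ks_def)
      then have "Ke g = x []"
        using x(2) [of "[]"] by (simp add: Ke_def \<epsilon>_scale)
      then have "x [] = 0"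
        using g 0 by (simp add: pieces_def top_cycles_def)
      then show ?thesis
        using x(1) [of v] 0 \<open>c = 0\<close> by (cases "v = []") auto
    next
      case (Suc k')
      have less: "c + ks k' < m"
        using c ks_Suc [of k'] Suc by simp
      show ?thesis
      proof (cases "v \<in> words n (c + kd i)")
        case True
        let ?r = "take (c + ks k') v" and ?u = "drop (c + ks k') v"
        have "?r @ ?u \<in> words n ((c + ks k') + kd k')"
          using True by (simp add: Suc kd_Suc add.assoc)
        moreover have "length ?r = c + ks k'"
          using words_length [OF True] by (simp add: Suc kd_Suc)
        ultimately have "?r \<in> words n (c + ks k')"
          using append_words by blast
        then have "x (?r @ ?u) = 0"
          using words_indep [OF less, of "\<lambda>r. x (r @ ?u)" ?r] x(3) [OF Suc, of ?u] unfolding bw_def by blast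
        then show ?thesis by simp
      qed (rule x(1))
    qed
    then have "g (list_encode u) = 0" for u
      using x(2) by simp
    then have "g q = 0" for q
      by (metis list_decode_inverse)
    then show ?thesis by auto
  qed
qed

text \<open>In this degree a cycle is a tensor whose windows starting at position
  \<open>ks i\<close> or later are relations, because its slices lie in \<open>W (kd i)\<close>, and
  whose leftmost window is one by the cycle condition. This settles \<open>ks i = 1\<close>. For
  \<open>ks i = m - 1\<close> the windows in between follow from the extra condition, hence from
  exactness at term 2.\<close>

lemma Kcycles_degree_Suc:
  assumes ex2: "3 \<le> i \<Longrightarrow> Kcycles 2 = Kd 2 ` KC (Suc 2)"
  shows "pieces (KD i) (Kcycles i) (kd (Suc i)) \<subseteq> (\<lambda>x. Kd i (emb x)) ` W (kd (Suc i))"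
proof
  let ?c = "ks i"
  fix g assume g: "g \<in> pieces (KD i) (Kcycles i) (kd (Suc i))"
  then obtain x where x: "\<And>v. v \<notin> words n (?c + kd i) \<Longrightarrow> x v = 0" "\<And>p. length p = ?c \<Longrightarrow> (\<lambda>u. x (p @ u)) \<in> W (kd i)"
    "\<And>u. g (list_encode u) = (\<Sum>p\<in>words n ?c. scale (x (p @ u)) (bw p))"
    "\<And>k u. i = Suc k \<Longrightarrow> (\<Sum>r\<in>words n (?c + ks k). scale (x (r @ u)) (bw r)) = 0"
    unfolding kd_Suc by (rule Kcycles_coordinates) auto
  have right: "(\<Sum>r\<in>words n m. scale (x (p @ r @ q)) (bw r)) = 0"
    if p: "?c \<le> length p" and pq: "length p + m + length q = ?c + kd i" for p q
  proof -
    have "(\<lambda>u. x (take ?c p @ u)) \<in> W (kd i)"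
      using p by (intro x(2)) simp
    moreover have "length (drop ?c p) + m + length q = kd i"
      using p pq by simp
    ultimately have "(\<Sum>r\<in>words n m. scale (x (take ?c p @ drop ?c p @ r @ q)) (bw r)) = 0"
      by (rule W_rel)
    then show ?thesis
      by (simp only: append_assoc [symmetric] append_take_drop_id)
  qed
  have left: "(\<Sum>r\<in>words n m. scale (x (r @ u)) (bw r)) = 0" if "0 < i" for u
  proof -
    obtain k where "i = Suc k" using \<open>0 < i\<close> gr0_implies_Suc by blast
    then show ?thesis using x(4) [of k u] ks_Suc [of k] by simp
  qed
  have "x \<in> W (?c + kd i)"
    unfolding W_def
  proof (intro CollectI conjI allI impI x(1))
    fix p q :: "nat list" assume pq: "length p + m + length q = ?c + kd i"
    show "(\<Sum>r\<in>words n m. scale (x (p @ r @ q)) (bw r)) = 0"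
    proof (cases "?c \<le> length p \<or> p = []")
      case True
      show ?thesis
      proof (cases "?c \<le> length p")
        case False
        then have "p = []" using True by simp
        moreover have "i \<noteq> 0"
          using pq m2 by (intro notI) (simp add: ks_def)
        ultimately show ?thesis using left by simp
      qed (rule right [OF _ pq])
    next
      case False
      then have lp: "0 < length p" "length p < ?c" by auto
      then have odd: "odd i" and cm: "?c = m - 1"
        by (auto simp: ks_def split: if_splits)
      \<comment> \<open>For \<open>i = 1\<close> the tensor has length \<open>m\<close>, and its
        only window is the leftmost one.\<close>
      have "i \<noteq> 1"
        using pq lp cm by (intro notI) simp
      then have i3: "3 \<le> i"
        using odd by presburger
      then have "1 \<le> i div 2" by simp
      then have "m \<le> i div 2 * m"
        by simp
      then have kd: "m + 1 \<le> kd i"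
        using odd by (simp add: kd_def)
      \<comment> \<open>Descending induction on the starting position \<open>t\<close>, from
        \<open>m - 1\<close> down: the window at \<open>t\<close> follows from those at 0 and
        \<open>t + 1\<close>.\<close>
      have "\<forall>p q. length p = t \<longrightarrow> length p + m + length q = ?c + kd i \<longrightarrow>
          (\<Sum>r\<in>words n m. scale (x (p @ r @ q)) (bw r)) = 0" if "0 < t" "t \<le> ?c" for t
        using that(2,1)
      proof (induction t rule: inc_induct)
        case base
        then show ?case using right by simp
      next
        case (step t)
        show ?case
        proof (intro allI impI)
          fix p q :: "nat list" assume p: "length p = t" and pq: "length p + m + length q = ?c + kd i"
          then have "q \<noteq> []"
            using kd step.hyps by auto
          then obtain a q2 where q: "q = [a] @ q2"
            by (cases q) auto
          have IH: "(\<Sum>r\<in>words n m. scale (x (p @ r @ q)) (bw r)) = 0"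
            if "length p = Suc t" "length p + m + length q = ?c + kd i" for p q
            using step.IH that by blast
          \<comment> \<open>The extra condition is applied with \<open>s = t + 1\<close> to the
            first \<open>t + 1 + m\<close> letters, the tail \<open>q2\<close> being held fixed;
            \<open>a\<close> is the letter just after the window at \<open>t\<close>.\<close>
          have "(\<Sum>r\<in>words n m. scale (x ((p @ r @ [a]) @ q2)) (bw r)) = 0"
          proof (rule extra_condition [of "Suc t" "\<lambda>v. x (v @ q2)" p "[a]"])
            show "Kcycles 2 = Kd 2 ` KC (Suc 2)" by (rule ex2 [OF i3])
            show "Suc t < m" using step.hyps cm by simp
            show "x (v @ q2) = 0" if "v \<notin> words n (Suc t + m)" for v
            proof (rule x(1))
              have l: "?c + kd i = (Suc t + m) + length q2"
                using pq p q by simp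
              show "v @ q2 \<notin> words n (?c + kd i)"
                unfolding l using that append_words [of v "Suc t + m" q2 n "length q2"] by (auto simp: words_def)
            qed
            show "(\<Sum>r\<in>words n m. scale (x ((r @ q') @ q2)) (bw r)) = 0" if "length q' = Suc t" for q'
              using left [of "q' @ q2"] i3 by simp
            show "(\<Sum>r\<in>words n m. scale (x ((p' @ r) @ q2)) (bw r)) = 0" if "length p' = Suc t" for p'
              using IH [OF that, of q2] pq p q that by simp
          qed (use p in auto)
          then show "(\<Sum>r\<in>words n m. scale (x (p @ r @ q)) (bw r)) = 0"
            by (simp add: q)
        qed
      qed
      from this [OF lp(1), rule_format, of p q] lp(2) pq show ?thesis by simp
    qed
  qed
  moreover have "g = Kd i (emb x)"
  proof
    fix q
    show "g q = Kd i (emb x) q"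
      using dK_emb [of ?c x "list_decode q"] x(3) [of "list_decode q"] by (simp add: Kd_def)
  qed
  ultimately show "g \<in> (\<lambda>x. Kd i (emb x)) ` W (kd (Suc i))"
    by (simp add: kd_Suc)
qed

lemma KC_hom_zero:
  assumes t: "module_hom_on (gm \<delta> (KC i)) reg t" and z: "\<And>e. e \<in> W (kd i) \<Longrightarrow> t (emb e) = 0" and g: "g \<in> KC i"
  shows "t g = 0"
proof -
  obtain E lam where "SW_frame (kd i) E lam"
    using SW_frame_exists by blast
  note E = SW_frameD [OF this]
  have gS: "g \<in> SW (kd i)" using g by (simp add: KC_def)
  have C: "left_module (gm \<delta> (KC i))"
    using gsub_left_module [OF KC_gsub] by (simp add: left_module_def)
  have emb: "emb e \<in> KC i" if "e \<in> E" for e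
    using E(2) emb_SW that by (auto simp: KC_def)
  have "t g = t (\<Sum>e\<in>E. uact (lam e g) (emb e))"
    using E(3) [OF gS] by (rule arg_cong)
  also have "\<dots> = (\<Sum>e\<in>E. t (uact (lam e g) (emb e)))"
    using gsub_act [OF KC_gsub emb] by (intro module_hom_on_sum [OF t C]) simp
  also have "\<dots> = (\<Sum>e\<in>E. lam e g * t (emb e))"
    using module_hom_on_act [OF t] emb by (intro sum.cong) auto
  also have "\<dots> = 0"
    using z E(2) by (intro sum.neutral) auto
  finally show ?thesis .
qed

text \<open>Cycles start in degree \<open>kd (i + 1) > kd i\<close>, so their coordinates in a frame
  have augmentation 0, and a homomorphism to \<open>k\<close> sees coordinates only through the
  augmentation.\<close>

lemma Kcycles_minimal:
  assumes t: "module_hom_on (gm (KD i) (KC i)) triv t" and z: "z \<in> Kcycles i"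
    and gs: "gsub (KD i) (Kcycles i)"
  shows "t z = 0"
proof -
  obtain E lam where "SW_frame (kd i) E lam"
    using SW_frame_exists by blast
  note E = SW_frameD [OF this]
  have "kd i < kd (Suc i)"
    using strict_mono_kd by (simp add: strict_mono_def)
  then have "ucomp (KD i) (int (kd i)) z = 0"
    using Kcycles_low gsub_ucomp_pieces [OF gs z] by blast
  then have "ci 0 (z q) = 0" for q
    using ucomp_apply [of "KD i" "int (kd i)" z q] by (simp add: KD_def)
  then have "\<epsilon> (z q) = 0" for q
    by (simp add: ci_0_eq)
  then have \<epsilon>: "\<epsilon> (lam e z) = 0" for e
    using E(6) by blast
  have zS: "z \<in> SW (kd i)" using z Kcycles_subset by blast
  have emb: "emb e \<in> KC i" if "e \<in> E" for e
    using E(2) emb_SW that by (auto simp: KC_def)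
  have "t z = t (\<Sum>e\<in>E. uact (lam e z) (emb e))"
    using E(3) [OF zS] by (rule arg_cong)
  also have "\<dots> = (\<Sum>e\<in>E. t (uact (lam e z) (emb e)))"
    using gsub_act [OF KC_gsub emb] by (intro module_hom_on_sum [OF t gsub_left_module [OF KC_gsub]]) simp
  also have "\<dots> = (\<Sum>e\<in>E. \<epsilon> (lam e z) * t (emb e))"
    using module_hom_on_act [OF t] emb by (intro sum.cong) auto
  also have "\<dots> = 0"
    by (simp add: \<epsilon>)
  finally show ?thesis .
qed

text \<open>The hypothesis on \<open>W l\<close> makes \<open>W (kd (i + 1))\<close> nonzero
  throughout the range. Its image is therefore a nonzero lowest component of the kernel, and
  concentration of Ext in one degree turns this into generation by that component.\<close>

theorem Koszul_exact:
  assumes conc: "\<And>i. \<exists>n. \<forall>j. j \<noteq> n \<longrightarrow> Ext_vanishes gr triv triv i j" and l: "W l \<noteq> {0}"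
  shows "kd (Suc i) \<le> l \<Longrightarrow> Kcycles i = Kd i ` KC (Suc i)"
proof (induction i rule: less_induct)
  case (less i)
  have ex: "Kcycles k = Kd k ` KC (Suc k)" if "k < i" for k
  proof (rule less.IH [OF that])
    have "kd (Suc k) < kd (Suc i)"
      using strict_mono_kd that by (simp add: strict_mono_def)
    then show "kd (Suc k) \<le> l" using less.prems by simp
  qed
  have R: "partial_resolution i KD KC Kd Ke"
    by (rule Koszul_partial_resolution) (rule ex)
  note gs = top_cycles_gsub [OF R]
  let ?D = "Kd i ` KC (Suc i)"
  have "Kcycles i \<subseteq> ?D"
  proof (rule kernel_generated [OF R _ conc])
    show "t z = 0" if "module_hom_on (gm (KD i) (KC i)) triv t" "z \<in> Kcycles i" for t z
      using Kcycles_minimal that gs by blast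
    show "pieces (KD i) (Kcycles i) k \<subseteq> {0}" if "k < kd (Suc i)" for k
      by (rule Kcycles_low [OF that])
    have "W (kd (Suc i)) \<noteq> {0}"
      using W_nonzero_mono [of "l - kd (Suc i)" "kd (Suc i)"] less.prems l by simp
    then obtain x where x: "x \<in> W (kd (Suc i))" "x \<noteq> 0"
      using wf.subspace_0 [OF W_subspace] by blast
    then have "Kd i (emb x) \<noteq> 0"
      unfolding Kd_def kd_Suc by (intro dK_emb_nonzero [OF ks_bounds(2)])
    moreover have "Kd i (emb x) \<in> pieces (KD i) (Kcycles i) (kd (Suc i))"
      using Kd_cycle [of "emb x" i] Kd_gdeg [of "emb x" i "int (kd (Suc i))"] emb_SW [OF x(1)] emb_gdeg [of x "kd (Suc i)"]
      by (simp add: pieces_def KC_def KD_def)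
    ultimately show "\<not> pieces (KD i) (Kcycles i) (kd (Suc i)) \<subseteq> {0}"
      by blast
    show "uv.subspace ?D"
      unfolding uv.subspace_def
    proof (intro conjI ballI allI)
      show "0 \<in> ?D"
        using module_hom_on_0 [OF Kd_hom gsub_left_module [OF KC_gsub]] gsub_0 [OF KC_gsub] by (metis image_eqI)
      fix x assume "x \<in> ?D"
      then obtain x' where x': "x = Kd i x'" "x' \<in> KC (Suc i)" by blast
      show "x + y \<in> ?D" if y: "y \<in> ?D" for y
      proof -
        obtain y' where y': "y = Kd i y'" "y' \<in> KC (Suc i)" using y by blast
        have "x + y = Kd i (x' + y')"
          using module_hom_on_add [OF Kd_hom] x' y' by simp
        then show ?thesis
          using gsub_add [OF KC_gsub x'(2) y'(2)] by blast
      qed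
      show "usc c x \<in> ?D" for c
      proof -
        have "usc c x = Kd i (uact (scale c 1) x')"
          using module_hom_on_act [OF Kd_hom] x' by (simp add: usc_eq_uact)
        then show ?thesis
          using gsub_act [OF KC_gsub x'(2)] by blast
      qed
    qed
    show "uact a x \<in> ?D" if x: "x \<in> ?D" for a x
    proof -
      obtain x' where x': "x = Kd i x'" "x' \<in> KC (Suc i)" using x by blast
      have "uact a x = Kd i (uact a x')"
        using module_hom_on_act [OF Kd_hom] x' by simp
      then show ?thesis
        using gsub_act [OF KC_gsub x'(2)] by blast
    qed
    \<comment> \<open>Exactness at term 2 is asked for only when \<open>i \<ge> 3\<close>, where the
      induction hypothesis provides it.\<close>
    have "pieces (KD i) (Kcycles i) (kd (Suc i)) \<subseteq> (\<lambda>x. Kd i (emb x)) ` W (kd (Suc i))"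
      by (rule Kcycles_degree_Suc) (rule ex, simp)
    then show "pieces (KD i) (Kcycles i) (kd (Suc i)) \<subseteq> ?D"
      using emb_SW by (auto simp: KC_def)
  qed
  then show ?case
    using Kd_cycle by blast
qed

section \<open>Consequences of the Gorenstein condition\<close>

text \<open>By contradiction: if the functional \<open>\<rho>\<close> kills all slices of
  \<open>W (kd (i + 2))\<close>, its \<open>S\<close>-linear extension is a cocycle, hence a
  coboundary, and every coboundary of this degree is zero; but the value at
  \<open>1 \<otimes> x\<close> is not.\<close>

lemma ladder_step:
  assumes R: "partial_resolution (Suc (Suc i)) KD KC Kd Ke"
    and ext: "Ext_vanishes gr triv reg (Suc i) (- int (kd (Suc i)))"
    and x: "x \<in> W (kd (Suc i))" "(\<Sum>u\<in>words n (kd (Suc i)). \<rho> u * x u) \<noteq> 0"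
  shows "\<exists>y\<in>W (kd (Suc (Suc i))). \<exists>p. length p = ks (Suc i) \<and> (\<Sum>u\<in>words n (kd (Suc i)). \<rho> u * y (p @ u)) \<noteq> 0"
proof (rule ccontr)
  assume "\<not> ?thesis"
  then have no: "(\<Sum>u\<in>words n (kd (Suc i)). \<rho> u * y (p @ u)) = 0"
    if "y \<in> W (kd (Suc (Suc i)))" "length p = ks (Suc i)" for y p
    using that by blast
  let ?i = "Suc i"
  let ?P = "res_P (Suc ?i) KD KC Kd Ke" and ?d = "res_d (Suc ?i) KD KC Kd Ke"
  have P: "?P k = gm (KD k) (KC k)" if "k \<le> Suc ?i" for k
    using that by (rule res_P_le)
  have d: "?d k = Kd k" if "k \<le> ?i" for k
    using that by (intro res_d_less) simp
  define F where "F = (\<lambda>g. \<Sum>u\<in>words n (kd ?i). scale (\<rho> u) (g (list_encode u)))"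
  define f where "f = (\<lambda>g. if g \<in> KC ?i then F g else 0)"
  have "f \<in> graded_Hom (?P ?i) reg (- int (kd ?i))"
    unfolding graded_Hom_def
  proof (intro CollectI conjI allI impI)
    show "module_hom_on (?P ?i) reg f"
      using gsub_add [OF KC_gsub] gsub_act [OF KC_gsub]
      by (simp add: P module_hom_on_def f_def F_def scale_right_distrib sum.distrib sum_distrib_left scale_mult_right)
    show "f ` Deg (?P ?i) k \<subseteq> Deg reg (k + - int (kd ?i))" for k
      by (auto simp: P f_def F_def KD_def gdeg_def intro!: gri_sum gri_scale)
    show "f g = 0" if "g \<notin> Car (?P ?i)" for g
      using that by (simp add: P f_def)
  qed
  moreover have "f (?d ?i h) = 0" if "h \<in> Car (?P (Suc ?i))" for h
  proof -
    have h: "h \<in> KC (Suc ?i)" using that by (simp add: P)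
    \<comment> \<open>The slices of \<open>h\<close> have values in \<open>S\<close>; after a
      functional on \<open>S\<close> they become slices of an element of \<open>W\<close>, to which
      \<open>no\<close> applies.\<close>
    have inner: "(\<Sum>u\<in>words n (kd ?i). scale (\<rho> u) (h (list_encode (p @ u)))) = 0" if p: "p \<in> words n (ks ?i)" for p
    proof (rule linear_functional_eqI)
      fix \<phi> assume \<phi>: "Vector_Spaces.linear scale (*) \<phi>"
      have "(\<lambda>u. \<phi> (h (list_encode u))) \<in> W (kd (Suc ?i))"
        using SW_D [OF _ \<phi>] h by (simp add: KC_def)
      from no [OF this words_length [OF p]] show "\<phi> (\<Sum>u\<in>words n (kd ?i). scale (\<rho> u) (h (list_encode (p @ u)))) = \<phi> 0"
        by (simp add: linear_scale_sum [OF \<phi>] linear_scale_scale [OF \<phi>] linear_scale_0 [OF \<phi>])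
    qed
    have "F (Kd ?i h) = (\<Sum>u\<in>words n (kd ?i). \<Sum>p\<in>words n (ks ?i). scale (\<rho> u) (h (list_encode (p @ u))) * bw p)"
      by (simp add: F_def Kd_def dK_apply scale_sum_right scale_mult_left)
    also have "\<dots> = (\<Sum>p\<in>words n (ks ?i). (\<Sum>u\<in>words n (kd ?i). scale (\<rho> u) (h (list_encode (p @ u)))) * bw p)"
      by (subst sum.swap) (simp add: sum_distrib_right)
    also have "\<dots> = 0"
      using inner by simp
    finally show ?thesis
      by (simp add: d f_def)
  qed
  ultimately have "f \<in> cocycles ?P ?d reg ?i (- int (kd ?i))"
    by (simp add: cocycles_def)
  then have "f \<in> coboundaries ?P ?d reg ?i (- int (kd ?i))"
    using ext graded_resolution_extend [OF R] unfolding Ext_vanishes_def by blast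
  then obtain t where t: "t \<in> graded_Hom (?P i) reg (- int (kd ?i))" "f = (\<lambda>x. if x \<in> Car (?P ?i) then t (?d i x) else 0)"
    by (auto simp: coboundaries_def)
  have th: "module_hom_on (gm (KD i) (KC i)) reg t"
    using t by (simp add: graded_Hom_def P)
  \<comment> \<open>A cochain of degree \<open>- kd (i + 1)\<close> sends the generators of term
    \<open>i\<close>, which have degree \<open>kd i\<close>, into negative degrees.\<close>
  have t0: "t g = 0" if "g \<in> KC i" for g
  proof (rule KC_hom_zero [OF th _ that])
    fix e assume e: "e \<in> W (kd i)"
    then have "emb e \<in> Deg (?P i) (int (kd i))"
      using emb_SW emb_gdeg by (simp add: P KC_def KD_def)
    then have "t (emb e) \<in> gri (int (kd i) + - int (kd ?i))"
      using t(1) unfolding graded_Hom_def by auto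
    moreover have "kd i < kd ?i"
      using strict_mono_kd by (simp add: strict_mono_def)
    ultimately show "t (emb e) = 0"
      by (simp add: gri_def)
  qed
  have ex: "emb x \<in> KC ?i"
    using emb_SW [OF x(1)] by (simp add: KC_def)
  then have "Kd i (emb x) \<in> KC i"
    using module_hom_on_closed [OF Kd_hom, of "emb x" i] by simp
  then have "f (emb x) = 0"
    using t(2) t0 ex by (simp add: P d)
  moreover have "f (emb x) = scale (\<Sum>u\<in>words n (kd ?i). \<rho> u * x u) 1"
    using ex by (simp add: f_def F_def scale_sum_left)
  ultimately show False
    using x(2) by simp
qed

text \<open>Each step puts a new block of letters in front of the slicing word \<open>p\<close>; the
  functional passed on is evaluation of \<open>\<rho>\<close> on the slice along
  \<open>p\<close>.\<close>

lemma ladder: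
  assumes R: "\<And>i. kd i \<le> l \<Longrightarrow> partial_resolution i KD KC Kd Ke"
    and ext: "\<And>i j. j \<noteq> - int l \<Longrightarrow> Ext_vanishes gr triv reg i j"
    and x: "x \<in> W m" "(\<Sum>u\<in>words n m. \<rho> u * x u) \<noteq> 0"
  shows "2 \<le> i \<Longrightarrow> kd i \<le> l \<Longrightarrow> \<exists>p y. length p + m = kd i \<and> y \<in> W (kd i) \<and> (\<Sum>u\<in>words n m. \<rho> u * y (p @ u)) \<noteq> 0"
proof (induction i rule: dec_induct)
  case base
  then show ?case using x by (intro exI [of _ "[]"] exI [of _ x]) simp
next
  case (step i)
  obtain k where k: "i = Suc k" using step.hyps by (metis Suc_le_D numeral_2_eq_2)
  have less: "kd i < kd (Suc i)"
    using strict_mono_kd by (simp add: strict_mono_def)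
  then obtain p y where p: "length p + m = kd i" and y: "y \<in> W (kd i)" "(\<Sum>u\<in>words n m. \<rho> u * y (p @ u)) \<noteq> 0"
    using step by auto
  have pw: "p \<in> words n (length p)"
  proof (rule ccontr)
    assume "p \<notin> words n (length p)"
    then have "y (p @ u) = 0" for u
      using append_words [of p "length p" u n m] p by (intro W_support [OF y(1)]) auto
    then show False using y(2) by simp
  qed
  \<comment> \<open>The functional \<open>y \<mapsto> \<Sum>\<^sub>u \<rho> u * y (p @ u)\<close>,
    written by its coefficients on words of length \<open>kd i\<close>.\<close>
  define \<rho>' where "\<rho>' = (\<lambda>v. if take (length p) v = p then \<rho> (drop (length p) v) else 0)"
  have \<rho>': "(\<Sum>v\<in>words n (kd i). \<rho>' v * F v) = (\<Sum>u\<in>words n m. \<rho> u * F (p @ u))" for F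
  proof -
    have "(\<Sum>v\<in>words n (kd i). \<rho>' v * F v) = (\<Sum>r\<in>words n (length p). \<Sum>u\<in>words n m. \<rho>' (r @ u) * F (r @ u))"
      unfolding p [symmetric] sum_words_add ..
    also have "\<dots> = (\<Sum>r\<in>words n (length p). if r = p then (\<Sum>u\<in>words n m. \<rho> u * F (p @ u)) else 0)"
      by (intro sum.cong) (auto simp: \<rho>'_def words_length)
    also have "\<dots> = (\<Sum>u\<in>words n m. \<rho> u * F (p @ u))"
      using pw by simp
    finally show ?thesis .
  qed
  have "\<exists>y\<in>W (kd (Suc i)). \<exists>r. length r = ks i \<and> (\<Sum>u\<in>words n (kd i). \<rho>' u * y (r @ u)) \<noteq> 0"
    unfolding k
  proof (rule ladder_step)
    show "partial_resolution (Suc (Suc k)) KD KC Kd Ke"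
      using R step.prems k by blast
    show "Ext_vanishes gr triv reg (Suc k) (- int (kd (Suc k)))"
      using less step.prems k by (intro ext) simp
    show "y \<in> W (kd (Suc k))" using y k by simp
    show "(\<Sum>u\<in>words n (kd (Suc k)). \<rho>' u * y u) \<noteq> 0"
      using \<rho>' [of y] y(2) k by simp
  qed
  then obtain y' r where y': "y' \<in> W (kd (Suc i))" "length r = ks i" "(\<Sum>u\<in>words n m. \<rho> u * y' (r @ p @ u)) \<noteq> 0"
    using \<rho>' by auto
  then show ?case
    using p kd_Suc [of i] by (intro exI [of _ "r @ p"] exI [of _ y']) simp
qed

end

section \<open>The Gorenstein condition and a copy of \<open>k\<close> in the ambient group\<close>

lemma projective_resolution_iso:
  assumes P: "projective_resolution P d e M" and M: "left_module M"
    and \<iota>: "module_hom_on M M' \<iota>" "inj_on \<iota> (Car M)" "\<iota> ` Car M = Car M'"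
  shows "projective_resolution P d (\<lambda>x. \<iota> (e x)) M'"
proof -
  note P' = projective_resolutionD [OF P]
  have "\<iota> y = 0 \<longleftrightarrow> y = 0" if "y \<in> Car M" for y
    using module_hom_on_0 [OF \<iota>(1) M] left_module_0 [OF M] \<iota>(2) that by (metis inj_onD)
  then have "{x \<in> Car (P 0). \<iota> (e x) = 0} = {x \<in> Car (P 0). e x = 0}"
    using module_hom_on_closed [OF P'(4)] by blast
  moreover have "(\<lambda>x. \<iota> (e x)) ` Car (P 0) = Car M'"
    using P'(5) \<iota>(3) by (metis image_image)
  ultimately show ?thesis
    using P module_hom_on_compose [OF P'(4) \<iota>(1)] unfolding projective_resolution_def by simp
qed

context connected_graded_algebra
begin

lemma Deg_shift_triv [simp]: "Deg (graded_shift l triv) j = (if l + j = 0 then UNIV else {0})"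
  by (simp add: graded_shift_def)

lemma AS_regular_theta:
  assumes "AS_regular scale gr d l" and "graded_projective_resolution gr P dd e triv"
  obtains \<theta> :: "int \<Rightarrow> ('s univ \<Rightarrow> 's) \<Rightarrow> 'k" where
    "\<And>j y z. y \<in> cocycles P dd reg d j \<Longrightarrow> z \<in> cocycles P dd reg d j \<Longrightarrow> \<theta> j (y + z) = \<theta> j y + \<theta> j z"
    "\<And>j. \<theta> j ` cocycles P dd reg d j = (if l + j = 0 then UNIV else {0})"
    "\<And>j. {z \<in> cocycles P dd reg d j. \<theta> j z = 0} = coboundaries P dd reg d j"
    "\<And>j n s z. s \<in> gr n \<Longrightarrow> z \<in> cocycles P dd reg d j \<Longrightarrow> \<theta> (j + int n) (\<lambda>x. z x * s) = \<theta> j z * \<epsilon> s"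
proof -
  have "\<exists>\<theta> :: int \<Rightarrow> ('s univ \<Rightarrow> 's) \<Rightarrow> 'k. \<forall>j.
      (\<forall>y\<in>cocycles P dd reg d j. \<forall>z\<in>cocycles P dd reg d j. \<theta> j (y + z) = \<theta> j y + \<theta> j z) \<and>
      \<theta> j ` cocycles P dd reg d j = Deg (graded_shift l triv) j \<and>
      {z \<in> cocycles P dd reg d j. \<theta> j z = 0} = coboundaries P dd reg d j \<and>
      (\<forall>n. \<forall>s\<in>gr n. \<forall>z\<in>cocycles P dd reg d j. \<theta> (j + int n) (\<lambda>x. z x * s) = \<theta> j z * augmentation scale gr s)"
    using assms unfolding AS_regular_def Ext_regular_iso_trivial_shift_def Let_def by blast
  then obtain \<theta> :: "int \<Rightarrow> ('s univ \<Rightarrow> 's) \<Rightarrow> 'k" where \<theta>: "\<forall>j.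
      (\<forall>y\<in>cocycles P dd reg d j. \<forall>z\<in>cocycles P dd reg d j. \<theta> j (y + z) = \<theta> j y + \<theta> j z) \<and>
      \<theta> j ` cocycles P dd reg d j = Deg (graded_shift l triv) j \<and>
      {z \<in> cocycles P dd reg d j. \<theta> j z = 0} = coboundaries P dd reg d j \<and>
      (\<forall>n. \<forall>s\<in>gr n. \<forall>z\<in>cocycles P dd reg d j. \<theta> (j + int n) (\<lambda>x. z x * s) = \<theta> j z * augmentation scale gr s)"
    by blast
  show thesis
  proof (rule that [of \<theta>])
    show "\<theta> j ` cocycles P dd reg d j = (if l + j = 0 then UNIV else {0})" for j
      using \<theta> by simp
    show "\<theta> (j + int n) (\<lambda>x. z x * s) = \<theta> j z * \<epsilon> s" if "s \<in> gr n" "z \<in> cocycles P dd reg d j" for j n s z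
      using \<theta> that by (simp add: augmentation_eq)
  qed (use \<theta> in auto)
qed

text \<open>For \<open>i = d\<close> the target \<open>k(l)\<close> is zero in degree
  \<open>j\<close>, so every cocycle lies in the kernel of \<open>\<theta> j\<close>, which consists
  of the coboundaries.\<close>

lemma AS_regular_Ext_vanishes:
  assumes AS: "AS_regular scale gr d l" and j: "j \<noteq> - l"
  shows "Ext_vanishes gr triv reg i j"
proof (cases "i = d")
  case False
  then show ?thesis
    using AS unfolding AS_regular_def by blast
next
  case True
  show ?thesis
    unfolding Ext_vanishes_def
  proof (intro allI impI)
    fix P dd e assume res: "graded_projective_resolution gr P dd e triv"
    obtain \<theta> :: "int \<Rightarrow> ('s univ \<Rightarrow> 's) \<Rightarrow> 'k" where
      "\<And>j y z. y \<in> cocycles P dd reg d j \<Longrightarrow> z \<in> cocycles P dd reg d j \<Longrightarrow> \<theta> j (y + z) = \<theta> j y + \<theta> j z"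
      and im: "\<And>j. \<theta> j ` cocycles P dd reg d j = (if l + j = 0 then UNIV else {0})"
      and ker: "\<And>j. {z \<in> cocycles P dd reg d j. \<theta> j z = 0} = coboundaries P dd reg d j"
      and "\<And>j n s z. s \<in> gr n \<Longrightarrow> z \<in> cocycles P dd reg d j \<Longrightarrow> \<theta> (j + int n) (\<lambda>x. z x * s) = \<theta> j z * \<epsilon> s"
      by (rule AS_regular_theta [OF AS res]) (rule that, assumption+)
    have "\<theta> j ` cocycles P dd reg d j = {0}"
      using im [of j] j by auto
    then have "{z \<in> cocycles P dd reg d j. \<theta> j z = 0} = cocycles P dd reg d j"
      by blast
    then show "cocycles P dd reg i j = coboundaries P dd reg i j"
      using ker [of j] True by simp
  qed
qed

text \<open>\<open>gldim\<close> speaks only of modules inside \<open>'s univ\<close>, whereas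
  \<open>triv\<close> lives on the type of the field; the copy consists of multiples of 1 at
  position 0.\<close>

definition triv_univ :: "('s, 's univ) lmod" where
  "triv_univ = \<lparr>Car = range (\<lambda>c. usingle 0 (scale c 1)), Act = (\<lambda>a x. usc (\<epsilon> a) x)\<rparr>"

lemma triv_univ_resolution:
  assumes "projective_resolution P dd e triv"
  shows "projective_resolution P dd (\<lambda>x. usingle 0 (scale (e x) 1)) triv_univ"
proof (rule projective_resolution_iso [OF assms triv_left_module])
  show "module_hom_on triv triv_univ (\<lambda>c. usingle 0 (scale c 1))"
    by (auto simp: module_hom_on_def triv_univ_def fun_eq_iff scale_left_distrib)
  show "inj_on (\<lambda>c. usingle 0 (scale c (1::'s))) (Car triv)"
    by (rule inj_onI) (auto dest!: fun_cong [of _ _ 0])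
qed (simp add: triv_univ_def del: usingle_apply)

lemma triv_univ_left_module: "left_module triv_univ"
proof -
  have "add_subgroup (Car triv_univ)"
    unfolding add_subgroup_def triv_univ_def
  proof (clarsimp, intro conjI allI)
    show "0 \<in> range (\<lambda>c. usingle 0 (scale c (1::'s)))"
      by (rule range_eqI [of _ _ 0]) (auto simp: fun_eq_iff)
    show "usingle 0 (scale c (1::'s)) + usingle 0 (scale c' 1) \<in> range (\<lambda>c. usingle 0 (scale c 1))" for c c'
      by (rule range_eqI [of _ _ "c + c'"]) (auto simp: fun_eq_iff scale_left_distrib)
    show "- usingle 0 (scale c (1::'s)) \<in> range (\<lambda>c. usingle 0 (scale c 1))" for c
      by (rule range_eqI [of _ _ "- c"]) (auto simp: fun_eq_iff)
  qed
  moreover have "usc a (usingle 0 (scale c (1::'s))) = usingle 0 (scale (a * c) 1)" for a c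
    by (auto simp: fun_eq_iff)
  ultimately show ?thesis
    unfolding left_module_def
    by (auto simp: triv_univ_def \<epsilon>_add \<epsilon>_mult uv.scale_left_distrib uv.scale_right_distrib)
qed

end

section \<open>The Gorenstein parameter belongs to the Koszul pattern\<close>

context word_presentation
begin

lemma kd_bracket: "\<exists>i. kd i \<le> l \<and> l < kd (Suc i)"
proof -
  have "\<exists>j. l < kd (Suc j)"
    using strict_mono_imp_increasing [OF strict_mono_kd] by (metis less_le_trans lessI)
  then have least: "l < kd (Suc (LEAST j. l < kd (Suc j)))"
    by (rule LeastI_ex)
  have "kd (LEAST j. l < kd (Suc j)) \<le> l"
  proof (cases "LEAST j. l < kd (Suc j)")
    case (Suc j)
    then have "\<not> l < kd (Suc j)"
      using not_less_Least [of j "\<lambda>j. l < kd (Suc j)"] by simp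
    then show ?thesis using Suc by simp
  qed simp
  with least show ?thesis by blast
qed

lemma usingle_SW0: "usingle 0 s \<in> SW 0"
  unfolding SW_def
proof (intro CollectI allI impI)
  fix \<phi> assume \<phi>: "Vector_Spaces.linear scale (*) \<phi>"
  have "list_encode u = 0 \<longleftrightarrow> u = []" for u
    by (cases u) auto
  then show "(\<lambda>u. \<phi> (usingle 0 s (list_encode u))) \<in> W 0"
    using m2 linear_scale_0 [OF \<phi>] by (simp add: W_def)
qed

text \<open>
  If \<open>l\<close> fell strictly between two degrees of the Koszul pattern, a resolution extending the Koszul
  complex would have in degree \<open>d\<close> either only generators of degree below \<open>l\<close>, or only generators
  of degree above \<open>l\<close>.  In the second case every cocycle of degree \<open>-l\<close> takes values in the
  augmentation ideal, and lifting it along \<open>S \<otimes> V \<rightarrow> S\<close> shows that its class is killed by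
  the augmentation.
\<close>

lemma kd_hits_parameter:
  assumes conc: "\<And>i. \<exists>n. \<forall>j. j \<noteq> n \<longrightarrow> Ext_vanishes gr triv triv i j" and Wl: "W l \<noteq> {0}"
    and AS: "AS_regular scale gr d (int l)" and l: "1 \<le> l"
  shows "\<exists>i. kd i = l"
proof (rule ccontr)
  assume no: "\<not> ?thesis"
  obtain i where i: "kd i \<le> l" "l < kd (Suc i)"
    using kd_bracket by blast
  then have il: "kd i < l"
    using no by (metis le_neq_implies_less)
  have i1: "1 \<le> i"
    using i(2) l by (cases i) auto
  have ex: "Kcycles k = Kd k ` KC (Suc k)" if "k < i" for k
  proof (rule Koszul_exact [OF conc Wl])
    have "kd (Suc k) \<le> kd i"
      using strict_mono_kd that by (simp add: strict_mono_less_eq)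
    then show "kd (Suc k) \<le> l" using i by simp
  qed
  have R: "partial_resolution i KD KC Kd Ke"
    by (rule Koszul_partial_resolution) (rule ex)
  let ?P = "res_P i KD KC Kd Ke" and ?d = "res_d i KD KC Kd Ke"
  have res: "graded_projective_resolution gr ?P ?d Ke triv"
    by (rule graded_resolution_extend [OF R])
  then have pres: "projective_resolution ?P ?d Ke triv"
    by (simp add: graded_projective_resolution_def)
  obtain \<theta> :: "int \<Rightarrow> ('s univ \<Rightarrow> 's) \<Rightarrow> 'k" where
    add: "\<And>j y z. y \<in> cocycles ?P ?d reg d j \<Longrightarrow> z \<in> cocycles ?P ?d reg d j \<Longrightarrow> \<theta> j (y + z) = \<theta> j y + \<theta> j z"
    and im: "\<And>j. \<theta> j ` cocycles ?P ?d reg d j = (if int l + j = 0 then UNIV else {0})"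
    and "\<And>j. {z \<in> cocycles ?P ?d reg d j. \<theta> j z = 0} = coboundaries ?P ?d reg d j"
    and right: "\<And>j n s z. s \<in> gr n \<Longrightarrow> z \<in> cocycles ?P ?d reg d j \<Longrightarrow> \<theta> (j + int n) (\<lambda>x. z x * s) = \<theta> j z * \<epsilon> s"
    by (rule AS_regular_theta [OF AS res]) (rule that, assumption+)
  \<comment> \<open>A cocycle \<open>f\<close> with class 1 is chosen; both cases below show that
    its class is 0.\<close>
  have "1 \<in> \<theta> (- int l) ` cocycles ?P ?d reg d (- int l)"
    by (simp add: im)
  then obtain f where "1 = \<theta> (- int l) f" "f \<in> cocycles ?P ?d reg d (- int l)"
    by (rule imageE)
  then have f: "f \<in> cocycles ?P ?d reg d (- int l)" "\<theta> (- int l) f = 1"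
    by simp_all
  have \<theta>0: "\<theta> j (\<lambda>x. 0) = 0" if "(\<lambda>x. 0) \<in> cocycles ?P ?d reg d j" for j
  proof -
    have "(\<lambda>x. 0) + (\<lambda>x. 0) = (\<lambda>x :: 's univ. 0 :: 's)" by auto
    then show ?thesis
      using add [OF that that] by (metis add_cancel_right_right)
  qed
  have fh: "module_hom_on (?P d) reg f" and fd: "\<And>k x. x \<in> Deg (?P d) k \<Longrightarrow> f x \<in> gri (k + - int l)"
    and fout: "\<And>x. x \<notin> Car (?P d) \<Longrightarrow> f x = 0" and fc: "\<And>x. x \<in> Car (?P (Suc d)) \<Longrightarrow> f (?d d x) = 0"
    using f(1) by (auto simp: cocycles_def graded_Hom_def)
  show False
  proof (cases "d \<le> i")
    \<comment> \<open>Here the generators of term \<open>d\<close> have degree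
      \<open>kd d \<le> kd i < l\<close>, so a cochain of degree \<open>-l\<close> sends them into
      negative degrees.\<close>
    case True
    have P: "?P d = gm (KD d) (KC d)"
      by (rule res_P_le [OF True])
    have "f x = 0" if "x \<in> KC d" for x
    proof (rule KC_hom_zero [OF _ _ that])
      show "module_hom_on (gm (KD d) (KC d)) reg f" using fh P by simp
      fix e assume "e \<in> W (kd d)"
      then have "f (emb e) \<in> gri (int (kd d) + - int l)"
        using emb_SW emb_gdeg by (intro fd) (simp add: P KC_def KD_def)
      moreover have "kd d \<le> kd i"
        using True strict_mono_kd by (simp add: strict_mono_less_eq)
      ultimately show "f (emb e) = 0"
        using il by (simp add: gri_def)
    qed
    then have "f = (\<lambda>x. 0)"
      using fout P by (auto simp: fun_eq_iff)
    then show False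
      using \<theta>0 f by simp
  next
    case False
    then obtain c where dc: "d = Suc (i + c)"
      by (metis less_iff_Suc_add not_le)
    define I where "I = syz_idx (KD i) (Kcycles i) c"
    have P: "?P d = gm fdeg (free_on I)"
      by (simp add: res_P_def dc I_def)
    obtain I' where P': "?P (Suc d) = gm fdeg (free_on I')"
      by (simp add: res_P_def dc)
    \<comment> \<open>The kernel at term \<open>i\<close> vanishes in all degrees below
      \<open>kd (i + 1)\<close>, in particular up to \<open>l\<close>, so all generators added
      afterwards have degree above \<open>l\<close>.\<close>
    have fdeg: "l < fdeg q" if "q \<in> I" for q
    proof (rule syz_low [OF top_cycles_gsub [OF R] top_cycles_locfin [OF R]])
      show "pieces (KD i) (Kcycles i) k \<subseteq> {0}" if "k \<le> l" for k
        using that i(2) by (intro Kcycles_low) simp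
      show "q \<in> syz_idx (KD i) (Kcycles i) c" using that by (simp add: I_def)
    qed
    have us: "usingle q 1 \<in> Deg (?P d) (int (fdeg q))" if "q \<in> I" for q
      using usingle_free_on [OF that] one_gr by (auto simp: P gdeg_def gri_def)
    have fu: "f (usingle q 1) \<in> gri (int (fdeg q) + - int l)" if "q \<in> I" for q
      by (rule fd [OF us [OF that]])
    have flc: "f x = lincomb (*) (\<lambda>q. f (usingle q 1)) x" if "x \<in> free_on I" for x
      using hom_eq_lincomb [of fdeg I reg f x] fh that P by simp
    have f\<epsilon>: "\<epsilon> (f x) = 0" if x: "x \<in> free_on I" for x
    proof -
      have "\<epsilon> (f (usingle q 1)) = 0" if "x q \<noteq> 0" for q
      proof -
        have q: "q \<in> I" using x that by (auto simp: free_on_def)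
        then show ?thesis
          using fu [OF q] fdeg [OF q] \<epsilon>_gr [of "f (usingle q 1)" "fdeg q - l"] by (auto simp: gri_def nat_diff_distrib split: if_splits)
      qed
      then show ?thesis
        unfolding flc [OF x] lincomb_def by (simp add: \<epsilon>_sum \<epsilon>_mult)
    qed
    \<comment> \<open>\<open>SW 0\<close> is \<open>S\<close>, placed at the code 0 of the empty
      word. Exactness at term 0 says that \<open>Kd 0\<close> maps onto the augmentation ideal,
      which contains all values of \<open>f\<close>.\<close>
    let ?f = "\<lambda>x. usingle 0 (f x)"
    have f': "module_hom_on (?P d) (gm (KD 0) (KC 0)) ?f"
      using fh usingle_SW0 by (auto simp: module_hom_on_def KC_def fun_eq_iff)
    have im': "?f ` Car (?P d) \<subseteq> Kd 0 ` Car (gm (KD (Suc 0)) (KC (Suc 0)))"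
      using ex [of 0] i1 f\<epsilon> usingle_SW0 by (auto simp: P top_cycles_def KC_def Ke_def)
    have fc': "?f (?d (Suc (i + c)) x) = 0" if "x \<in> Car (?P (Suc (Suc (i + c))))" for x
      using fc [of x] that dc by (auto simp: fun_eq_iff)
    have gl: "gldim TYPE('s) = enat (Suc (i + c))"
      using AS dc by (simp add: AS_regular_def)
    obtain g where g: "module_hom_on (?P d) (gm (KD (Suc 0)) (KC (Suc 0))) g"
      "\<forall>x\<in>Car (?P d). Kd 0 (g x) = ?f x" "\<forall>x\<in>Car (?P (Suc d)). g (?d d x) = 0"
      using gldim_lift_cocycle [OF gl triv_univ_left_module triv_univ_resolution [OF pres] gsub_left_module [OF KC_gsub]
          gsub_left_module [OF KC_gsub] Kd_hom f' [unfolded dc] fc' im' [unfolded dc]] unfolding dc by blast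
    have dhom: "module_hom_on (?P (Suc d)) (?P d) (?d d)"
      using projective_resolutionD(3) [OF pres] .
    have fg: "f x = (\<Sum>p\<in>words n 1. g x (list_encode p) * bw p)" if "x \<in> free_on I" for x
    proof -
      have "f x = Kd 0 (g x) (list_encode [])"
        using g(2) that by (simp add: P)
      then show ?thesis
        unfolding Kd_def dK_apply by (simp add: ks_def)
    qed
    \<comment> \<open>The lift \<open>g\<close> comes from ungraded resolutions and need not be
      homogeneous. On each generator only the component of degree \<open>fdeg q - l - 1\<close> is
      kept, so that the maps \<open>h p\<close> have degree \<open>-l - 1\<close>.\<close>
    define G where "G = (\<lambda>p q. ci (int (fdeg q) + (- int l - 1)) (g (usingle q 1) (list_encode p)))"
    define h where "h = (\<lambda>p x. if x \<in> free_on I then lincomb (Act reg) (G p) x else 0)"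
    have lch: "module_hom_on (gm fdeg (free_on I)) reg (lincomb (Act reg) (G p))" for p
      by (rule lincomb_hom [OF reg_left_module]) simp
    have hh: "module_hom_on (?P d) reg (h p)" for p
      using lch [of p] unfolding P by (simp add: module_hom_on_def h_def free_on_add free_on_act)
    have hco: "h p \<in> cocycles ?P ?d reg d (- int l - 1)" for p
      unfolding cocycles_def graded_Hom_def
    proof (intro CollectI conjI allI ballI impI)
      show "module_hom_on (?P d) reg (h p)" by (rule hh)
      show "h p ` Deg (?P d) k \<subseteq> Deg reg (k + (- int l - 1))" for k
      proof -
        have "x q * G p q \<in> gri (k + (- int l - 1))" if "x \<in> gdeg fdeg k" for x q
        proof -
          have "x q \<in> gri (k - int (fdeg q))" using that by (simp add: gdeg_def)
          from gri_mult2 [OF this, of "G p q" "int (fdeg q) + (- int l - 1)"] show ?thesis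
            by (simp add: G_def)
        qed
        then show ?thesis
          by (auto simp: P h_def lincomb_def intro!: gri_sum)
      qed
      show "h p x = 0" if "x \<notin> Car (?P d)" for x
        using that by (simp add: P h_def)
      fix x assume x: "x \<in> Car (?P (Suc d))"
      \<comment> \<open>On a homogeneous element of degree \<open>k\<close> the cocycle condition
        for \<open>h p\<close> is the component in degree \<open>k - l - 1\<close> of the cocycle
        equation for \<open>g\<close>.\<close>
      have homog: "h p (?d d y) = 0" if y: "y \<in> free_on I'" "y \<in> gdeg fdeg k" for y k
      proof -
        let ?z = "?d d y"
        have yP: "y \<in> Deg (?P (Suc d)) k" using y by (simp add: P')
        have "?z \<in> Deg (?P d) k"
          using res yP unfolding graded_projective_resolution_def by (simp add: image_subset_iff)
        then have z: "?z \<in> free_on I" "?z \<in> gdeg fdeg k"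
          by (simp_all add: P)
        have K: "finite {q. ?z q \<noteq> 0}" "{q. ?z q \<noteq> 0} \<subseteq> I"
          using z by (auto simp: free_on_def)
        have "g ?z = lincomb uact (\<lambda>q. g (usingle q 1)) ?z"
          using hom_eq_lincomb [of fdeg I "gm (KD (Suc 0)) (KC (Suc 0))" g ?z] g(1) z(1) by (simp add: P)
        moreover have "g ?z = 0"
          using g(3) y by (simp add: P')
        ultimately have "lincomb uact (\<lambda>q. g (usingle q 1)) ?z (list_encode p) = 0"
          by simp
        then have "(\<Sum>q | ?z q \<noteq> 0. ?z q * g (usingle q 1) (list_encode p)) = 0"
          by (simp add: lincomb_def sum_fun_apply)
        then have "0 = ci (k + (- int l - 1)) (\<Sum>q | ?z q \<noteq> 0. ?z q * g (usingle q 1) (list_encode p))"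
          by simp
        also have "\<dots> = (\<Sum>q | ?z q \<noteq> 0. ?z q * G p q)"
          unfolding ci_sum
        proof (intro sum.cong refl)
          fix q assume "q \<in> {q. ?z q \<noteq> 0}"
          then have "?z q \<noteq> 0" "?z q \<in> gri (k - int (fdeg q))"
            using z(2) by (auto simp: gdeg_def)
          then have "?z q \<in> gr (nat (k - int (fdeg q)))" "int (nat (k - int (fdeg q))) = k - int (fdeg q)"
            by (auto simp: gri_def split: if_splits)
          from ci_mult_left [OF this(1), of "int (fdeg q) + (- int l - 1)"] this(2)
          show "ci (k + (- int l - 1)) (?z q * g (usingle q 1) (list_encode p)) = ?z q * G p q"
            by (simp add: G_def)
        qed
        finally show ?thesis
          using z(1) by (simp add: h_def lincomb_def)
      qed
      have comp: "module_hom_on (?P (Suc d)) reg (\<lambda>x. h p (?d d x))"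
        by (rule module_hom_on_compose [OF dhom hh])
      have x': "x \<in> free_on I'" using x by (simp add: P')
      then obtain J where J: "x = (\<Sum>j\<in>J. ucomp fdeg (int j) x)"
        using gsub_sum_pieces [OF free_on_gsub] by blast
      have xc: "ucomp fdeg (int j) x \<in> free_on I'" for j
        by (rule gsub_ucomp [OF free_on_gsub x'])
      have "h p (?d d x) = h p (?d d (\<Sum>j\<in>J. ucomp fdeg (int j) x))"
        using J by (rule arg_cong)
      also have "\<dots> = (\<Sum>j\<in>J. h p (?d d (ucomp fdeg (int j) x)))"
        using xc by (intro module_hom_on_sum [OF comp]) (simp_all add: P' gsub_left_module free_on_gsub)
      also have "\<dots> = 0"
        using homog [OF xc ucomp_gdeg] by simp
      finally show "h p (?d d x) = 0" .
    qed
    \<comment> \<open>The discarded components play no part in recovering \<open>f\<close>, which is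
      itself homogeneous of degree \<open>-l\<close>.\<close>
    have fsum: "f = (\<lambda>x. \<Sum>p\<in>words n 1. h p x * bw p)"
    proof
      fix x
      show "f x = (\<Sum>p\<in>words n 1. h p x * bw p)"
      proof (cases "x \<in> free_on I")
        case False
        then show ?thesis using fout by (simp add: P h_def)
      next
        case True
        have "f (usingle q 1) = (\<Sum>p\<in>words n 1. G p q * bw p)" if q: "q \<in> I" for q
        proof -
          have "f (usingle q 1) = ci (int (fdeg q) + - int l) (f (usingle q 1))"
            using ci_homogeneous [OF fu [OF q]] by simp
          also have "\<dots> = (\<Sum>p\<in>words n 1. ci (int (fdeg q) + - int l) (g (usingle q 1) (list_encode p) * bw p))"
            unfolding fg [OF usingle_free_on [OF q]] ci_sum ..
          also have "\<dots> = (\<Sum>p\<in>words n 1. G p q * bw p)"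
          proof (intro sum.cong refl)
            fix p assume "p \<in> words n 1"
            from ci_mult_right [OF bw_gr [OF this], of "int (fdeg q) + (- int l - 1)"]
            show "ci (int (fdeg q) + - int l) (g (usingle q 1) (list_encode p) * bw p) = G p q * bw p"
              by (simp add: G_def)
          qed
          finally show ?thesis .
        qed
        then have "f x = (\<Sum>q | x q \<noteq> 0. \<Sum>p\<in>words n 1. x q * G p q * bw p)"
          unfolding flc [OF True] lincomb_def using True
          by (intro sum.cong refl) (auto simp: free_on_def sum_distrib_left mult.assoc)
        also have "\<dots> = (\<Sum>p\<in>words n 1. (\<Sum>q | x q \<noteq> 0. x q * G p q) * bw p)"
          by (subst sum.swap) (simp add: sum_distrib_right)
        finally show ?thesis
          using True by (simp add: h_def lincomb_def)
      qed
    qed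
    \<comment> \<open>\<open>\<theta>\<close> turns right multiplication by a letter into
      multiplication by its augmentation, which is 0. The finite sum is treated by induction because
      \<open>\<theta>\<close> is additive for two summands.\<close>
    have "(\<lambda>x. \<Sum>p\<in>A. h p x * bw p) \<in> cocycles ?P ?d reg d (- int l) \<and> \<theta> (- int l) (\<lambda>x. \<Sum>p\<in>A. h p x * bw p) = 0"
      if "finite A" "A \<subseteq> words n 1" for A
      using that
    proof (induction A rule: finite_induct)
      case empty
      have "left_module (?P d)" by (rule projective_resolutionD(2) [OF pres])
      then show ?case
        using cocycles_reg_0 [of ?P d] \<theta>0 by simp
    next
      case (insert p A)
      have p: "bw p \<in> gr 1" using insert.prems bw_gr by blast
      have eq: "(\<lambda>x. \<Sum>p\<in>insert p A. h p x * bw p) = (\<lambda>x. h p x * bw p) + (\<lambda>x. \<Sum>p\<in>A. h p x * bw p)"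
        using insert.hyps by (simp add: fun_eq_iff)
      have c1: "(\<lambda>x. h p x * bw p) \<in> cocycles ?P ?d reg d (- int l)"
        using cocycles_reg_mult [OF hco p] by simp
      have "\<theta> (- int l) (\<lambda>x. h p x * bw p) = 0"
        using right [OF p hco] \<epsilon>_gr [OF p] by simp
      then show ?case
        unfolding eq using insert.IH insert.prems c1 cocycles_reg_add add by simp
    qed
    from this [OF finite_words order_refl] show False
      using f(2) fsum by simp
  qed
qed

text \<open>The climb ends exactly at \<open>W l\<close> because \<open>l\<close> equals some
  \<open>kd i\<close>, and \<open>m \<le> l\<close> gives \<open>i \<ge> 2\<close>, so that it can
  start at \<open>W m\<close>.\<close>

theorem relations_detected:
  assumes conc: "\<And>i. \<exists>n. \<forall>j. j \<noteq> n \<longrightarrow> Ext_vanishes gr triv triv i j" and Wl: "W l \<noteq> {0}"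
    and AS: "AS_regular scale gr d (int l)" and l: "m \<le> l"
    and x: "x \<in> W m" "(\<Sum>u\<in>words n m. \<rho> u * x u) \<noteq> 0"
  shows "\<exists>p y. length p + m = l \<and> y \<in> W l \<and> (\<Sum>u\<in>words n m. \<rho> u * y (p @ u)) \<noteq> 0"
proof -
  have "1 \<le> l" using l m2 by simp
  then obtain i where i: "kd i = l"
    using kd_hits_parameter [OF conc Wl AS] by blast
  have "2 \<le> i"
    using i l strict_mono_less_eq [OF strict_mono_kd, of 2 i] by simp
  moreover have "partial_resolution k KD KC Kd Ke" if "kd k \<le> l" for k
  proof (rule Koszul_partial_resolution, rule Koszul_exact [OF conc Wl])
    fix j assume "j < k"
    then have "kd (Suc j) \<le> kd k"
      using strict_mono_kd by (simp add: strict_mono_less_eq)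
    then show "kd (Suc j) \<le> l" using that by simp
  qed
  ultimately show ?thesis
    using ladder [of l x \<rho> i] AS_regular_Ext_vanishes [OF AS] x i by blast
qed

end

section \<open>Tensors\<close>

lemma tensor_mult_add_left: "(T + T') \<otimes>\<^sub>t U = T \<otimes>\<^sub>t U + T' \<otimes>\<^sub>t U"
  and tensor_mult_add_right: "T \<otimes>\<^sub>t (U + U') = T \<otimes>\<^sub>t U + T \<otimes>\<^sub>t U'"
  and tensor_mult_scale_left: "tscale c T \<otimes>\<^sub>t U = tscale c (T \<otimes>\<^sub>t U)"
  and tensor_mult_scale_right: "T \<otimes>\<^sub>t tscale c U = tscale c (T \<otimes>\<^sub>t U)"
  by (auto simp: tensor_mult_def fun_eq_iff algebra_simps sum.distrib sum_distrib_left)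

lemma tensor_mult_0_left: "0 \<otimes>\<^sub>t U = 0"
  and tensor_mult_0_right: "T \<otimes>\<^sub>t 0 = 0"
  by (auto simp: tensor_mult_def fun_eq_iff)

lemma subspace_tensor_mult_left:
  assumes "tens.subspace D"
  shows "tens.subspace {T. T \<otimes>\<^sub>t U \<in> D}"
  using assms unfolding tens.subspace_def
  by (auto simp: tensor_mult_add_left tensor_mult_scale_left tensor_mult_0_left simp del: plus_fun_apply)

lemma subspace_tensor_mult_right:
  assumes "tens.subspace D"
  shows "tens.subspace {U. T \<otimes>\<^sub>t U \<in> D}"
  using assms unfolding tens.subspace_def
  by (auto simp: tensor_mult_add_right tensor_mult_scale_right tensor_mult_0_right simp del: plus_fun_apply)

text \<open>By trilinearity it is enough to test products of elements of \<open>R\<close> with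
  generators of the outer factors.\<close>

lemma tensor_subspace_mult_subset:
  assumes D: "tens.subspace D" and A: "\<And>a r c. a \<in> A \<Longrightarrow> r \<in> R \<Longrightarrow> c \<in> C \<Longrightarrow> a \<otimes>\<^sub>t r \<otimes>\<^sub>t c \<in> D"
  shows "tens.span A \<otimes>\<^sub>s R \<otimes>\<^sub>s tens.span C \<subseteq> D"
proof -
  have 1: "a \<otimes>\<^sub>t r \<otimes>\<^sub>t c \<in> D" if "a \<in> A" "r \<in> R" "c \<in> tens.span C" for a r c
    using tens.span_minimal [OF _ subspace_tensor_mult_right [OF D, of "a \<otimes>\<^sub>t r"], of C] A that by blast
  have 2: "a \<otimes>\<^sub>t r \<otimes>\<^sub>t c \<in> D" if "a \<in> tens.span A" "r \<in> R" "c \<in> tens.span C" for a r c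
    using tens.span_minimal [OF _ subspace_tensor_mult_left [OF subspace_tensor_mult_left [OF D, of c], of r], of A] 1 that
    by blast
  have 3: "X \<otimes>\<^sub>t c \<in> D" if "X \<in> tens.span A \<otimes>\<^sub>s R" "c \<in> tens.span C" for X c
    using tens.span_minimal [OF _ subspace_tensor_mult_left [OF D, of c], of "{T \<otimes>\<^sub>t U | T U. T \<in> tens.span A \<and> U \<in> R}"]
      2 that unfolding tensor_subspace_mult_def by blast
  show ?thesis
    unfolding tensor_subspace_mult_def [of "tens.span A \<otimes>\<^sub>s R"]
    using 3 by (intro tens.span_minimal D) blast
qed

lemma tensor_subspace_multI: "T \<in> A \<Longrightarrow> U \<in> B \<Longrightarrow> T \<otimes>\<^sub>t U \<in> A \<otimes>\<^sub>s B"
  unfolding tensor_subspace_mult_def by (intro tens.span_base) blast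

lemma tensor_subspace_mult_subspace: "tens.subspace (A \<otimes>\<^sub>s B)"
  unfolding tensor_subspace_mult_def by (rule tens.subspace_span)

text \<open>When \<open>T\<close> is concentrated in degree \<open>length fs\<close>, only one
  splitting of the argument list contributes.\<close>

lemma tensor_mult_append:
  assumes "\<And>gs. length gs \<noteq> length fs \<Longrightarrow> T gs = 0"
  shows "(T \<otimes>\<^sub>t U) (fs @ hs) = T fs * U hs"
proof -
  have "(T \<otimes>\<^sub>t U) (fs @ hs) = (\<Sum>i\<le>length (fs @ hs). if i = length fs then T fs * U hs else 0)"
    unfolding tensor_mult_def by (intro sum.cong refl) (auto intro!: assms)
  then show ?thesis by simp
qed

lemma tensor_map_mult:
  "tensor_map scale V \<sigma> (T \<otimes>\<^sub>t U) = tensor_map scale V \<sigma> T \<otimes>\<^sub>t tensor_map scale V \<sigma> U"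
proof
  fix fs
  have s: "set fs \<subseteq> dual scale V \<longleftrightarrow> set (take i fs) \<subseteq> dual scale V \<and> set (drop i fs) \<subseteq> dual scale V" for i
    by (metis append_take_drop_id set_append Un_subset_iff)
  show "tensor_map scale V \<sigma> (T \<otimes>\<^sub>t U) fs = (tensor_map scale V \<sigma> T \<otimes>\<^sub>t tensor_map scale V \<sigma> U) fs"
  proof (cases "set fs \<subseteq> dual scale V")
    case True
    then have "set (take i fs) \<subseteq> dual scale V" "set (drop i fs) \<subseteq> dual scale V" for i
      using s by blast+
    then show ?thesis
      using True by (simp add: tensor_map_def tensor_mult_def take_map drop_map)
  next
    case False
    have "tensor_map scale V \<sigma> T (take i fs) * tensor_map scale V \<sigma> U (drop i fs) = 0" for i
      using False s [of i] by (auto simp: tensor_map_def)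
    then have "(tensor_map scale V \<sigma> T \<otimes>\<^sub>t tensor_map scale V \<sigma> U) fs = 0"
      unfolding tensor_mult_def by (intro sum.neutral ballI)
    then show ?thesis
      using False by (simp add: tensor_map_def)
  qed
qed

lemma tensor_map_add: "tensor_map scale V \<sigma> (T + U) = tensor_map scale V \<sigma> T + tensor_map scale V \<sigma> U"
  and tensor_map_scale: "tensor_map scale V \<sigma> (tscale c T) = tscale c (tensor_map scale V \<sigma> T)"
  and tensor_map_0: "tensor_map scale V \<sigma> 0 = 0"
  by (auto simp: tensor_map_def fun_eq_iff)

lemma subspace_tensor_map:
  assumes "tens.subspace D"
  shows "tens.subspace {T. tensor_map scale V \<sigma> T \<in> D}"
  using assms unfolding tens.subspace_def
  by (auto simp: tensor_map_add tensor_map_scale tensor_map_0 simp del: plus_fun_apply)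

lemma tensor_power_minimal:
  assumes "tens.subspace D" "\<And>vs. vs \<in> lists V \<Longrightarrow> length vs = k \<Longrightarrow> pure_tensor scale V vs \<in> D"
  shows "tensor_power scale V k \<subseteq> D"
  unfolding tensor_power_def using assms by (intro tens.span_minimal) auto

lemma tensor_algebra_minimal:
  assumes "tens.subspace D" "\<And>vs. vs \<in> lists V \<Longrightarrow> pure_tensor scale V vs \<in> D"
  shows "tensor_algebra scale V \<subseteq> D"
  unfolding tensor_algebra_def using assms by (intro tens.span_minimal) auto

lemma tensor_power_subset: "tensor_power scale V k \<subseteq> tensor_algebra scale V"
  unfolding tensor_power_def tensor_algebra_def by (intro tens.span_mono) auto

lemma tensor_power_subspace: "tens.subspace (tensor_power scale V k)"
  and tensor_algebra_subspace: "tens.subspace (tensor_algebra scale V)"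
  by (simp_all add: tensor_power_def tensor_algebra_def)

lemma pure_tensor_power: "vs \<in> lists V \<Longrightarrow> pure_tensor scale V vs \<in> tensor_power scale V (length vs)"
  and pure_tensor_algebra: "vs \<in> lists V \<Longrightarrow> pure_tensor scale V vs \<in> tensor_algebra scale V"
  unfolding tensor_power_def tensor_algebra_def by (auto intro: tens.span_base)

lemma tensor_power_length:
  assumes "T \<in> tensor_power scale V k" "length fs \<noteq> k"
  shows "T fs = 0"
proof -
  have "tensor_power scale V k \<subseteq> {T. T fs = 0}"
    using assms(2) by (intro tensor_power_minimal) (auto simp: tens.subspace_def pure_tensor_def)
  then show ?thesis using assms(1) by blast
qed

lemma tensor_algebra_dual:
  assumes "T \<in> tensor_algebra scale V" "\<not> set fs \<subseteq> dual scale V"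
  shows "T fs = 0"
proof -
  have "tensor_algebra scale V \<subseteq> {T. T fs = 0}"
    using assms(2) by (intro tensor_algebra_minimal) (auto simp: tens.subspace_def pure_tensor_def)
  then show ?thesis using assms(1) by blast
qed

text \<open>Functionals are functions on the whole ambient type, but tensors see only their
  restrictions to \<open>V\<close>. This matters where
  \<open>g \<circ> \<tau>' \<circ> \<tau>\<close> is compared with \<open>g\<close>: they agree on
  \<open>V\<close>.\<close>

lemma tensor_algebra_cong:
  assumes T: "T \<in> tensor_algebra scale V" and fs: "set fs \<subseteq> dual scale V" "set gs \<subseteq> dual scale V"
    and eq: "list_all2 (\<lambda>f g. \<forall>v\<in>V. f v = g v) fs gs"
  shows "T fs = T gs"
proof -
  have len: "length fs = length gs" using eq by (rule list_all2_lengthD)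
  have "map2 (\<lambda>f v. f v) fs vs = map2 (\<lambda>f v. f v) gs vs" if "vs \<in> lists V" for vs
    using eq that
  proof (induction fs gs arbitrary: vs rule: list_all2_induct)
    case (Cons f fs g gs)
    then show ?case by (cases vs) auto
  qed simp
  then have "tensor_algebra scale V \<subseteq> {T. T fs = T gs}"
    using fs len by (intro tensor_algebra_minimal) (auto simp: tens.subspace_def pure_tensor_def)
  then show ?thesis using T by blast
qed

lemma GL_closed: "\<sigma> \<in> GL scale V \<Longrightarrow> v \<in> V \<Longrightarrow> \<sigma> v \<in> V"
  by (auto simp: GL_def bij_betw_def)

lemma GL_map_lists: "\<sigma> \<in> GL scale V \<Longrightarrow> vs \<in> lists V \<Longrightarrow> map \<sigma> vs \<in> lists V"
  using GL_closed [of \<sigma> scale V] by (auto simp: in_lists_conv_set)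

lemma tensor_map_power:
  assumes "\<sigma> \<in> GL scale V" "T \<in> tensor_power scale V k"
  shows "tensor_map scale V \<sigma> T \<in> tensor_power scale V k"
proof -
  have "map \<sigma> vs \<in> lists V" if "vs \<in> lists V" for vs
    using GL_map_lists [OF assms(1) that] .
  then have "tensor_map scale V \<sigma> (pure_tensor scale V vs) \<in> tensor_power scale V (length vs)" if "vs \<in> lists V" for vs
    using pure_tensor_power [of "map \<sigma> vs" V scale] tensor_map_pure_tensor [OF assms(1)] that by simp
  then have "tensor_power scale V k \<subseteq> {T. tensor_map scale V \<sigma> T \<in> tensor_power scale V k}"
    by (intro tensor_power_minimal subspace_tensor_map tensor_power_subspace) blast
  then show ?thesis using assms(2) by blast
qed

lemma tensor_map_algebra:
  assumes "\<sigma> \<in> GL scale V" "T \<in> tensor_algebra scale V"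
  shows "tensor_map scale V \<sigma> T \<in> tensor_algebra scale V"
proof -
  have "map \<sigma> vs \<in> lists V" if "vs \<in> lists V" for vs
    using GL_map_lists [OF assms(1) that] .
  then have "tensor_algebra scale V \<subseteq> {T. tensor_map scale V \<sigma> T \<in> tensor_algebra scale V}"
    using pure_tensor_algebra [of "map \<sigma> vs" V scale for vs] tensor_map_pure_tensor [OF assms(1)]
    by (intro tensor_algebra_minimal subspace_tensor_map tensor_algebra_subspace) auto
  then show ?thesis using assms(2) by blast
qed

lemma tensor_map_inverse:
  assumes "\<sigma> \<in> GL scale V" "\<tau> \<in> GL scale V" "\<And>v. v \<in> V \<Longrightarrow> \<tau> (\<sigma> v) = v" "T \<in> tensor_algebra scale V"
  shows "tensor_map scale V \<tau> (tensor_map scale V \<sigma> T) = T"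
proof -
  let ?f = "tensor_map scale V"
  have "map \<sigma> vs \<in> lists V" if "vs \<in> lists V" for vs
    using GL_map_lists [OF assms(1) that] .
  moreover have "map \<tau> (map \<sigma> vs) = vs" if "vs \<in> lists V" for vs
    using assms(3) that by (induction vs) auto
  ultimately have "?f \<tau> (?f \<sigma> (pure_tensor scale V vs)) = pure_tensor scale V vs" if "vs \<in> lists V" for vs
    using tensor_map_pure_tensor [OF assms(1)] tensor_map_pure_tensor [OF assms(2)] that by metis
  moreover have "tens.subspace {T. ?f \<tau> (?f \<sigma> T) = T}"
    unfolding tens.subspace_def by (auto simp: tensor_map_add tensor_map_scale tensor_map_0 simp del: plus_fun_apply)
  ultimately have "tensor_algebra scale V \<subseteq> {T. ?f \<tau> (?f \<sigma> T) = T}"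
    by (intro tensor_algebra_minimal) auto
  then show ?thesis using assms(4) by blast
qed

text \<open>Contraction of the leftmost tensor factors with the functionals
  \<open>fs\<close>.\<close>

definition tensor_slice :: "('s \<Rightarrow> 'k) list \<Rightarrow> ('s, 'k) tensor \<Rightarrow> ('s, 'k) tensor" where
  "tensor_slice fs T = (\<lambda>hs. T (fs @ hs))"

lemma tensor_map_slice:
  assumes "set fs \<subseteq> dual scale V"
  shows "tensor_map scale V \<sigma> (tensor_slice (map (\<lambda>f. f \<circ> \<sigma>) fs) T) = tensor_slice fs (tensor_map scale V \<sigma> T)"
  using assms by (auto simp: tensor_map_def tensor_slice_def)

section \<open>Evaluation of tensors in \<open>S\<close> and the ideal of relations\<close>

context connected_graded_algebra
begin

definition V1 :: "'s set" where "V1 = gr 1"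

abbreviation pt :: "'s list \<Rightarrow> ('s, 'k) tensor" where "pt \<equiv> pure_tensor scale V1"
abbreviation ev :: "('s, 'k) tensor \<Rightarrow> 's" where "ev \<equiv> tensor_eval scale V1"
abbreviation TA :: "('s, 'k) tensor set" where "TA \<equiv> tensor_algebra scale V1"
abbreviation TP :: "nat \<Rightarrow> ('s, 'k) tensor set" where "TP \<equiv> tensor_power scale V1"

lemma V1_subspace: "subspace V1"
  unfolding V1_def by (rule subspace_gr)

lemma TA_0: "0 \<in> TA"
  and TA_add: "T \<in> TA \<Longrightarrow> U \<in> TA \<Longrightarrow> T + U \<in> TA"
  and TA_scale: "T \<in> TA \<Longrightarrow> tscale c T \<in> TA"
  and TA_sum: "(\<And>a. a \<in> A \<Longrightarrow> f a \<in> TA) \<Longrightarrow> sum f A \<in> TA"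
  using tens.subspace_0 [OF tensor_algebra_subspace] tens.subspace_add [OF tensor_algebra_subspace]
    tens.subspace_scale [OF tensor_algebra_subspace] tens.subspace_sum [OF tensor_algebra_subspace] by metis+

lemma TP_scale: "T \<in> TP k \<Longrightarrow> tscale c T \<in> TP k"
  and TP_sum: "(\<And>a. a \<in> A \<Longrightarrow> f a \<in> TP k) \<Longrightarrow> sum f A \<in> TP k"
  using tens.subspace_scale [OF tensor_power_subspace] tens.subspace_sum [OF tensor_power_subspace] by metis+

lemma pt_TA: "vs \<in> lists V1 \<Longrightarrow> pt vs \<in> TA"
  and pt_TP: "vs \<in> lists V1 \<Longrightarrow> pt vs \<in> TP (length vs)"
  and TP_TA: "T \<in> TP k \<Longrightarrow> T \<in> TA"
  by (auto intro: pure_tensor_algebra pure_tensor_power subsetD [OF tensor_power_subset])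

lemma relations_iff: "T \<in> relations scale gr m \<longleftrightarrow> T \<in> TP m \<and> ev T = 0"
  by (simp add: relations_def V1_def)

lemma TA_representation:
  assumes "T \<in> TA"
  shows "\<exists>F c. finite F \<and> F \<subseteq> lists V1 \<and> T = (\<Sum>vs\<in>F. tscale (c vs) (pt vs))"
proof -
  obtain t r where t: "finite t" "t \<subseteq> pt ` lists V1" "T = (\<Sum>a\<in>t. tscale (r a) a)"
    using assms unfolding tensor_algebra_def tens.span_explicit by blast
  obtain F where F: "F \<subseteq> lists V1" "inj_on pt F" "t = pt ` F"
    using t(2) subset_image_inj by metis
  have "finite F" using t(1) F finite_imageD by blast
  moreover have "T = (\<Sum>vs\<in>F. tscale (r (pt vs)) (pt vs))"
    unfolding t(3) F(3) by (subst sum.reindex [OF F(2)]) simp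
  ultimately show ?thesis
    using F(1) by (intro exI [of _ F] exI [of _ "\<lambda>vs. r (pt vs)"]) blast
qed

lemma ev_pt: "vs \<in> lists V1 \<Longrightarrow> ev (pt vs) = prod_list vs"
  using tensor_eval_sum [OF V1_subspace, of "{vs}" "\<lambda>_. 1"] by simp

text \<open>\<open>ev\<close> is computed from an expression by pure tensors; two expressions are
  added over the union of their index sets, with coefficients extended by zero.\<close>

lemma ev_add:
  assumes "T \<in> TA" "U \<in> TA"
  shows "ev (T + U) = ev T + ev U"
proof -
  obtain F c where F: "finite F" "F \<subseteq> lists V1" "T = (\<Sum>vs\<in>F. tscale (c vs) (pt vs))"
    using TA_representation [OF assms(1)] by blast
  obtain G e where G: "finite G" "G \<subseteq> lists V1" "U = (\<Sum>vs\<in>G. tscale (e vs) (pt vs))"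
    using TA_representation [OF assms(2)] by blast
  let ?c = "\<lambda>vs. if vs \<in> F then c vs else 0" and ?e = "\<lambda>vs. if vs \<in> G then e vs else 0"
  have T: "T = (\<Sum>vs\<in>F \<union> G. tscale (?c vs) (pt vs))"
    unfolding F(3) by (rule sum.mono_neutral_cong_left) (use F(1) G(1) in \<open>auto simp: fun_eq_iff\<close>)
  have U: "U = (\<Sum>vs\<in>F \<union> G. tscale (?e vs) (pt vs))"
    unfolding G(3) by (rule sum.mono_neutral_cong_left) (use F(1) G(1) in \<open>auto simp: fun_eq_iff\<close>)
  have TU: "T + U = (\<Sum>vs\<in>F \<union> G. tscale (?c vs + ?e vs) (pt vs))"
    unfolding T U sum.distrib [symmetric] by (intro sum.cong refl) (auto simp: fun_eq_iff distrib_right)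
  have FG: "finite (F \<union> G)" "F \<union> G \<subseteq> lists V1"
    using F(1,2) G(1,2) by auto
  note e = tensor_eval_sum [OF V1_subspace FG]
  have "ev (T + U) = (\<Sum>vs\<in>F \<union> G. scale (?c vs + ?e vs) (prod_list vs))"
    unfolding TU by (rule e)
  also have "\<dots> = (\<Sum>vs\<in>F \<union> G. scale (?c vs) (prod_list vs)) + (\<Sum>vs\<in>F \<union> G. scale (?e vs) (prod_list vs))"
    unfolding scale_left_distrib by (rule sum.distrib)
  also have "\<dots> = ev T + ev U"
    unfolding T U by (simp only: e)
  finally show ?thesis .
qed

lemma ev_scale:
  assumes "T \<in> TA"
  shows "ev (tscale a T) = scale a (ev T)"
proof -
  obtain F c where F: "finite F" "F \<subseteq> lists V1" "T = (\<Sum>vs\<in>F. tscale (c vs) (pt vs))"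
    using TA_representation [OF assms(1)] by blast
  have "tscale a T = (\<Sum>vs\<in>F. tscale (a * c vs) (pt vs))"
    unfolding F(3) by (rule ext) (simp only: sum_fun_apply sum_distrib_left mult.assoc)
  then show ?thesis
    using tensor_eval_sum [OF V1_subspace F(1,2), of "\<lambda>vs. a * c vs"] tensor_eval_sum [OF V1_subspace F(1,2), of c]
    by (simp add: F(3) scale_sum_right)
qed

lemma ev_0 [simp]: "ev 0 = 0"
  using tensor_eval_sum [OF V1_subspace, of "{}"] by simp

lemma subspace_ev:
  assumes "subspace D"
  shows "tens.subspace {T \<in> TA. ev T \<in> D}"
  unfolding tens.subspace_def
proof (intro conjI ballI allI)
  show "0 \<in> {T \<in> TA. ev T \<in> D}"
    using subspace_0 [OF assms] by (simp add: TA_0)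
  fix T assume T: "T \<in> {T \<in> TA. ev T \<in> D}"
  show "T + U \<in> {T \<in> TA. ev T \<in> D}" if "U \<in> {T \<in> TA. ev T \<in> D}" for U
    using T that subspace_add [OF assms] by (simp add: ev_add TA_add del: plus_fun_apply)
  show "tscale c T \<in> {T \<in> TA. ev T \<in> D}" for c
    using T subspace_scale [OF assms] by (simp add: ev_scale TA_scale)
qed

lemma subspace_ev_0: "tens.subspace {T \<in> TA. ev T = 0}"
  using subspace_ev [OF subspace_single_0] by simp

lemma ev_sum:
  assumes "finite F" "\<And>a. a \<in> F \<Longrightarrow> f a \<in> TA"
  shows "ev (\<Sum>a\<in>F. tscale (c a) (f a)) = (\<Sum>a\<in>F. scale (c a) (ev (f a)))"
  using assms
proof (induction F rule: finite_induct)
  case (insert a F)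
  have m: "(\<Sum>a\<in>F. tscale (c a) (f a)) \<in> TA" "tscale (c a) (f a) \<in> TA"
    using insert.prems by (auto intro!: TA_sum TA_scale)
  have "ev (\<Sum>a\<in>insert a F. tscale (c a) (f a)) = ev (tscale (c a) (f a) + (\<Sum>a\<in>F. tscale (c a) (f a)))"
    using insert.hyps by (simp del: plus_fun_apply)
  also have "\<dots> = scale (c a) (ev (f a)) + (\<Sum>a\<in>F. scale (c a) (ev (f a)))"
    unfolding ev_add [OF m(2,1)] using insert by (simp add: ev_scale)
  finally show ?case using insert.hyps by (simp del: plus_fun_apply)
qed simp

lemma TA_mult:
  assumes "T \<in> TA" "U \<in> TA"
  shows "T \<otimes>\<^sub>t U \<in> TA \<and> ev (T \<otimes>\<^sub>t U) = ev T * ev U"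
proof -
  have sub: "tens.subspace {U \<in> TA. T \<otimes>\<^sub>t U \<in> TA \<and> ev (T \<otimes>\<^sub>t U) = ev T * ev U}" for T
    unfolding tens.subspace_def
    by (auto simp: TA_0 TA_add TA_scale tensor_mult_0_right tensor_mult_add_right tensor_mult_scale_right ev_add ev_scale distrib_left scale_mult_right
        simp del: plus_fun_apply)
  have sub': "tens.subspace {T \<in> TA. T \<otimes>\<^sub>t U \<in> TA \<and> ev (T \<otimes>\<^sub>t U) = ev T * ev U}" for U
    unfolding tens.subspace_def
    by (auto simp: TA_0 TA_add TA_scale tensor_mult_0_left tensor_mult_add_left tensor_mult_scale_left ev_add ev_scale distrib_right scale_mult_left
        simp del: plus_fun_apply)
  have "TA \<subseteq> {U \<in> TA. pt vs \<otimes>\<^sub>t U \<in> TA \<and> ev (pt vs \<otimes>\<^sub>t U) = ev (pt vs) * ev U}" if "vs \<in> lists V1" for vs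
    using that by (intro tensor_algebra_minimal sub) (simp_all add: pure_tensor_mult ev_pt pt_TA)
  then have "TA \<subseteq> {T \<in> TA. T \<otimes>\<^sub>t U \<in> TA \<and> ev (T \<otimes>\<^sub>t U) = ev T * ev U}"
    using assms(2) pt_TA by (intro tensor_algebra_minimal sub') blast
  then show ?thesis using assms(1) by blast
qed

lemma prod_list_gr: "vs \<in> lists V1 \<Longrightarrow> prod_list vs \<in> gr (length vs)"
proof (induction vs)
  case (Cons v vs)
  then show ?case using mult_gr [of v 1 "prod_list vs" "length vs"] by (simp add: V1_def)
qed (simp add: one_gr)

lemma TP_ev_gr: "T \<in> TP k \<Longrightarrow> ev T \<in> gr k"
proof -
  have "TP k \<subseteq> {T \<in> TA. ev T \<in> gr k}"
    using prod_list_gr by (intro tensor_power_minimal subspace_ev subspace_gr) (auto simp: ev_pt pt_TA)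
  then show "T \<in> TP k \<Longrightarrow> ev T \<in> gr k" by blast
qed

text \<open>In a preimage of a homogeneous element only the pure tensors of the right length are
  kept; the products of the others lie in different degrees.\<close>

lemma gr_eq_ev_TP:
  assumes "ev ` TA = UNIV"
  shows "gr k = ev ` TP k"
proof
  show "ev ` TP k \<subseteq> gr k" using TP_ev_gr by blast
  show "gr k \<subseteq> ev ` TP k"
  proof
    fix s assume s: "s \<in> gr k"
    obtain T where T: "T \<in> TA" "s = ev T" using assms by blast
    obtain F c where F': "finite F" "F \<subseteq> lists V1" "T = (\<Sum>vs\<in>F. tscale (c vs) (pt vs))"
      using TA_representation [OF T(1)] by blast
    note F = F'(1,2) T(2) [unfolded F'(3) tensor_eval_sum [OF V1_subspace F'(1,2)]]
    let ?G = "{vs \<in> F. length vs = k}"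
    have "s = hcomp k s" using s by (simp add: hcomp_homogeneous)
    also have "\<dots> = (\<Sum>vs\<in>F. scale (c vs) (hcomp k (prod_list vs)))"
      unfolding F(3) by (simp add: hcomp_sum hcomp_scale)
    also have "\<dots> = (\<Sum>vs\<in>F. if length vs = k then scale (c vs) (prod_list vs) else 0)"
      using F(2) by (intro sum.cong refl) (auto simp: hcomp_homogeneous [OF prod_list_gr] subset_iff)
    also have "\<dots> = (\<Sum>vs\<in>?G. scale (c vs) (prod_list vs))"
      using F(1) by (simp add: sum.inter_filter)
    also have "\<dots> = ev (\<Sum>vs\<in>?G. tscale (c vs) (pt vs))"
      by (rule tensor_eval_sum [OF V1_subspace, symmetric]) (use F(1,2) in auto)
    finally have "s = ev (\<Sum>vs\<in>?G. tscale (c vs) (pt vs))" .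
    moreover have "(\<Sum>vs\<in>?G. tscale (c vs) (pt vs)) \<in> TP k"
      using F(2) pt_TP by (intro TP_sum TP_scale) blast
    ultimately show "s \<in> ev ` TP k" by blast
  qed
qed

lemma relations_subspace: "tens.subspace (relations scale gr m)"
proof -
  have "relations scale gr m = TP m \<inter> {T \<in> TA. ev T = 0}"
    by (auto simp: relations_iff TP_TA)
  then show ?thesis
    using tens.subspace_inter [OF tensor_power_subspace subspace_ev_0] by simp
qed

lemma pt_Nil_mult: "pt [] \<otimes>\<^sub>t T = T" "T \<otimes>\<^sub>t pt [] = T"
proof -
  show "pt [] \<otimes>\<^sub>t T = T"
  proof
    fix fs
    show "(pt [] \<otimes>\<^sub>t T) fs = T fs"
      using tensor_mult_append [of "[]" "pt []" T fs] by (simp add: pure_tensor_def)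
  qed
  show "T \<otimes>\<^sub>t pt [] = T"
  proof
    fix fs
    have "(T \<otimes>\<^sub>t pt []) fs = (\<Sum>i\<le>length fs. if i = length fs then T fs else 0)"
      unfolding tensor_mult_def by (intro sum.cong refl) (auto simp: pure_tensor_def)
    then show "(T \<otimes>\<^sub>t pt []) fs = T fs" by simp
  qed
qed

text \<open>\<open>m_Koszul\<close> provides some generating space \<open>R'\<close>, while the
  theorem is about all relations of degree \<open>m\<close>. A generator lies in the ideal because
  \<open>pt []\<close> is the unit of the tensor algebra.\<close>

lemma presentation_relations:
  assumes R': "R' \<subseteq> TP m" and ker: "{T \<in> TA. ev T = 0} = tensor_ideal scale V1 R'"
  shows "R' \<subseteq> relations scale gr m"
proof
  fix r assume r: "r \<in> R'"
  have "pt [] \<otimes>\<^sub>t r \<otimes>\<^sub>t pt [] \<in> tensor_ideal scale V1 R'"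
    unfolding tensor_ideal_def using r by (intro tensor_subspace_multI) (auto simp: pt_TA)
  then have "r \<in> {T \<in> TA. ev T = 0}"
    unfolding ker by (simp only: pt_Nil_mult)
  then show "r \<in> relations scale gr m"
    using r R' by (auto simp: relations_iff)
qed

text \<open>An ideal generated in degree \<open>m\<close> has no components of lower degree; this is
  the source of the independence of words shorter than \<open>m\<close>.\<close>

lemma ideal_low_degree:
  assumes R': "R' \<subseteq> TP m" and T: "T \<in> tensor_ideal scale V1 R'" and fs: "length fs < m"
  shows "T fs = 0"
proof -
  have "tensor_ideal scale V1 R' \<subseteq> {T. \<forall>fs. length fs < m \<longrightarrow> T fs = 0}"
    unfolding tensor_ideal_def tensor_algebra_def
  proof (rule tensor_subspace_mult_subset)
    show "tens.subspace {T :: ('s, 'k) tensor. \<forall>fs. length fs < m \<longrightarrow> T fs = 0}"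
      by (auto simp: tens.subspace_def)
    fix a r c :: "('s, 'k) tensor" assume "r \<in> R'"
    then have r: "r fs = 0" if "length fs < m" for fs
      using tensor_power_length [of r scale "V1" m fs] R' that by blast
    then have "(a \<otimes>\<^sub>t r) fs = 0" if "length fs < m" for fs
      using that by (auto simp: tensor_mult_def)
    then show "a \<otimes>\<^sub>t r \<otimes>\<^sub>t c \<in> {T. \<forall>fs. length fs < m \<longrightarrow> T fs = 0}"
      by (auto simp: tensor_mult_def [of "a \<otimes>\<^sub>t r"])
  qed
  then show ?thesis using T fs by blast
qed

text \<open>The kernel of evaluation is the ideal of \<open>R'\<close>, and each product
  \<open>a r c\<close> with \<open>r\<close> in \<open>R'\<close> is mapped to a product containing
  a relation. This is what lets \<open>\<sigma>\<close> descend to \<open>S\<close>.\<close>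

lemma ev_tensor_map_kernel:
  assumes R': "R' \<subseteq> TP m" and ker: "{T \<in> TA. ev T = 0} = tensor_ideal scale V1 R'"
    and \<sigma>: "\<sigma> \<in> GL scale V1" and pres: "tensor_map scale V1 \<sigma> ` relations scale gr m \<subseteq> relations scale gr m"
    and T: "T \<in> TA" "ev T = 0"
  shows "ev (tensor_map scale V1 \<sigma> T) = 0"
proof -
  let ?f = "tensor_map scale V1 \<sigma>"
  have "tensor_ideal scale V1 R' \<subseteq> {T. ?f T \<in> {U \<in> TA. ev U = 0}}"
    unfolding tensor_ideal_def tensor_algebra_def [of scale "V1"]
  proof (rule tensor_subspace_mult_subset [OF subspace_tensor_map])
    show "tens.subspace {U \<in> tens.span (pt ` lists V1). ev U = 0}"
      using subspace_ev_0 by (simp add: tensor_algebra_def)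
    fix a r c assume a: "a \<in> pt ` lists V1" and r: "r \<in> R'" and c: "c \<in> pt ` lists V1"
    have fr: "?f r \<in> relations scale gr m"
      using pres presentation_relations [OF R' ker] r by blast
    then have m: "?f a \<in> TA" "?f r \<in> TA" "?f c \<in> TA"
      using a c tensor_map_algebra [OF \<sigma> pt_TA] by (auto simp: relations_iff TP_TA)
    have "ev (?f a \<otimes>\<^sub>t ?f r \<otimes>\<^sub>t ?f c) = ev (?f a) * ev (?f r) * ev (?f c)"
      using TA_mult m by simp
    moreover have "ev (?f r) = 0" using fr by (simp add: relations_iff)
    ultimately show "a \<otimes>\<^sub>t r \<otimes>\<^sub>t c \<in> {T. ?f T \<in> {U \<in> tens.span (pt ` lists V1). ev U = 0}}"
      using TA_mult m by (simp add: tensor_map_mult tensor_algebra_def)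
  qed
  then show ?thesis using T ker by blast
qed

text \<open>Evaluation intertwines an automorphism with the tensor powers of its restriction to
  \<open>V\<close>. It follows that the automorphism is determined by this restriction, and that the
  restriction preserves relations.\<close>

lemma aut_tensor_map:
  assumes \<sigma>: "\<sigma> \<in> graded_algebra_aut scale gr"
  shows "restrict \<sigma> V1 \<in> GL scale V1"
    and "T \<in> TA \<Longrightarrow> ev (tensor_map scale V1 (restrict \<sigma> V1) T) = \<sigma> (ev T)"
proof -
  let ?\<tau> = "restrict \<sigma> V1"
  have b: "bij \<sigma>" and lin: "linear_on scale UNIV scale \<sigma>" and one: "\<sigma> 1 = 1"
    and mult: "\<And>a b. \<sigma> (a * b) = \<sigma> a * \<sigma> b" and img: "\<And>i. \<sigma> ` gr i = gr i"
    using \<sigma> by (auto simp: graded_algebra_aut_def)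
  have "bij_betw ?\<tau> V1 V1"
    using img [of 1] bij_is_inj [OF b] by (auto simp: V1_def bij_betw_def inj_on_def image_restrict_eq)
  moreover have "linear_on scale V1 scale ?\<tau>"
    using lin subspace_add [OF V1_subspace] subspace_scale [OF V1_subspace] by (simp add: linear_on_def)
  ultimately show GL: "?\<tau> \<in> GL scale V1"
    by (simp add: GL_def)
  let ?f = "tensor_map scale V1 ?\<tau>"
  have "\<sigma> 0 = 0"
    using lin unfolding linear_on_def by (metis UNIV_I add_cancel_right_right add_0)
  have "TA \<subseteq> {T \<in> TA. ev (?f T) = \<sigma> (ev T)}"
  proof (rule tensor_algebra_minimal)
    show "tens.subspace {T \<in> TA. ev (?f T) = \<sigma> (ev T)}"
      unfolding tens.subspace_def
      using lin \<open>\<sigma> 0 = 0\<close>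
      by (auto simp: TA_0 TA_add TA_scale tensor_map_algebra [OF GL] tensor_map_0 tensor_map_add tensor_map_scale ev_add ev_scale linear_on_def simp del: plus_fun_apply)
    fix vs assume vs: "vs \<in> lists V1"
    then have "map ?\<tau> vs \<in> lists V1"
      by (rule GL_map_lists [OF GL])
    moreover have "prod_list (map ?\<tau> vs) = \<sigma> (prod_list vs)"
      using vs by (induction vs) (auto simp: one mult)
    ultimately show "pt vs \<in> {T \<in> TA. ev (?f T) = \<sigma> (ev T)}"
      using vs tensor_map_pure_tensor [OF GL vs] by (simp add: ev_pt pt_TA)
  qed
  then show "T \<in> TA \<Longrightarrow> ev (?f T) = \<sigma> (ev T)" by blast
qed

lemma tensor_map_sandwich:
  assumes \<tau>: "\<tau> \<in> GL scale V1" and pres: "tensor_map scale V1 \<tau> ` R \<subseteq> R"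
    and T: "T \<in> TP s \<otimes>\<^sub>s R \<otimes>\<^sub>s TP t"
  shows "tensor_map scale V1 \<tau> T \<in> TP s \<otimes>\<^sub>s R \<otimes>\<^sub>s TP t"
proof -
  let ?f = "tensor_map scale V1 \<tau>"
  have "TP s \<otimes>\<^sub>s R \<otimes>\<^sub>s TP t \<subseteq> {T. ?f T \<in> TP s \<otimes>\<^sub>s R \<otimes>\<^sub>s TP t}"
    unfolding tensor_power_def [of scale "V1" s] tensor_power_def [of scale "V1" t]
  proof (rule tensor_subspace_mult_subset [OF subspace_tensor_map [OF tensor_subspace_mult_subspace]])
    fix a r c assume a: "a \<in> pt ` {vs \<in> lists V1. length vs = s}" and r: "r \<in> R"
      and c: "c \<in> pt ` {vs \<in> lists V1. length vs = t}"
    have "?f a \<in> TP s" "?f c \<in> TP t"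
      using a c pt_TP by (auto intro!: tensor_map_power [OF \<tau>])
    moreover have "?f r \<in> R" using pres r by blast
    ultimately have "?f a \<otimes>\<^sub>t ?f r \<otimes>\<^sub>t ?f c \<in> TP s \<otimes>\<^sub>s R \<otimes>\<^sub>s TP t"
      by (intro tensor_subspace_multI)
    then show "a \<otimes>\<^sub>t r \<otimes>\<^sub>t c \<in> {T. ?f T \<in> tens.span (pt ` {vs \<in> lists V1. length vs = s}) \<otimes>\<^sub>s R \<otimes>\<^sub>s
        tens.span (pt ` {vs \<in> lists V1. length vs = t})}"
      by (simp add: tensor_map_mult tensor_power_def)
  qed
  then show ?thesis using T by blast
qed

lemma GL_inverse:
  assumes \<tau>: "\<tau> \<in> GL scale V" and V: "subspace V"
  shows "\<exists>\<tau>'\<in>GL scale V. (\<forall>v\<in>V. \<tau>' (\<tau> v) = v) \<and> (\<forall>v\<in>V. \<tau> (\<tau>' v) = v)"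
proof -
  have b: "bij_betw \<tau> V V" and lin: "linear_on scale V scale \<tau>"
    using \<tau> by (auto simp: GL_def)
  let ?\<tau>' = "restrict (inv_into V \<tau>) V"
  have 1: "?\<tau>' (\<tau> v) = v" "\<tau> v \<in> V" if "v \<in> V" for v
    using b that bij_betw_inv_into_left [OF b that] by (auto simp: bij_betw_def)
  have 2: "\<tau> (?\<tau>' v) = v" "?\<tau>' v \<in> V" if "v \<in> V" for v
    using b that bij_betw_inv_into_right [OF b that] inv_into_into [of v \<tau> V] by (auto simp: bij_betw_def)
  have inj: "x = y" if "x \<in> V" "y \<in> V" "\<tau> x = \<tau> y" for x y
    using that 1 by metis
  have "bij_betw ?\<tau>' V V"
    by (rule bij_betw_byWitness [where f' = \<tau>]) (use 1 2 in auto)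
  moreover have "?\<tau>' (x + y) = ?\<tau>' x + ?\<tau>' y" if "x \<in> V" "y \<in> V" for x y
  proof (rule inj)
    show "\<tau> (?\<tau>' (x + y)) = \<tau> (?\<tau>' x + ?\<tau>' y)"
      using lin 2 that subspace_add [OF V] unfolding linear_on_def by metis
  qed (use 2 that subspace_add [OF V] in auto)
  moreover have "?\<tau>' (scale c x) = scale c (?\<tau>' x)" if "x \<in> V" for c x
  proof (rule inj)
    show "\<tau> (?\<tau>' (scale c x)) = \<tau> (scale c (?\<tau>' x))"
      using lin 2 that subspace_scale [OF V] unfolding linear_on_def by metis
  qed (use 2 that subspace_scale [OF V] in auto)
  ultimately have "?\<tau>' \<in> GL scale V"
    by (simp add: GL_def linear_on_def)
  then show ?thesis using 1 2 by blast
qed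

text \<open>The last factor consists of scalars, so \<open>T\<close> lies in
  \<open>V\<^sup>s \<otimes> R\<close>; contracting the first \<open>s\<close> factors leaves a
  combination of elements of \<open>R\<close>.\<close>

lemma slice_relations:
  assumes T: "T \<in> TP s \<otimes>\<^sub>s relations scale gr m \<otimes>\<^sub>s TP 0" and fs: "length fs = s"
  shows "tensor_slice fs T \<in> relations scale gr m"
proof -
  let ?R = "relations scale gr m"
  have "TP s \<otimes>\<^sub>s ?R \<otimes>\<^sub>s TP 0 \<subseteq> {T. tensor_slice fs T \<in> ?R}"
    unfolding tensor_power_def [of scale "V1" s] tensor_power_def [of scale "V1" 0]
  proof (rule tensor_subspace_mult_subset)
    show "tens.subspace {T. tensor_slice fs T \<in> ?R}"
      using relations_subspace [of m] unfolding tens.subspace_def tensor_slice_def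
      by (auto simp: zero_fun_def plus_fun_def)
    fix a r c assume a: "a \<in> pt ` {vs \<in> lists V1. length vs = s}" and r: "r \<in> ?R"
      and c: "c \<in> pt ` {vs \<in> lists V1. length vs = 0}"
    have "c = pt []" using c by auto
    then have "tensor_slice fs (a \<otimes>\<^sub>t r \<otimes>\<^sub>t c) = tensor_slice fs (a \<otimes>\<^sub>t r)"
      by (simp add: pt_Nil_mult)
    also have "\<dots> = tscale (a fs) r"
      unfolding tensor_slice_def using a fs
      by (intro ext tensor_mult_append) (auto simp: pure_tensor_def)
    also have "\<dots> \<in> ?R"
      using tens.subspace_scale [OF relations_subspace r] .
    finally show "a \<otimes>\<^sub>t r \<otimes>\<^sub>t c \<in> {T. tensor_slice fs T \<in> ?R}" by simp
  qed
  then show ?thesis using T by blast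
qed

end

section \<open>Tensors and words\<close>

locale generator_basis = connected_graded_algebra scale gr
  for scale :: "'k::field \<Rightarrow> 's::ring_1 \<Rightarrow> 's" and gr +
  fixes n :: nat and b :: "nat \<Rightarrow> 's"
  assumes b_inj: "inj_on b {..<n}" and b_indep: "independent (b ` {..<n})" and b_span: "span (b ` {..<n}) = V1"
begin

definition db :: "nat \<Rightarrow> 's \<Rightarrow> 'k" where
  "db a v = representation (b ` {..<n}) v (b a)"

lemma db_dual: "db a \<in> dual scale V1"
  using b_indep b_span by (auto simp: db_def dual_def linear_on_def representation_add representation_scale)

lemma map_db_dual: "set (map db u) \<subseteq> dual scale V1"
  using db_dual by auto

lemma b_V1: "a < n \<Longrightarrow> b a \<in> V1"
  using span_base [of "b a" "b ` {..<n}"] b_span by simp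

lemma db_b: "a < n \<Longrightarrow> c < n \<Longrightarrow> db a (b c) = (if a = c then 1 else 0)"
  using representation_basis [OF b_indep, of "b c"] inj_on_eq_iff [OF b_inj, of a c] by (simp add: db_def)

lemma V1_expand:
  assumes "v \<in> V1"
  shows "v = (\<Sum>a<n. scale (db a v) (b a))"
proof -
  have "v = (\<Sum>x\<in>b ` {..<n}. scale (representation (b ` {..<n}) v x) x)"
    using sum_representation_eq [OF b_indep, of v "b ` {..<n}"] assms b_span by simp
  also have "\<dots> = (\<Sum>a<n. scale (db a v) (b a))"
    by (subst sum.reindex [OF b_inj]) (simp add: db_def)
  finally show ?thesis .
qed

lemma map_b_V1: "u \<in> words n k \<Longrightarrow> map b u \<in> lists V1"
  by (auto simp: words_def subset_iff intro!: b_V1)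

lemma pt_Cons: "pt (v # vs) (f # fs) = (if f \<in> dual scale V1 then f v * pt vs fs else 0)"
  by (auto simp: pure_tensor_def)

lemma sum_words_1: "(\<Sum>p\<in>words n 1. f p) = (\<Sum>a<n. f [a])"
  by (rule sum.reindex_bij_witness [of _ "\<lambda>a. [a]" hd]) (auto simp: words_def length_Suc_conv)

lemma dual_expand:
  assumes f: "f \<in> dual scale V1" and v: "v \<in> V1"
  shows "f v = (\<Sum>a<n. db a v * f (b a))"
proof -
  have lin: "linear_on scale V1 (*) f" using f by (simp add: dual_def)
  have "f 0 = 0"
    using lin subspace_0 [OF V1_subspace] unfolding linear_on_def by (metis add_cancel_right_right add_0)
  have "f (\<Sum>a\<in>A. scale (db a v) (b a)) = (\<Sum>a\<in>A. db a v * f (b a))" if "finite A" "A \<subseteq> {..<n}" for A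
    using that
  proof (induction A rule: finite_induct)
    case (insert a A)
    have "scale (db a v) (b a) \<in> V1" "(\<Sum>a\<in>A. scale (db a v) (b a)) \<in> V1" "b a \<in> V1"
      using insert.prems b_V1 by (auto intro!: subspace_scale [OF V1_subspace] subspace_sum [OF V1_subspace])
    then show ?case
      using insert lin by (simp add: linear_on_def)
  qed (simp add: \<open>f 0 = 0\<close>)
  from this [of "{..<n}"] show ?thesis
    using V1_expand [OF v] by simp
qed

lemma pt_expand:
  assumes "vs \<in> lists V1"
  shows "pt vs fs = (\<Sum>u\<in>words n (length vs). pt vs (map db u) * pt (map b u) fs)"
  using assms
proof (induction vs arbitrary: fs)
  case Nil
  then show ?case by (simp add: pure_tensor_def)
next
  case (Cons v vs)
  show ?case
  proof (cases "length fs = Suc (length vs) \<and> set fs \<subseteq> dual scale V1")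
    case False
    then have 1: "pt (v # vs) fs = 0" by (auto simp: pure_tensor_def)
    have 2: "pt (map b u) fs = 0" if "u \<in> words n (length (v # vs))" for u
      using False words_length [OF that] by (auto simp: pure_tensor_def)
    show ?thesis
      unfolding 1 by (intro sum.neutral [symmetric] ballI) (simp only: 2 mult_zero_right)
  next
    case True
    then obtain f fs' where fs: "fs = f # fs'" "f \<in> dual scale V1"
      by (cases fs) auto
    have "(\<Sum>u\<in>words n (length (v # vs)). pt (v # vs) (map db u) * pt (map b u) fs) =
        (\<Sum>u\<in>words n (1 + length vs). pt (v # vs) (map db u) * pt (map b u) fs)"
      by simp
    also have "\<dots> = (\<Sum>a<n. \<Sum>u\<in>words n (length vs). db a v * f (b a) * (pt vs (map db u) * pt (map b u) fs'))"
      unfolding sum_words_add sum_words_1 by (simp add: fs pt_Cons db_dual mult_ac)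
    also have "\<dots> = (\<Sum>a<n. db a v * f (b a)) * (\<Sum>u\<in>words n (length vs). pt vs (map db u) * pt (map b u) fs')"
      by (simp add: sum_product)
    also have "\<dots> = f v * pt vs fs'"
    proof -
      have "v \<in> V1" "vs \<in> lists V1" using Cons.hyps by auto
      then show ?thesis
        by (simp only: dual_expand [OF fs(2), of v, symmetric] Cons.IH [of fs', symmetric])
    qed
    finally show ?thesis
      by (simp add: fs pt_Cons)
  qed
qed

definition word_tensor :: "nat \<Rightarrow> (nat list \<Rightarrow> 'k) \<Rightarrow> ('s, 'k) tensor" where
  "word_tensor k x = (\<Sum>u\<in>words n k. tscale (x u) (pt (map b u)))"

lemma word_tensor_apply: "word_tensor k x fs = (\<Sum>u\<in>words n k. x u * pt (map b u) fs)"
  by (simp add: word_tensor_def sum_fun_apply)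

text \<open>A tensor is encoded as a multilinear form, and its values on the dual basis are its
  coordinates on words.\<close>

lemma TP_expand:
  assumes "T \<in> TP k"
  shows "T = word_tensor k (\<lambda>u. T (map db u))"
proof -
  have "TP k \<subseteq> {T. \<forall>fs. T fs = (\<Sum>u\<in>words n k. T (map db u) * pt (map b u) fs)}"
  proof (rule tensor_power_minimal)
    show "tens.subspace {T. \<forall>fs. T fs = (\<Sum>u\<in>words n k. T (map db u) * pt (map b u) fs)}" (is "tens.subspace ?D")
    proof (rule tens.subspaceI)
      show "0 \<in> ?D" by simp
      fix x assume x: "x \<in> ?D"
      show "x + y \<in> ?D" if y: "y \<in> ?D" for y
      proof (intro CollectI allI)
        fix fs
        have "(x + y) fs = (\<Sum>u\<in>words n k. x (map db u) * pt (map b u) fs) + (\<Sum>u\<in>words n k. y (map db u) * pt (map b u) fs)"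
          unfolding plus_fun_apply using x y by (intro arg_cong2 [where f = "(+)"]) blast+
        then show "(x + y) fs = (\<Sum>u\<in>words n k. (x + y) (map db u) * pt (map b u) fs)"
          by (simp only: plus_fun_apply distrib_right sum.distrib)
      qed
      show "tscale c x \<in> ?D" for c
      proof (intro CollectI allI)
        fix fs
        have "c * x fs = c * (\<Sum>u\<in>words n k. x (map db u) * pt (map b u) fs)"
          using x by (intro arg_cong [where f = "(*) c"]) blast
        then show "c * x fs = (\<Sum>u\<in>words n k. c * x (map db u) * pt (map b u) fs)"
          by (simp only: sum_distrib_left mult.assoc)
      qed
    qed
    fix vs assume vs: "vs \<in> lists V1" "length vs = k"
    show "pt vs \<in> {T. \<forall>fs. T fs = (\<Sum>u\<in>words n k. T (map db u) * pt (map b u) fs)}"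
    proof (intro CollectI allI)
      fix fs
      show "pt vs fs = (\<Sum>u\<in>words n k. pt vs (map db u) * pt (map b u) fs)"
        using pt_expand [OF vs(1), of fs] by (simp only: vs(2))
    qed
  qed
  then have "T fs = word_tensor k (\<lambda>u. T (map db u)) fs" for fs
    unfolding word_tensor_apply using assms by blast
  then show ?thesis by (rule ext)
qed

lemma pt_words: "u \<in> words n k \<Longrightarrow> v \<in> words n k \<Longrightarrow> pt (map b v) (map db u) = (if u = v then 1 else 0)"
proof (induction k arbitrary: u v)
  case 0
  then show ?case by (simp add: pure_tensor_def)
next
  case (Suc k)
  then obtain a u' c v' where "u = a # u'" "v = c # v'" "a < n" "c < n" "u' \<in> words n k" "v' \<in> words n k"
    by (cases u; cases v) (auto simp: words_def)
  then show ?case using Suc.IH [of u' v'] by (simp add: pt_Cons db_dual db_b)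
qed

lemma word_tensor_coeff:
  assumes "u \<in> words n k"
  shows "word_tensor k x (map db u) = x u"
proof -
  have "word_tensor k x (map db u) = (\<Sum>v\<in>words n k. if u = v then x v else 0)"
    unfolding word_tensor_apply using assms by (intro sum.cong) (auto simp: pt_words)
  then show ?thesis using assms by simp
qed

lemma pt_word_TP: "u \<in> words n k \<Longrightarrow> pt (map b u) \<in> TP k"
  using pt_TP [OF map_b_V1] words_length by (metis length_map)

lemma word_tensor_TP: "word_tensor k x \<in> TP k"
  unfolding word_tensor_def by (intro TP_sum TP_scale pt_word_TP)

lemma ev_word_tensor: "ev (word_tensor k x) = (\<Sum>u\<in>words n k. scale (x u) (prod_list (map b u)))"
  unfolding word_tensor_def
  by (subst ev_sum) (auto simp: ev_pt map_b_V1 intro: TP_TA [OF pt_word_TP])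

lemma words_independent:
  assumes R': "R' \<subseteq> TP m" and ker: "{T \<in> TA. ev T = 0} = tensor_ideal scale V1 R'" and k: "k < m"
    and x: "(\<Sum>u\<in>words n k. scale (x u) (prod_list (map b u))) = 0" and u: "u \<in> words n k"
  shows "x u = 0"
proof -
  have "word_tensor k x \<in> {T \<in> TA. ev T = 0}"
    using x TP_TA [OF word_tensor_TP] by (simp add: ev_word_tensor)
  then have "word_tensor k x (map db u) = 0"
    unfolding ker by (rule ideal_low_degree [OF R']) (use k words_length [OF u] in simp)
  then show ?thesis using word_tensor_coeff [OF u] by simp
qed

lemma gr_span_words:
  assumes "ev ` TA = UNIV"
  shows "gr j \<subseteq> span ((\<lambda>u. prod_list (map b u)) ` words n j)"
proof
  fix s assume "s \<in> gr j"
  then obtain T where T: "T \<in> TP j" "s = ev T"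
    using gr_eq_ev_TP [OF assms] by blast
  have "s = (\<Sum>u\<in>words n j. scale (T (map db u)) (prod_list (map b u)))"
    using ev_word_tensor [of j "\<lambda>u. T (map db u)"] TP_expand [OF T(1)] T(2) by simp
  also have "\<dots> \<in> span ((\<lambda>u. prod_list (map b u)) ` words n j)"
    by (intro span_sum span_scale span_base imageI)
  finally show "s \<in> span ((\<lambda>u. prod_list (map b u)) ` words n j)" .
qed

end

section \<open>Superpotentials as elements of \<open>W l\<close>\<close>

locale koszul_words = word_presentation scale gr n m b + generator_basis scale gr n b
  for scale :: "'k::field \<Rightarrow> 's::ring_1 \<Rightarrow> 's" and gr n m b
begin

abbreviation Rl :: "('s, 'k) tensor set" where "Rl \<equiv> relations scale gr m"

lemma relations_coeff:
  assumes "T \<in> Rl"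
  shows "(\<Sum>u\<in>words n m. scale (T (map db u)) (bw u)) = 0"
proof -
  have T: "T \<in> TP m" "ev T = 0" using assms by (auto simp: relations_iff)
  show ?thesis
    using ev_word_tensor [of m "\<lambda>u. T (map db u)"] TP_expand [OF T(1)] T(2) by (simp add: bw_def)
qed

lemma relations_W:
  assumes "T \<in> Rl"
  shows "(\<lambda>u. if u \<in> words n m then T (map db u) else 0) \<in> W m"
  using relations_coeff [OF assms] by (simp add: W_def cong: sum.cong)

lemma word_tensor_relations:
  assumes "(\<Sum>u\<in>words n m. scale (x u) (bw u)) = 0"
  shows "word_tensor m x \<in> Rl"
  using assms by (simp add: relations_iff word_tensor_TP ev_word_tensor bw_def)

lemma sandwich_coeff:
  assumes T: "T \<in> TP s \<otimes>\<^sub>s Rl \<otimes>\<^sub>s TP t" and pq: "length p = s" "length q = t"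
  shows "(\<Sum>u\<in>words n m. scale (T (map db (p @ u @ q))) (bw u)) = 0"
proof -
  let ?D = "{T. (\<Sum>u\<in>words n m. scale (T (map db (p @ u @ q))) (bw u)) = 0}"
  have "TP s \<otimes>\<^sub>s Rl \<otimes>\<^sub>s TP t \<subseteq> ?D"
    unfolding tensor_power_def [of scale V1 s] tensor_power_def [of scale V1 t]
  proof (rule tensor_subspace_mult_subset)
    show "tens.subspace ?D"
      unfolding tens.subspace_def
      by (auto simp: scale_left_distrib sum.distrib scale_sum_right [symmetric] simp flip: scale_scale)
    fix a r c assume a: "a \<in> pt ` {vs \<in> lists V1. length vs = s}" and r: "r \<in> Rl"
      and c: "c \<in> pt ` {vs \<in> lists V1. length vs = t}"
    have a0: "a gs = 0" if "length gs \<noteq> s" for gs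
      using a that by (auto simp: pure_tensor_def)
    have r0: "r gs = 0" if "length gs \<noteq> m" for gs
      using r tensor_power_length that by (auto simp: relations_iff)
    have "(a \<otimes>\<^sub>t r \<otimes>\<^sub>t c) (map db (p @ u @ q)) = a (map db p) * c (map db q) * r (map db u)"
      if u: "u \<in> words n m" for u
    proof -
      have ar: "(a \<otimes>\<^sub>t r) gs = 0" if "length gs \<noteq> s + m" for gs
        unfolding tensor_mult_def
      proof (intro sum.neutral ballI)
        fix i assume "i \<in> {..length gs}"
        then show "a (take i gs) * r (drop i gs) = 0"
          using a0 [of "take i gs"] r0 [of "drop i gs"] that by (cases "i = s") auto
      qed
      have "(a \<otimes>\<^sub>t r \<otimes>\<^sub>t c) (map db (p @ u @ q)) = (a \<otimes>\<^sub>t r \<otimes>\<^sub>t c) ((map db p @ map db u) @ map db q)"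
        by simp
      also have "\<dots> = (a \<otimes>\<^sub>t r) (map db p @ map db u) * c (map db q)"
        by (rule tensor_mult_append) (use ar pq words_length [OF u] in auto)
      also have "(a \<otimes>\<^sub>t r) (map db p @ map db u) = a (map db p) * r (map db u)"
        by (rule tensor_mult_append) (use a0 pq in auto)
      finally show ?thesis by simp
    qed
    then have "(\<Sum>u\<in>words n m. scale ((a \<otimes>\<^sub>t r \<otimes>\<^sub>t c) (map db (p @ u @ q))) (bw u)) =
        scale (a (map db p) * c (map db q)) (\<Sum>u\<in>words n m. scale (r (map db u)) (bw u))"
      by (simp add: scale_sum_right)
    then show "a \<otimes>\<^sub>t r \<otimes>\<^sub>t c \<in> ?D"
      using relations_coeff [OF r] by simp
  qed
  then show ?thesis using T by blast
qed

lemma superpotential_W: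
  assumes T: "\<And>s t. s + t = l - m \<Longrightarrow> T \<in> TP s \<otimes>\<^sub>s Rl \<otimes>\<^sub>s TP t" and l: "m \<le> l"
  shows "(\<lambda>u. if u \<in> words n l then T (map db u) else 0) \<in> W l"
proof -
  have "(\<Sum>u\<in>words n m. scale (if p @ u @ q \<in> words n l then T (map db (p @ u @ q)) else 0) (bw u)) = 0"
    if pq: "length p + m + length q = l" for p q
  proof (cases "set p \<union> set q \<subseteq> {..<n}")
    case True
    then have "p @ u @ q \<in> words n l" if "u \<in> words n m" for u
      using that pq by (auto simp: words_def)
    then have "(\<Sum>u\<in>words n m. scale (if p @ u @ q \<in> words n l then T (map db (p @ u @ q)) else 0) (bw u)) =
        (\<Sum>u\<in>words n m. scale (T (map db (p @ u @ q))) (bw u))"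
      by (intro sum.cong) auto
    also have "\<dots> = 0"
      using pq by (intro sandwich_coeff [OF T]) auto
    finally show ?thesis .
  next
    \<comment> \<open>Some outer letter is not the index of a basis vector, so all coefficients in
      the window are 0 by definition.\<close>
    case False
    then have "p @ u @ q \<notin> words n l" for u by (auto simp: words_def)
    then show ?thesis by simp
  qed
  then show ?thesis by (simp add: W_def)
qed

text \<open>Fixing the outer words groups the terms of \<open>y\<close> into products of a pure
  tensor, a relation and a pure tensor.\<close>

lemma W_superpotential:
  assumes y: "y \<in> W l" and st: "s + m + t = l"
  shows "word_tensor l y \<in> TP s \<otimes>\<^sub>s Rl \<otimes>\<^sub>s TP t"
proof -
  let ?r = "\<lambda>p q. word_tensor m (\<lambda>u. y (p @ u @ q))"
  have "word_tensor l y = (\<Sum>p\<in>words n s. \<Sum>q\<in>words n t. pt (map b p) \<otimes>\<^sub>t ?r p q \<otimes>\<^sub>t pt (map b q))"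
  proof
    fix fs
    have "(\<Sum>u\<in>words n m. y (p @ u @ q) * pt (map b p @ map b u @ map b q) fs) = (pt (map b p) \<otimes>\<^sub>t ?r p q \<otimes>\<^sub>t pt (map b q)) fs"
      for p q
    proof -
      have lin: "pt (map b p) \<otimes>\<^sub>t (\<Sum>u\<in>A. tscale (c u) (f u)) \<otimes>\<^sub>t pt (map b q) =
          (\<Sum>u\<in>A. tscale (c u) (pt (map b p) \<otimes>\<^sub>t f u \<otimes>\<^sub>t pt (map b q)))" if "finite A" for A :: "nat list set" and c f
        using that
      proof (induction A rule: finite_induct)
        case empty
        show ?case
          unfolding sum.empty tensor_mult_0_right tensor_mult_0_left ..
      next
        case (insert u A)
        then show ?case
          by (simp add: tensor_mult_add_right tensor_mult_add_left tensor_mult_scale_left tensor_mult_scale_right del: plus_fun_apply)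
      qed
      show ?thesis
        unfolding word_tensor_def lin [OF finite_words] by (simp add: sum_fun_apply pure_tensor_mult)
    qed
    moreover have "word_tensor l y fs = (\<Sum>p\<in>words n s. \<Sum>q\<in>words n t. \<Sum>u\<in>words n m. y (p @ u @ q) * pt (map b p @ map b u @ map b q) fs)"
      unfolding word_tensor_apply st [symmetric] add.assoc sum_words_add
      by (subst sum.swap [of _ "words n t"]) simp
    ultimately show "word_tensor l y fs = (\<Sum>p\<in>words n s. \<Sum>q\<in>words n t. pt (map b p) \<otimes>\<^sub>t ?r p q \<otimes>\<^sub>t pt (map b q)) fs"
      by (simp add: sum_fun_apply)
  qed
  moreover have "pt (map b p) \<otimes>\<^sub>t ?r p q \<otimes>\<^sub>t pt (map b q) \<in> TP s \<otimes>\<^sub>s Rl \<otimes>\<^sub>s TP t"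
    if p: "p \<in> words n s" and q: "q \<in> words n t" for p q
  proof -
    have "?r p q \<in> Rl"
      using W_rel [OF y, of p q] st words_length [OF p] words_length [OF q] by (intro word_tensor_relations) simp
    then show ?thesis
      using pt_word_TP p q by (intro tensor_subspace_multI)
  qed
  ultimately show ?thesis
    by (auto intro!: tens.subspace_sum [OF tensor_subspace_mult_subspace])
qed

text \<open>If a relation \<open>T\<close> were not a combination of slices, some functional would
  vanish on all slices of \<open>w\<close> but not at \<open>T\<close>. By
  \<open>relations_detected\<close> it is nonzero on a slice of some element of \<open>W l\<close>,
  contradicting that this element is a multiple of \<open>w\<close>.\<close>

theorem relations_subset_slices:
  assumes conc: "\<And>i. \<exists>n. \<forall>j. j \<noteq> n \<longrightarrow> Ext_vanishes gr triv triv i j" and AS: "AS_regular scale gr d (int l)"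
    and l: "m \<le> l" and w: "w \<in> TP l" "w \<noteq> 0"
    and int: "(\<Inter>(s, t)\<in>{(s, t). s + t = l - m}. TP s \<otimes>\<^sub>s Rl \<otimes>\<^sub>s TP t) = tens.span {w}"
  shows "Rl \<subseteq> tens.span {tensor_slice fs w | fs. set fs \<subseteq> dual scale V1 \<and> length fs = l - m}" (is "_ \<subseteq> ?S")
proof (rule ccontr)
  assume "\<not> Rl \<subseteq> ?S"
  then obtain T where T: "T \<in> Rl" "T \<notin> ?S" by blast
  obtain \<phi> where \<phi>: "Vector_Spaces.linear tscale (*) \<phi>" "\<forall>y\<in>?S. \<phi> y = 0" "\<phi> T = 1"
    using tens.linear_functional_extend [OF tens.subspace_span T(2)] by blast
  interpret \<phi>: Vector_Spaces.linear tscale "(*)" \<phi> by (rule \<phi>(1))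
  define \<rho> where "\<rho> = (\<lambda>u. \<phi> (pt (map b u)))"
  have \<phi>wt: "\<phi> (word_tensor k x) = (\<Sum>u\<in>words n k. x u * \<rho> u)" if "k = m" for k x
    unfolding word_tensor_def \<phi>.sum by (simp add: \<phi>.scale \<rho>_def)
  let ?x = "\<lambda>u. if u \<in> words n m then T (map db u) else 0"
  let ?wc = "\<lambda>u. if u \<in> words n l then w (map db u) else 0"
  have wst: "w \<in> TP s \<otimes>\<^sub>s Rl \<otimes>\<^sub>s TP t" if "s + t = l - m" for s t
    using int tens.span_base [of w "{w}"] that by blast
  have wcW: "?wc \<in> W l"
    by (rule superpotential_W [OF wst l])
  have "?wc \<noteq> 0"
  proof
    assume z: "?wc = 0"
    have "w (map db u) = 0" if "u \<in> words n l" for u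
      using fun_cong [OF z, of u] that by simp
    then have "word_tensor l (\<lambda>u. w (map db u)) = 0"
      unfolding word_tensor_def by (intro sum.neutral) (auto simp: fun_eq_iff)
    then show False
      using TP_expand [OF w(1)] w(2) by simp
  qed
  then have Wl: "W l \<noteq> {0}" using wcW by blast
  have "T = word_tensor m (\<lambda>u. T (map db u))"
    using T(1) by (intro TP_expand) (simp add: relations_iff)
  then have "\<phi> T = (\<Sum>u\<in>words n m. T (map db u) * \<rho> u)"
    using \<phi>wt by metis
  then have "(\<Sum>u\<in>words n m. \<rho> u * ?x u) \<noteq> 0"
    using \<phi>(3) by (simp add: mult.commute cong: sum.cong)
  then obtain p y where p: "length p + m = l" and y: "y \<in> W l" "(\<Sum>u\<in>words n m. \<rho> u * y (p @ u)) \<noteq> 0"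
    using relations_detected [OF conc Wl AS l relations_W [OF T(1)]] by blast
  \<comment> \<open>Here one-dimensionality enters: the element found in \<open>W l\<close> is a
    multiple of \<open>w\<close>, and its slice along the word \<open>p\<close> is the one along the
    dual basis functionals \<open>map db p\<close>.\<close>
  have "word_tensor l y \<in> tens.span {w}"
    unfolding int [symmetric] using W_superpotential [OF y(1)] l by auto
  then obtain c where c: "word_tensor l y = tscale c w"
    by (auto simp: tens.span_singleton)
  have yw: "y u = c * w (map db u)" if "u \<in> words n l" for u
    using word_tensor_coeff [OF that, of y] c by simp
  have pw: "p \<in> words n (length p)"
  proof (rule ccontr)
    assume "p \<notin> words n (length p)"
    then have "y (p @ u) = 0" for u
      using append_words [of p "length p" u n m] p by (intro W_support [OF y(1)]) auto
    then show False using y(2) by simp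
  qed
  let ?sl = "tensor_slice (map db p) w"
  have "?sl \<in> Rl"
    using slice_relations [OF wst, of "l - m" "map db p"] p by simp
  then have "?sl = word_tensor m (\<lambda>u. ?sl (map db u))"
    by (intro TP_expand) (simp add: relations_iff)
  then have "\<phi> ?sl = (\<Sum>u\<in>words n m. ?sl (map db u) * \<rho> u)"
    using \<phi>wt by metis
  moreover have "?sl \<in> ?S"
    using map_db_dual [of p] p by (intro tens.span_base) (auto intro!: exI [of _ "map db p"])
  ultimately have "(\<Sum>u\<in>words n m. w (map db (p @ u)) * \<rho> u) = 0"
    using \<phi>(2) by (simp add: tensor_slice_def)
  moreover have "(\<Sum>u\<in>words n m. \<rho> u * y (p @ u)) = c * (\<Sum>u\<in>words n m. w (map db (p @ u)) * \<rho> u)"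
  proof -
    have "p @ u \<in> words n l" if "u \<in> words n m" for u
      using pw that append_words [of p "length p" u n m] p by simp
    then show ?thesis
      unfolding sum_distrib_left by (intro sum.cong refl) (simp add: yw)
  qed
  ultimately show False using y(2) by simp
qed

end

section \<open>Automorphisms and the superpotential\<close>

context connected_graded_algebra
begin

text \<open>Contraction is natural: applying \<open>\<tau>\<close> to the slice of \<open>w\<close>
  along the functionals \<open>f \<circ> \<tau>\<close> gives the slice along the \<open>f\<close>
  of the image of \<open>w\<close>, which is a multiple of \<open>w\<close>. As
  \<open>\<tau>\<close> is invertible, every slice arises in this way, and slices span the
  relations.\<close>

lemma superpotential_preserves_relations:
  assumes \<tau>: "\<tau> \<in> GL scale V1" and w: "w \<in> TA" and fix_w: "tensor_map scale V1 \<tau> w \<in> tens.span {w}"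
    and R1: "relations scale gr m \<subseteq> tens.span {tensor_slice fs w | fs. set fs \<subseteq> dual scale V1 \<and> length fs = k}"
    and R2: "\<And>fs. length fs = k \<Longrightarrow> tensor_slice fs w \<in> relations scale gr m"
  shows "tensor_map scale V1 \<tau> ` relations scale gr m \<subseteq> relations scale gr m"
proof -
  let ?f = "tensor_map scale V1 \<tau>" and ?R = "relations scale gr m"
  obtain c where c: "?f w = tscale c w"
    using fix_w by (auto simp: tens.span_singleton)
  obtain \<tau>' where \<tau>': "\<tau>' \<in> GL scale V1" "\<forall>v\<in>V1. \<tau>' (\<tau> v) = v"
    using GL_inverse [OF \<tau> V1_subspace] by blast
  have comp: "g \<circ> \<sigma> \<in> dual scale V1" if "g \<in> dual scale V1" "\<sigma> \<in> GL scale V1" for g \<sigma>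
    using that GL_closed [OF that(2)] by (auto simp: dual_def GL_def linear_on_def)
  have "?f (tensor_slice gs w) \<in> ?R" if gs: "set gs \<subseteq> dual scale V1" "length gs = k" for gs
  proof -
    \<comment> \<open>Precomposition with \<open>\<tau>'\<close> is undone by \<open>\<tau>\<close>
      on \<open>V\<close>, so the functionals \<open>gs\<close> may be replaced by these followed by
      \<open>\<tau>\<close> without changing the slice of \<open>w\<close>.\<close>
    let ?fs = "map (\<lambda>g. g \<circ> \<tau>') gs"
    have fs: "set ?fs \<subseteq> dual scale V1"
      using gs(1) comp \<tau>'(1) by auto
    have fs': "set (map (\<lambda>f. f \<circ> \<tau>) ?fs) \<subseteq> dual scale V1"
      using fs comp \<tau> by auto
    have "tensor_slice gs w = tensor_slice (map (\<lambda>f. f \<circ> \<tau>) ?fs) w"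
    proof
      fix hs
      show "tensor_slice gs w hs = tensor_slice (map (\<lambda>f. f \<circ> \<tau>) ?fs) w hs"
      proof (cases "set hs \<subseteq> dual scale V1")
        case True
        have "list_all2 (\<lambda>f g. \<forall>v\<in>V1. f v = g v) gs (map (\<lambda>f. f \<circ> \<tau>) ?fs)"
          using \<tau>'(2) by (auto simp: list_all2_conv_all_nth)
        moreover have "list_all2 (\<lambda>f g. \<forall>v\<in>V1. f v = g v) hs hs"
          by (rule list.rel_refl) simp
        ultimately have "list_all2 (\<lambda>f g. \<forall>v\<in>V1. f v = g v) (gs @ hs) (map (\<lambda>f. f \<circ> \<tau>) ?fs @ hs)"
          by (rule list_all2_appendI)
        then show ?thesis
          unfolding tensor_slice_def using gs(1) fs' True by (intro tensor_algebra_cong [OF w]) auto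
      next
        case False
        then show ?thesis
          unfolding tensor_slice_def using tensor_algebra_dual [OF w] by (metis Un_subset_iff set_append)
      qed
    qed
    then have "?f (tensor_slice gs w) = tensor_slice ?fs (tscale c w)"
      using tensor_map_slice [OF fs, of \<tau> w] c by simp
    also have "\<dots> = tscale c (tensor_slice ?fs w)"
      by (simp add: tensor_slice_def)
    also have "\<dots> \<in> ?R"
      using tens.subspace_scale [OF relations_subspace R2] gs(2) by simp
    finally show ?thesis .
  qed
  then have "tens.span {tensor_slice fs w | fs. set fs \<subseteq> dual scale V1 \<and> length fs = k} \<subseteq> {T. ?f T \<in> ?R}"
    by (intro tens.span_minimal subspace_tensor_map relations_subspace) blast
  then show ?thesis using R1 by blast
qed

text \<open>\<open>S\<close> is a quotient of the tensor algebra by evaluation, and the action of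
  \<open>\<tau>\<close> descends because it preserves the kernel. The inverse \<open>\<tau>'\<close>
  descends for the same reason, which makes the induced map bijective.\<close>

lemma GL_extends_to_aut:
  assumes surj: "ev ` TA = UNIV" and R': "R' \<subseteq> TP m" and ker: "{T \<in> TA. ev T = 0} = tensor_ideal scale V1 R'"
    and \<tau>: "\<tau> \<in> GL scale V1" and \<tau>': "\<tau>' \<in> GL scale V1" and inv: "\<And>v. v \<in> V1 \<Longrightarrow> \<tau>' (\<tau> v) = v" "\<And>v. v \<in> V1 \<Longrightarrow> \<tau> (\<tau>' v) = v"
    and pres: "tensor_map scale V1 \<tau> ` relations scale gr m \<subseteq> relations scale gr m"
      "tensor_map scale V1 \<tau>' ` relations scale gr m \<subseteq> relations scale gr m"
  shows "\<exists>\<sigma>\<in>graded_algebra_aut scale gr. restrict \<sigma> V1 = \<tau>"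
proof -
  let ?f = "tensor_map scale V1"
  define lift where "lift = (\<lambda>s. SOME T. T \<in> TA \<and> ev T = s)"
  have lift: "lift s \<in> TA" "ev (lift s) = s" for s
  proof -
    have "\<exists>T. T \<in> TA \<and> ev T = s" using surj by (metis UNIV_I imageE)
    from someI_ex [OF this] show "lift s \<in> TA" "ev (lift s) = s" by (auto simp: lift_def)
  qed
  define ext where "ext = (\<lambda>\<sigma> s. ev (?f \<sigma> (lift s)))"
  have ext: "ext \<sigma> (ev T) = ev (?f \<sigma> T)"
    if \<sigma>: "\<sigma> \<in> GL scale V1" "?f \<sigma> ` relations scale gr m \<subseteq> relations scale gr m" and T: "T \<in> TA" for \<sigma> T
  proof -
    let ?L = "lift (ev T)"
    have U: "tscale (-1) T \<in> TA" by (rule TA_scale [OF T])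
    \<comment> \<open>The induced map is independent of the chosen preimage: the difference of two
      preimages lies in the kernel of evaluation.\<close>
    have "ev (?L + tscale (-1) T) = 0"
      unfolding ev_add [OF lift(1) U] ev_scale [OF T] lift(2) by simp
    then have "ev (?f \<sigma> (?L + tscale (-1) T)) = 0"
      by (intro ev_tensor_map_kernel [OF R' ker \<sigma>] TA_add lift(1) U)
    then have "ev (?f \<sigma> ?L) + scale (-1) (ev (?f \<sigma> T)) = 0"
      unfolding tensor_map_add tensor_map_scale
        ev_add [OF tensor_map_algebra [OF \<sigma>(1) lift(1)] TA_scale [OF tensor_map_algebra [OF \<sigma>(1) T]]]
        ev_scale [OF tensor_map_algebra [OF \<sigma>(1) T]] .
    then show ?thesis by (simp add: ext_def)
  qed
  note e = ext [OF \<tau> pres(1)] and e' = ext [OF \<tau>' pres(2)]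
  have inv1: "ext \<tau>' (ext \<tau> s) = s" for s
    using e [OF lift(1)] e' [OF tensor_map_algebra [OF \<tau> lift(1)]] tensor_map_inverse [OF \<tau> \<tau>' inv(1) lift(1)] lift(2) by metis
  have inv2: "ext \<tau> (ext \<tau>' s) = s" for s
    using e' [OF lift(1)] e [OF tensor_map_algebra [OF \<tau>' lift(1)]] tensor_map_inverse [OF \<tau>' \<tau> inv(2) lift(1)] lift(2) by metis
  have "bij (ext \<tau>)"
    by (rule bij_betw_byWitness [where f' = "ext \<tau>'"]) (auto simp: inv1 inv2)
  moreover have "ext \<tau> (x + y) = ext \<tau> x + ext \<tau> y" for x y
  proof -
    have "ext \<tau> (ev (lift x + lift y)) = ev (?f \<tau> (lift x)) + ev (?f \<tau> (lift y))"
      unfolding e [OF TA_add [OF lift(1) lift(1)]] tensor_map_add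
      by (intro ev_add tensor_map_algebra [OF \<tau>] lift(1))
    then show ?thesis by (simp add: ev_add lift ext_def del: plus_fun_apply)
  qed
  moreover have "ext \<tau> (scale c x) = scale c (ext \<tau> x)" for c x
  proof -
    have "ext \<tau> (ev (tscale c (lift x))) = scale c (ev (?f \<tau> (lift x)))"
      unfolding e [OF TA_scale [OF lift(1)]] tensor_map_scale
      by (intro ev_scale tensor_map_algebra [OF \<tau>] lift(1))
    then show ?thesis by (simp add: ev_scale lift ext_def)
  qed
  moreover have "ext \<tau> (x * y) = ext \<tau> x * ext \<tau> y" for x y
  proof -
    have m: "lift x \<otimes>\<^sub>t lift y \<in> TA" "ev (lift x \<otimes>\<^sub>t lift y) = x * y"
      using TA_mult [OF lift(1) lift(1)] lift(2) by auto
    have "ext \<tau> (ev (lift x \<otimes>\<^sub>t lift y)) = ev (?f \<tau> (lift x)) * ev (?f \<tau> (lift y))"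
      unfolding e [OF m(1)] tensor_map_mult
      using TA_mult [OF tensor_map_algebra [OF \<tau> lift(1)] tensor_map_algebra [OF \<tau> lift(1)]] by blast
    then show ?thesis by (simp add: m ext_def)
  qed
  moreover have "ext \<tau> 1 = 1"
  proof -
    have "ev (pt []) = 1" using ev_pt [of "[]"] by simp
    moreover have "?f \<tau> (pt []) = pt []" using tensor_map_pure_tensor [OF \<tau>, of "[]"] by simp
    ultimately show ?thesis using e [OF pt_TA, of "[]"] by simp
  qed
  moreover have "ext \<tau> ` gr i = gr i" for i
  proof -
    have TPf: "?f \<tau> ` TP i = TP i"
    proof
      show "?f \<tau> ` TP i \<subseteq> TP i" using tensor_map_power [OF \<tau>] by blast
      show "TP i \<subseteq> ?f \<tau> ` TP i"
        using tensor_map_power [OF \<tau>'] tensor_map_inverse [OF \<tau>' \<tau> inv(2) TP_TA] by (metis imageI subsetI)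
    qed
    have "ext \<tau> ` gr i = ext \<tau> ` (ev ` TP i)"
      using gr_eq_ev_TP [OF surj, of i] by (rule arg_cong)
    also have "\<dots> = (\<lambda>T. ev (?f \<tau> T)) ` TP i"
      unfolding image_image using e TP_TA by (intro image_cong) auto
    also have "\<dots> = ev ` (?f \<tau> ` TP i)" by (simp add: image_image)
    also have "\<dots> = gr i" unfolding TPf by (rule gr_eq_ev_TP [OF surj, symmetric])
    finally show ?thesis .
  qed
  ultimately have "ext \<tau> \<in> graded_algebra_aut scale gr"
    by (simp add: graded_algebra_aut_def linear_on_def)
  moreover have "restrict (ext \<tau>) V1 = \<tau>"
  proof
    fix v
    show "restrict (ext \<tau>) V1 v = \<tau> v"
    proof (cases "v \<in> V1")
      case True
      then have "ext \<tau> (ev (pt [v])) = ev (pt [\<tau> v])"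
        using e [OF pt_TA, of "[v]"] tensor_map_pure_tensor [OF \<tau>, of "[v]"] by simp
      then show ?thesis
        using True GL_closed [OF \<tau>] by (simp add: ev_pt)
    next
      case False
      then show ?thesis using \<tau> by (simp add: GL_def extensional_def)
    qed
  qed
  ultimately show ?thesis by blast
qed

end

text \<open>Automorphisms are identified with elements of \<open>GL(V)\<close> by restriction to
  \<open>V\<close>, so the equality of groups becomes bijectivity of restriction onto the stabilizer
  of the line.\<close>

theorem theorem1p1:
  fixes scale :: "'k::field \<Rightarrow> 's::ring_1 \<Rightarrow> 's"
    and gr :: "nat \<Rightarrow> 's set"
    and m d l :: nat
    and w :: "('s, 'k) tensor"
  defines "V \<equiv> gr 1"
  defines "R \<equiv> relations scale gr m"
  assumes "m_Koszul scale gr m"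
    and "AS_regular scale gr d (int l)"
    and "m \<le> l"
    and "w \<noteq> 0"
    and "(\<Inter>(s, t)\<in>{(s, t). s + t = l - m}. tensor_power scale V s \<otimes>\<^sub>s R \<otimes>\<^sub>s tensor_power scale V t)
           = tens.span {w}"
  shows "bij_betw (\<lambda>\<sigma>. restrict \<sigma> V) (graded_algebra_aut scale gr)
           {\<sigma> \<in> GL scale V. tensor_map scale V \<sigma> ` tens.span {w} = tens.span {w}}"
proof -
  note K = \<open>m_Koszul scale gr m\<close> [unfolded m_Koszul_def]
  interpret connected_graded_algebra scale gr using K by blast
  have V: "V = V1" by (simp add: V_def V1_def)
  obtain R' where R': "R' \<subseteq> TP m" "ev ` TA = UNIV" "{T \<in> TA. ev T = 0} = tensor_ideal scale V1 R'"
    using K unfolding V1_def by blast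
  have conc: "\<exists>n. \<forall>j. j \<noteq> n \<longrightarrow> Ext_vanishes gr triv triv i j" for i
    using K by blast
  have int: "(\<Inter>(s, t)\<in>{(s, t). s + t = l - m}. TP s \<otimes>\<^sub>s R \<otimes>\<^sub>s TP t) = tens.span {w}"
    using assms(7) by (simp only: V)
  have sandwich: "T \<in> TP s \<otimes>\<^sub>s R \<otimes>\<^sub>s TP t" if "s + t = l - m" "T \<in> tens.span {w}" for T s t
    using int that by blast
  have w_span: "w \<in> tens.span {w}" by (simp add: tens.span_base)
  \<comment> \<open>The member of the intersection with \<open>s = l - m\<close> and
    \<open>t = 0\<close> places \<open>w\<close> in the tensor power of degree
    \<open>l\<close>.\<close>
  have wTP: "w \<in> TP l"
  proof -
    have "TP (l - m) \<otimes>\<^sub>s R \<otimes>\<^sub>s TP 0 \<subseteq> TP l"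
      unfolding tensor_power_def [of scale V1 "l - m"] tensor_power_def [of scale V1 0]
    proof (rule tensor_subspace_mult_subset [OF tensor_power_subspace])
      fix a r c assume a: "a \<in> pt ` {vs \<in> lists V1. length vs = l - m}" and r: "r \<in> R"
        and c: "c \<in> pt ` {vs \<in> lists V1. length vs = 0}"
      obtain vs where vs: "vs \<in> lists V1" "length vs = l - m" "a = pt vs" using a by blast
      have "TP m \<subseteq> {r. pt vs \<otimes>\<^sub>t r \<in> TP l}"
      proof (rule tensor_power_minimal [OF subspace_tensor_mult_right [OF tensor_power_subspace]])
        fix us assume "us \<in> lists V1" "length us = m"
        then show "pt us \<in> {r. pt vs \<otimes>\<^sub>t r \<in> TP l}"
          using pt_TP [of "vs @ us"] vs \<open>m \<le> l\<close> by (simp add: pure_tensor_mult)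
      qed
      then have "pt vs \<otimes>\<^sub>t r \<in> TP l" using r by (auto simp: R_def relations_iff)
      moreover have "c = pt []" using c by auto
      ultimately show "a \<otimes>\<^sub>t r \<otimes>\<^sub>t c \<in> TP l" using vs by (simp add: pt_Nil_mult)
    qed
    then show ?thesis using sandwich [of "l - m" 0, OF _ w_span] by auto
  qed
  obtain B0 where B0: "finite B0" "span B0 = V1"
    using K unfolding V1_def by blast
  obtain B where B: "B \<subseteq> V1" "independent B" "V1 \<subseteq> span B"
    using maximal_independent_subset by blast
  then have sB: "span B = V1" using span_minimal [OF _ V1_subspace] by blast
  have "finite B" using independent_span_bound [OF B0(1) B(2)] B(1) B0(2) by blast
  then obtain b where b: "bij_betw b {..<card B} B"
    using ex_bij_betw_nat_finite by (metis atLeast0LessThan)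
  let ?n = "card B"
  have bB: "b ` {..<?n} = B" using b by (simp add: bij_betw_def)
  interpret generator_basis scale gr ?n b
    by unfold_locales (use b B(2) sB bB in \<open>auto simp: bij_betw_def\<close>)
  interpret koszul_words scale gr ?n m b
  proof
    show "2 \<le> m" using K by blast
    show "b i \<in> gr 1" if "i < ?n" for i using b_V1 [OF that] by (simp add: V1_def)
    show "gr j \<subseteq> span ((\<lambda>u. prod_list (map b u)) ` words ?n j)" for j
      by (rule gr_span_words [OF R'(2)])
    show "x u = 0" if "k < m" "(\<Sum>u\<in>words ?n k. scale (x u) (prod_list (map b u))) = 0" "u \<in> words ?n k" for k x u
      by (rule words_independent [OF R'(1,3) that])
  qed
  have R1: "R \<subseteq> tens.span {tensor_slice fs w | fs. set fs \<subseteq> dual scale V1 \<and> length fs = l - m}"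
    unfolding R_def
    by (rule relations_subset_slices [OF conc \<open>AS_regular scale gr d (int l)\<close> \<open>m \<le> l\<close> wTP \<open>w \<noteq> 0\<close> int [unfolded R_def]])
  have R2: "tensor_slice fs w \<in> R" if "length fs = l - m" for fs
    using sandwich [OF _ w_span, of "l - m" 0] that slice_relations unfolding R_def by simp
  let ?f = "tensor_map scale V1"
  let ?G = "{\<sigma> \<in> GL scale V1. ?f \<sigma> ` tens.span {w} = tens.span {w}}"
  have presR: "?f \<tau> ` R \<subseteq> R" if "\<tau> \<in> GL scale V1" "?f \<tau> ` tens.span {w} = tens.span {w}" for \<tau>
    unfolding R_def
    using that w_span R1 R2 unfolding R_def
    by (intro superpotential_preserves_relations [OF that(1) TP_TA [OF wTP], of _ "l - m"]) auto
  have "inj_on (\<lambda>\<sigma>. restrict \<sigma> V1) (graded_algebra_aut scale gr)"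
  proof (rule inj_onI)
    fix \<sigma> \<sigma>' assume *: "\<sigma> \<in> graded_algebra_aut scale gr" "\<sigma>' \<in> graded_algebra_aut scale gr" "restrict \<sigma> V1 = restrict \<sigma>' V1"
    show "\<sigma> = \<sigma>'"
    proof
      fix s
      obtain T where T: "T \<in> TA" "s = ev T" using R'(2) by blast
      then show "\<sigma> s = \<sigma>' s"
        using aut_tensor_map(2) [OF *(1) T(1)] aut_tensor_map(2) [OF *(2) T(1)] *(3) by simp
    qed
  qed
  moreover have "restrict \<sigma> V1 \<in> ?G" if \<sigma>: "\<sigma> \<in> graded_algebra_aut scale gr" for \<sigma>
  proof -
    let ?\<tau> = "restrict \<sigma> V1"
    note \<tau> = aut_tensor_map(1) [OF \<sigma>]
    have "\<sigma> 0 = 0"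
      using aut_tensor_map(2) [OF \<sigma> TA_0] by (simp add: tensor_map_0)
    then have "?f ?\<tau> ` R \<subseteq> R"
      using tensor_map_power [OF \<tau>] aut_tensor_map(2) [OF \<sigma> TP_TA] by (auto simp: R_def relations_iff)
    \<comment> \<open>A map preserving the relations preserves each of the intersected spaces, hence
      the intersection, which is the line of \<open>w\<close>.\<close>
    then have "?f ?\<tau> w \<in> TP s \<otimes>\<^sub>s R \<otimes>\<^sub>s TP t" if "s + t = l - m" for s t
      by (intro tensor_map_sandwich [OF \<tau>] sandwich [OF that w_span])
    then have "?f ?\<tau> w \<in> tens.span {w}"
      unfolding int [symmetric] by blast
    then obtain c where c: "?f ?\<tau> w = tscale c w"
      by (auto simp: tens.span_singleton)
    obtain \<tau>' where \<tau>': "\<tau>' \<in> GL scale V1" "\<forall>v\<in>V1. \<tau>' (?\<tau> v) = v"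
      using GL_inverse [OF \<tau> V1_subspace] by blast
    \<comment> \<open>The inverse of the restricted map recovers \<open>w\<close> from its image, so
      the line is mapped onto itself and not to zero.\<close>
    have "c \<noteq> 0"
    proof
      assume "c = 0"
      then have "?f ?\<tau> w = 0" using c by (simp add: fun_eq_iff)
      then have "?f \<tau>' (?f ?\<tau> w) = 0" by (simp only: tensor_map_0)
      then show False
        using tensor_map_inverse [OF \<tau> \<tau>'(1) _ TP_TA [OF wTP]] \<tau>'(2) \<open>w \<noteq> 0\<close> by metis
    qed
    have "?f ?\<tau> (tscale a w) = tscale (a * c) w" for a
      unfolding tensor_map_scale c by (rule ext) (simp only: mult.assoc)
    then have "?f ?\<tau> ` tens.span {w} = range (\<lambda>a. tscale (a * c) w)"
      by (simp add: tens.span_singleton image_image)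
    also have "\<dots> = tens.span {w}"
      unfolding tens.span_singleton
    proof (intro set_eqI iffI)
      fix T assume "T \<in> range (\<lambda>a. tscale a w)"
      then obtain a where "T = tscale a w" by blast
      then show "T \<in> range (\<lambda>a. tscale (a * c) w)"
        using \<open>c \<noteq> 0\<close> by (intro range_eqI [of _ _ "a / c"]) simp
    qed blast
    finally show ?thesis using \<tau> by blast
  qed
  moreover have "\<tau> \<in> (\<lambda>\<sigma>. restrict \<sigma> V1) ` graded_algebra_aut scale gr" if "\<tau> \<in> ?G" for \<tau>
  proof -
    have \<tau>: "\<tau> \<in> GL scale V1" "?f \<tau> ` tens.span {w} = tens.span {w}" using that by auto
    obtain \<tau>' where \<tau>': "\<tau>' \<in> GL scale V1" "\<forall>v\<in>V1. \<tau>' (\<tau> v) = v" "\<forall>v\<in>V1. \<tau> (\<tau>' v) = v"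
      using GL_inverse [OF \<tau>(1) V1_subspace] by blast
    have spTA: "T \<in> TA" if "T \<in> tens.span {w}" for T
      using that tens.span_minimal [OF _ tensor_algebra_subspace, of "{w}" scale V1] TP_TA [OF wTP] by blast
    \<comment> \<open>The inverse stabilizes the line as well, so it too preserves the relations, as
      the extension to an automorphism demands.\<close>
    have "?f \<tau>' (?f \<tau> T) = T" if "T \<in> tens.span {w}" for T
      using tensor_map_inverse [OF \<tau>(1) \<tau>'(1) _ spTA [OF that]] \<tau>'(2) by blast
    then have "(\<lambda>T. ?f \<tau>' (?f \<tau> T)) ` tens.span {w} = (\<lambda>T. T) ` tens.span {w}"
      by (rule image_cong [OF refl])
    then have "?f \<tau>' ` (?f \<tau> ` tens.span {w}) = tens.span {w}"
      unfolding image_image image_ident .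
    then have "?f \<tau>' ` tens.span {w} = tens.span {w}"
      using \<tau>(2) by simp
    then have "\<exists>\<sigma>\<in>graded_algebra_aut scale gr. restrict \<sigma> V1 = \<tau>"
      using presR [OF \<tau>] presR [OF \<tau>'(1)] \<tau>'(2,3) unfolding R_def
      by (intro GL_extends_to_aut [OF R'(2,1,3) \<tau>(1) \<tau>'(1)]) auto
    then show ?thesis by blast
  qed
  ultimately show ?thesis
    unfolding bij_betw_def V by blast
qed

end
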